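(* Let $\varepsilon>0$, and let $Y$ (depending on $\varepsilon$) and its closed subspace $X_\varepsilon\subset Y$ be the Banach spaces defined in the context. Then the space $X_\varepsilon$ does not have the approximation property. Moreover, there exists a constant $C_\varepsilon>0$ such that for every integer $n\geq 2$ and every $n$-dimensional subspace $E$ of $X_\varepsilon$: 1) $d(E,\ell^2_n)\leq C_\varepsilon(\log n)^{1+\varepsilon}$; 2) $E$ is $C_\varepsilon(\log n)^{1+\varepsilon}$-complemented in $Y$ (and hence in $X_\varepsilon$).
   Context: $d(\cdot,\cdot)$ is the Banach–Mazur distance, and $\ell^2_n$ is $n$-dimensional Hilbert space. A subspace $E$ of a Banach space $Z$ is $K$-complemented in $Z$ if there is a linear projection from $Z$ onto $E$ of norm at most $K$. $|A|$ denotes the cardinality of a finite set $A$. Basic data. For integers $n\ge 1$ let $I_n=\{2^n,2^n+1,\dots,2^{n+1}-1\}$. Let $(e_k)_{k\ge1}$ be the standard basis of $c_0$ and $(e_k')_{k\ge1}$ the coordinate functionals. For $i\ge 1$ let $$z_i=e_{2i}-e_{2i+1}+e_{4i}+e_{4i+1}+e_{4i+2}+e_{4i+3},\qquad z_i'=\tfrac12(e'_{2i}-e'_{2i+1}),$$ and let $W$ be the linear span of $\{z_i: i\ge1\}$. For a linear map $U:W\to W$ and $n\ge1$ put $\beta_n(U)=2^{-n}\sum_{i\in I_n}\langle z_i',Uz_i\rangle$. Partitions. Fix partitions $\Delta_n$ and $\nabla_n$ of $I_n$ ($n\ge1$), finitely supported scalar sequences $y_j\in W$ ($j\ge 1$),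 integers $m_n\geq 1$, and a constant $C>0$ independent of $n$, with the following properties (such objects exist by a construction of Szankowski, Israel J. Math. 30 (1978), 123–130): (a) for every linear $U:W\to W$ and every $n\ge2$, $\beta_n(U)-\beta_{n-1}(U)=2^{-n-1}\sum_{j\in I_{n+1}}\langle e_j',Uy_j\rangle$; (b) every $B\in\nabla_n$ has $|B|=m_n$, where $m_n\ge C2^{n/8}$ (hence $|\nabla_n|=2^n/m_n$); (c) if $A\in\Delta_n$ and $B\in\nabla_n$, then $|A\cap B|\le1$ and $|A|\ge C2^{7n/8}$; (d) for $n\ge2$, $B\in\nabla_n$ and any signs $\varepsilon_i=\pm1$ ($i\in B$), one can write $\sum_{i\in B}\varepsilon_iy_i=\sum_{j=1}^{10}\sum_{i\in A_j}\eta_{j,i}e_i$ with signs $\eta_{j,i}=\pm1$, where each $A_j$ ($j=1,\dots,10$) is a subset of some element of $\Delta_{n-1}$, $\Delta_n$ or $\Delta_{n+1}$ and $|A_j|=|B|$. The spaces. Let $a=2^{1/8}$ and define $p_n\in[1,2]$ by $$\frac1{p_n}-\frac12=\frac{1}{n}\log_a\left(n^{1+\varepsilon}\right)$$ for all $n\geq 1$ for which the right-hand side is at most $\tfrac12$, and $p_n=1$ for the finitely many remaining $n$. Let $$Y=\Bigl(\sum_{n\ge1}\Bigl(\sum_{A\in\Delta_n}\ell^2_{|A|}\Bigr)_{\ell^{p_n}}\Bigr)_{\ell^2},$$ that is, $Y$ is the Banach space of scalar sequences $x=(x_k)_{k\ge2}$ with $$\|x\|_Y=\Bigl(\sum_{n\ge1}\Bigl(\sum_{A\in\Delta_n}\bigl(\sum_{k\in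 A}|x_k|^2\bigr)^{p_n/2}\Bigr)^{2/p_n}\Bigr)^{1/2}<\infty .$$ The finitely supported sequences $z_i$ are regarded as elements of $Y$, and $X_\varepsilon$ is the closure of $W$ in $Y$. *)

theory Defs
  imports "HOL-Analysis.Analysis" "HOL-Library.Function_Algebras" "HOL-Library.Disjoint_Sets"
begin

text \<open>
  Scalars range over a type of class \<open>real_normed_field\<close> and \<open>euclidean_space\<close>. Up to isometric
  isomorphism the only such types are the real and the complex numbers, so that both cases are
  covered. A normed space is given by a carrier, which is a linear subspace of the space of all
  scalar sequences, and a norm, which is only meaningful on that carrier.
\<close>

definition seq_scale :: "'k \<Rightarrow> (nat \<Rightarrow> 'k) \<Rightarrow> nat \<Rightarrow> 'k::{real_normed_field,euclidean_space}"
    (infixr "*\<^sub>q" 75)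
  where "c *\<^sub>q x = (\<lambda>k. c * x k)"

global_interpretation seqs: vector_space
  "seq_scale :: 'k \<Rightarrow> (nat \<Rightarrow> 'k) \<Rightarrow> nat \<Rightarrow> 'k::{real_normed_field,euclidean_space}"
  by standard (auto simp: seq_scale_def fun_eq_iff algebra_simps)


section \<open>Normed spaces of scalar sequences\<close>

definition linear_map ::
    "(nat \<Rightarrow> 'k::{real_normed_field,euclidean_space}) set \<Rightarrow> (nat \<Rightarrow> 'k) set
      \<Rightarrow> ((nat \<Rightarrow> 'k) \<Rightarrow> (nat \<Rightarrow> 'k)) \<Rightarrow> bool"
  where "linear_map S S' T \<longleftrightarrow> T \<in> S \<rightarrow> S' \<and>
    (\<forall>x\<in>S. \<forall>y\<in>S. T (x + y) = T x + T y) \<and> (\<forall>c. \<forall>x\<in>S. T (c *\<^sub>q x) = c *\<^sub>q T x)"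

definition op_norm ::
    "(nat \<Rightarrow> 'k::{real_normed_field,euclidean_space}) set \<Rightarrow> ((nat \<Rightarrow> 'k) \<Rightarrow> real)
      \<Rightarrow> ((nat \<Rightarrow> 'k) \<Rightarrow> real) \<Rightarrow> ((nat \<Rightarrow> 'k) \<Rightarrow> (nat \<Rightarrow> 'k)) \<Rightarrow> ennreal"
  where "op_norm S N N' T = (SUP x\<in>{x \<in> S. N x \<le> 1}. ennreal (N' (T x)))"

abbreviation norm_topology ::
    "(nat \<Rightarrow> 'k::{real_normed_field,euclidean_space}) set \<Rightarrow> ((nat \<Rightarrow> 'k) \<Rightarrow> real)
      \<Rightarrow> (nat \<Rightarrow> 'k) topology"
  where "norm_topology S N \<equiv> Metric_space.mtopology S (\<lambda>x y. N (x - y))"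

definition finite_rank ::
    "(nat \<Rightarrow> 'k::{real_normed_field,euclidean_space}) set
      \<Rightarrow> ((nat \<Rightarrow> 'k) \<Rightarrow> (nat \<Rightarrow> 'k)) \<Rightarrow> bool"
  where "finite_rank S T \<longleftrightarrow> (\<exists>F. finite F \<and> T ` S \<subseteq> seqs.span F)"

definition approximation_property ::
    "(nat \<Rightarrow> 'k::{real_normed_field,euclidean_space}) set \<Rightarrow> ((nat \<Rightarrow> 'k) \<Rightarrow> real) \<Rightarrow> bool"
  where "approximation_property S N \<longleftrightarrow>
    (\<forall>K \<delta>. compactin (norm_topology S N) K \<and> \<delta> > 0 \<longrightarrow>
      (\<exists>T. linear_map S S T \<and> op_norm S N N T < top \<and> finite_rank S T \<and>
        (\<forall>x\<in>K. N (T x - x) \<le> \<delta>)))"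

text \<open>The distance of two non-isomorphic spaces is the infimum of the empty set, hence infinite.\<close>

definition banach_mazur ::
    "(nat \<Rightarrow> 'k::{real_normed_field,euclidean_space}) set \<Rightarrow> ((nat \<Rightarrow> 'k) \<Rightarrow> real)
      \<Rightarrow> (nat \<Rightarrow> 'k) set \<Rightarrow> ((nat \<Rightarrow> 'k) \<Rightarrow> real) \<Rightarrow> ennreal"
  where "banach_mazur S N S' N' =
    (INF T\<in>{T. linear_map S S' T \<and> bij_betw T S S' \<and>
              op_norm S N N' T < top \<and> op_norm S' N' N (inv_into S T) < top}.
      op_norm S N N' T * op_norm S' N' N (inv_into S T))"

definition complemented ::
    "real \<Rightarrow> (nat \<Rightarrow> 'k::{real_normed_field,euclidean_space}) set \<Rightarrow> (nat \<Rightarrow> 'k) set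
      \<Rightarrow> ((nat \<Rightarrow> 'k) \<Rightarrow> real) \<Rightarrow> bool"
  where "complemented K E S N \<longleftrightarrow> E \<subseteq> S \<and>
    (\<exists>P. linear_map S E P \<and> (\<forall>x\<in>E. P x = x) \<and> op_norm S N N P \<le> ennreal K)"

definition ell2 :: "nat \<Rightarrow> (nat \<Rightarrow> 'k::{real_normed_field,euclidean_space}) set"
  where "ell2 n = {x. \<forall>k\<ge>n. x k = 0}"

definition ell2_norm :: "nat \<Rightarrow> (nat \<Rightarrow> 'k::{real_normed_field,euclidean_space}) \<Rightarrow> real"
  where "ell2_norm n x = sqrt (\<Sum>k<n. (norm (x k))\<^sup>2)"


section \<open>The vectors z and their span\<close>

definition dyadic :: "nat \<Rightarrow> nat set"
  where "dyadic n = {2 ^ n..<2 ^ (n + 1)}"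

definition unit_seq :: "nat \<Rightarrow> nat \<Rightarrow> 'k::{real_normed_field,euclidean_space}"
  where "unit_seq k = (\<lambda>i. if i = k then 1 else 0)"

definition z :: "nat \<Rightarrow> nat \<Rightarrow> 'k::{real_normed_field,euclidean_space}"
  where "z i = unit_seq (2 * i) - unit_seq (2 * i + 1)
    + unit_seq (4 * i) + unit_seq (4 * i + 1) + unit_seq (4 * i + 2) + unit_seq (4 * i + 3)"

definition z' :: "nat \<Rightarrow> (nat \<Rightarrow> 'k) \<Rightarrow> 'k::{real_normed_field,euclidean_space}"
  where "z' i x = (1 / 2) * (x (2 * i) - x (2 * i + 1))"

definition W :: "(nat \<Rightarrow> 'k::{real_normed_field,euclidean_space}) set"
  where "W = seqs.span (z ` {1..})"

definition beta ::
    "nat \<Rightarrow> ((nat \<Rightarrow> 'k) \<Rightarrow> (nat \<Rightarrow> 'k)) \<Rightarrow> 'k::{real_normed_field,euclidean_space}"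
  where "beta n U = (1 / 2 ^ n) * (\<Sum>i\<in>dyadic n. z' i (U (z i)))"


section \<open>The spaces Y and X\<close>

definition exponent_gap :: "real \<Rightarrow> nat \<Rightarrow> real"
  where "exponent_gap \<epsilon> n = (1 / real n) * log (2 powr (1 / 8)) (real n powr (1 + \<epsilon>))"

definition p_exp :: "real \<Rightarrow> nat \<Rightarrow> real"
  where "p_exp \<epsilon> n = (if exponent_gap \<epsilon> n \<le> 1 / 2 then 1 / (1 / 2 + exponent_gap \<epsilon> n) else 1)"

definition layer ::
    "real \<Rightarrow> (nat \<Rightarrow> nat set set) \<Rightarrow> nat \<Rightarrow> (nat \<Rightarrow> 'k::{real_normed_field,euclidean_space}) \<Rightarrow> real"
  where "layer \<epsilon> \<Delta> n x =
    (\<Sum>A\<in>\<Delta> n. (\<Sum>k\<in>A. (norm (x k))\<^sup>2) powr (p_exp \<epsilon> n / 2)) powr (2 / p_exp \<epsilon> n)"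

text \<open>A sequence indexed from 2 is a function on the naturals that vanishes at 0 and 1.\<close>

definition Y_space ::
    "real \<Rightarrow> (nat \<Rightarrow> nat set set) \<Rightarrow> (nat \<Rightarrow> 'k::{real_normed_field,euclidean_space}) set"
  where "Y_space \<epsilon> \<Delta> = {x. (\<forall>k<2. x k = 0) \<and> (\<lambda>n. layer \<epsilon> \<Delta> n x) summable_on {1..}}"

definition Y_norm ::
    "real \<Rightarrow> (nat \<Rightarrow> nat set set) \<Rightarrow> (nat \<Rightarrow> 'k::{real_normed_field,euclidean_space}) \<Rightarrow> real"
  where "Y_norm \<epsilon> \<Delta> x = sqrt (\<Sum>\<^sub>\<infinity>n\<in>{1..}. layer \<epsilon> \<Delta> n x)"

definition X_space ::
    "real \<Rightarrow> (nat \<Rightarrow> nat set set) \<Rightarrow> (nat \<Rightarrow> 'k::{real_normed_field,euclidean_space}) set"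
  where "X_space \<epsilon> \<Delta> = norm_topology (Y_space \<epsilon> \<Delta>) (Y_norm \<epsilon> \<Delta>) closure_of W"

end

(*
  No approximation property: if a finite rank operator T were close to the identity on a suitable
  compact set, then beta n T would tend to 0 while beta n of the identity is 1. The increments of
  beta n (T - id) are traces over the blocks of Nabla n. Each is dominated, for suitable signs, by the
  value of T - id at a signed sum of the vectors y j, whose norm is of order (m n) powr (1 / 2),
  whereas the block being transversal to Delta n costs (m n) powr (1 - 1 / p n). The choice of p n
  makes the resulting series converge, with room for normalising the signed sums to a null sequence.

  Hilbertian subspaces: on each layer an n-dimensional E carries a weighted 2-norm that dominates the
  layer norm and is dominated by it up to a factor kappa powr (2 / p - 1), where the weights form a
  density controlling the elements of E pointwise with constant kappa. The uniform density has
  kappa = sqrt (card Delta), and the density of an almost Auerbach basis has kappa = 2 * n ^ 2. Using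
  the former up to layers of order ln n and the latter beyond gives the factor (ln n) powr (1 + eps)
  on all layers, and the sum of the weighted forms yields the Hilbert structure and the projection.
*)

theory Submission
  imports Defs "Jordan_Normal_Form.Determinant"
begin

no_notation scalar_prod (infix "\<bullet>" 70)

section \<open>Conjugation\<close>

text \<open>Both halves rest on one calibration: the gap \<open>g = 1 / p n - 1 / 2\<close>
  satisfies \<open>(2 powr (n / 8)) powr g = n powr (1 + \<epsilon>)\<close> as long as it is not
  truncated at 1/2. A block of \<open>Nabla n\<close> has at least \<open>C * 2 powr (n / 8)\<close>
  points, so an increment of \<open>beta\<close> gains a factor of order
  \<open>n powr (- (1 + \<epsilon>))\<close>; half of \<open>\<epsilon>\<close> is spent on the null
  sequence, the other half keeps the series convergent. \<open>\<Delta> n\<close> has at most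
  \<open>2 powr (n / 8) / C\<close> blocks, so the uniform density costs only order
  \<open>n powr (1 + \<epsilon>)\<close>. Three obstacles shape the rest. The recursion for
  \<open>beta\<close> concerns maps of \<open>W\<close> into itself, whereas an approximating
  operator takes values in the closure; a linear map back into \<open>W\<close> that keeps finitely
  many entries bridges this. The projection must be defined on all of \<open>Y\<close>, so an inner
  product on \<open>E\<close> does not suffice: the first slot of the form ranges over
  \<open>Y\<close>. Since the densities change from layer to layer, only a constant uniform in the
  layer lets the forms be summed.\<close>

definition cnj_scalar :: "'k::{real_normed_field,euclidean_space} \<Rightarrow> 'k"
  where "cnj_scalar x = of_real (2 * (x \<bullet> 1)) - x"

text \<open>
  The scalar field is only known to be a Euclidean space with multiplicative norm; that
  \<open>norm (u - 1) * norm (u + 1) = norm (u * u - 1)\<close> takes its largest value 2 forces \<open>u * u = -1\<close>.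
\<close>

lemma imaginary_square:
  fixes u :: "'k::{real_normed_field,euclidean_space}"
  assumes "norm u = 1" and "u \<bullet> 1 = 0"
  shows "u * u = -1"
proof -
  have 4: "(1::'k) \<bullet> 1 = 1" by (simp add: norm_eq_1[symmetric])
  have 1: "(norm (u - 1))\<^sup>2 = 2" "(norm (u + 1))\<^sup>2 = 2"
    using assms by (auto simp: power2_norm_eq_inner algebra_simps inner_commute norm_eq_1 4)
  have "(norm ((u - 1) * (u + 1)))\<^sup>2 = 4"
    by (simp add: norm_mult power_mult_distrib 1)
  hence 2: "(norm (u * u - 1))\<^sup>2 = 4"
    by (simp add: algebra_simps)
  have 3: "(norm (u * u))\<^sup>2 = 1" by (simp add: norm_mult assms)
  have "(u * u) \<bullet> 1 = -1" using 2 3 4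
    by (simp add: power2_norm_eq_inner algebra_simps inner_commute)
  hence "(norm (u * u + 1))\<^sup>2 = 0" using 3 4
    by (simp add: power2_norm_eq_inner algebra_simps inner_commute)
  thus ?thesis by (simp add: eq_neg_iff_add_eq_0)
qed

text \<open>\<open>cnj_scalar\<close> is the reflection in the real axis spanned by 1. With
  \<open>x = t + w\<close> and \<open>w\<close> orthogonal to 1, the product is
  \<open>(t + w) * (t - w) = t * t - w * w\<close>, and \<open>imaginary_square\<close>, rescaled,
  evaluates \<open>w * w\<close>. Multiplicativity, isometry and involution of the conjugation are
  then read off from this identity.\<close>

lemma mult_cnj_scalar:
  fixes x :: "'k::{real_normed_field,euclidean_space}"
  shows "x * cnj_scalar x = (of_real (norm x))\<^sup>2"
proof -
  have 4: "(1::'k) \<bullet> 1 = 1" by (simp add: norm_eq_1[symmetric])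
  define t where "t = x \<bullet> 1"
  define w where "w = x - of_real t"
  have w1: "w \<bullet> 1 = 0" by (simp add: w_def t_def inner_diff_left of_real_def 4)
  have ww: "w * w = - of_real ((norm w)\<^sup>2)"
  proof (cases "w = 0")
    case False
    define u where "u = inverse (norm w) *\<^sub>R w"
    have "norm u = 1" using False by (simp add: u_def)
    moreover have "u \<bullet> 1 = 0" using w1 by (simp add: u_def)
    ultimately have "u * u = -1" by (rule imaginary_square)
    moreover have "w = of_real (norm w) * u" using False by (simp add: u_def scaleR_conv_of_real)
    ultimately show ?thesis
    proof -
      assume "u * u = -1" "w = of_real (norm w) * u"
      hence "w * w = of_real (norm w) * of_real (norm w) * (u * u)"
        by (metis mult.assoc mult.left_commute)
      thus ?thesis using \<open>u * u = -1\<close> by (simp add: power2_eq_square)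
    qed
  qed simp
  have x: "x = of_real t + w" by (simp add: w_def)
  have n: "(norm x)\<^sup>2 = t\<^sup>2 + (norm w)\<^sup>2"
    unfolding x power2_norm_eq_inner using w1 4
    by (simp add: algebra_simps inner_commute of_real_def power2_eq_square)
  have "cnj_scalar x = of_real t - w" by (simp add: cnj_scalar_def w_def t_def)
  hence "x * cnj_scalar x = (of_real t + w) * (of_real t - w)" by (simp only: x[symmetric])
  also have "\<dots> = of_real t * of_real t - w * w" by (simp add: algebra_simps)
  also have "\<dots> = of_real (t\<^sup>2 + (norm w)\<^sup>2)" by (simp add: ww power2_eq_square)
  also have "\<dots> = of_real ((norm x)\<^sup>2)" by (simp only: n)
  finally show ?thesis by simp
qed

lemma cnj_scalar_add: "cnj_scalar (x + y) = cnj_scalar x + cnj_scalar y"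
  by (simp add: cnj_scalar_def inner_add_left algebra_simps)

lemma cnj_scalar_0 [simp]: "cnj_scalar 0 = 0"
  by (simp add: cnj_scalar_def)

lemma cnj_scalar_sum: "cnj_scalar (\<Sum>i\<in>A. f i) = (\<Sum>i\<in>A. cnj_scalar (f i))"
  by (induction A rule: infinite_finite_induct) (auto simp: cnj_scalar_add)

lemma cnj_scalar_eq_divide: "x \<noteq> 0 \<Longrightarrow> cnj_scalar x = (of_real (norm x))\<^sup>2 / x"
  by (simp add: mult_cnj_scalar[symmetric] field_simps)

lemma cnj_scalar_mult: "cnj_scalar (x * y) = cnj_scalar x * cnj_scalar y"
  by (cases "x = 0 \<or> y = 0")
     (auto simp: cnj_scalar_eq_divide norm_mult power_mult_distrib)

lemma norm_cnj_scalar [simp]: "norm (cnj_scalar x) = norm x"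
  by (cases "x = 0") (auto simp: cnj_scalar_eq_divide norm_divide norm_power power2_eq_square norm_mult)

lemma cnj_scalar_cnj_scalar [simp]: "cnj_scalar (cnj_scalar x) = x"
proof (cases "x = 0")
  case False
  hence "cnj_scalar x \<noteq> 0" by (metis norm_cnj_scalar norm_eq_zero)
  hence "cnj_scalar (cnj_scalar x) = (of_real (norm x))\<^sup>2 / cnj_scalar x"
    by (simp add: cnj_scalar_eq_divide[of "cnj_scalar x"])
  thus ?thesis using False \<open>cnj_scalar x \<noteq> 0\<close> by (simp add: mult_cnj_scalar[symmetric])
qed simp

lemma cnj_scalar_of_real [simp]: "cnj_scalar (of_real r) = of_real r"
proof -
  have "(1::'a) \<bullet> 1 = 1" by (simp add: norm_eq_1[symmetric])
  thus ?thesis by (simp add: cnj_scalar_def of_real_def scaleR_left_diff_distrib[symmetric])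
qed

lemma bounded_linear_cnj_scalar: "bounded_linear cnj_scalar"
proof (rule bounded_linear_intro[where K = 1])
  fix r and x :: 'a
  have "cnj_scalar (of_real r * x) = of_real r * cnj_scalar x" by (simp add: cnj_scalar_mult)
  thus "cnj_scalar (r *\<^sub>R x) = r *\<^sub>R cnj_scalar x" by (simp add: scaleR_conv_of_real)
qed (auto simp: cnj_scalar_add)


section \<open>Coordinates on finite-dimensional spaces of sequences\<close>

lemma sum_fun_apply: "(\<Sum>i\<in>A. f i) k = (\<Sum>i\<in>A. f i k)"
  for f :: "'a \<Rightarrow> 'b \<Rightarrow> 'c::comm_monoid_add"
  by (induction A rule: infinite_finite_induct) auto

definition seq_restrict :: "nat set \<Rightarrow> (nat \<Rightarrow> 'k) \<Rightarrow> nat \<Rightarrow> 'k::{real_normed_field,euclidean_space}"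
  where "seq_restrict S x = (\<lambda>k. if k \<in> S then x k else 0)"

lemma seq_restrict_add: "seq_restrict S (x + y) = seq_restrict S x + seq_restrict S y"
  by (auto simp: seq_restrict_def fun_eq_iff)

lemma seq_restrict_scale: "seq_restrict S (c *\<^sub>q x) = c *\<^sub>q seq_restrict S x"
  by (auto simp: seq_restrict_def fun_eq_iff seq_scale_def)

lemma seq_restrict_0: "seq_restrict S 0 = 0"
  by (auto simp: seq_restrict_def fun_eq_iff)

lemma span_seq_restrict: "seqs.span (seq_restrict S ` B) = seq_restrict S ` seqs.span B"
proof (intro subset_antisym subsetI)
  fix v assume "v \<in> seqs.span (seq_restrict S ` B)"
  thus "v \<in> seq_restrict S ` seqs.span B"
  proof (induction rule: seqs.span_induct_alt)
    case base
    show ?case by (rule image_eqI[where x = 0]) (simp_all only: seq_restrict_0 seqs.span_zero)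
  next
    case (step c x y)
    then obtain a b where ab: "a \<in> B" "x = seq_restrict S a" "b \<in> seqs.span B" "y = seq_restrict S b" by blast
    have "c *\<^sub>q x + y = seq_restrict S (c *\<^sub>q a + b)"
      unfolding ab by (simp only: seq_restrict_add seq_restrict_scale)
    moreover have "c *\<^sub>q a + b \<in> seqs.span B" using ab(1,3) by (rule seqs.span_add[OF seqs.span_scale[OF seqs.span_base]])
    ultimately show ?case by (rule image_eqI)
  qed
next
  fix v assume "v \<in> seq_restrict S ` seqs.span B"
  then obtain w where w: "w \<in> seqs.span B" "v = seq_restrict S w" by blast
  have "seq_restrict S w \<in> seqs.span (seq_restrict S ` B)"
    using w(1)
  proof (induction rule: seqs.span_induct_alt)
    case base
    show ?case by (simp only: seq_restrict_0 seqs.span_zero)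
  next
    case (step c x y)
    have "seq_restrict S x \<in> seqs.span (seq_restrict S ` B)"
      using step by (intro seqs.span_base imageI)
    thus ?case unfolding seq_restrict_add seq_restrict_scale
      using step by (intro seqs.span_add seqs.span_scale)
  qed
  thus "v \<in> seqs.span (seq_restrict S ` B)" by (simp only: w)
qed

text \<open>Gaussian elimination to reduced echelon form: \<open>J\<close> is a set of pivots and
  \<open>g\<close> the basis dual to evaluation at them. Coordinates in a finite-dimensional space
  thereby become actual entries of the sequences, and entries are bounded by the norms in
  use.\<close>

lemma span_coordinates:
  fixes F :: "(nat \<Rightarrow> 'k::{real_normed_field,euclidean_space}) set"
  assumes "finite F"
  shows "\<exists>J g. finite J \<and> card J \<le> card F \<and> (\<forall>j\<in>J. g j \<in> seqs.span F) \<and>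
     (\<forall>j\<in>J. \<forall>i\<in>J. g j i = (if i = j then 1 else 0)) \<and>
     (\<forall>v\<in>seqs.span F. v = (\<Sum>j\<in>J. v j *\<^sub>q g j))"
  using assms
proof (induction F rule: finite_induct)
  case empty
  show ?case by (rule exI[of _ "{}"]) auto
next
  case (insert a F)
  then obtain J g where H: "finite J" "card J \<le> card F" "\<forall>j\<in>J. g j \<in> seqs.span F"
     "\<forall>j\<in>J. \<forall>i\<in>J. g j i = (if i = j then 1 else 0)"
     "\<forall>v\<in>seqs.span F. v = (\<Sum>j\<in>J. v j *\<^sub>q g j)" by (elim exE conjE)
  note J = H(1,2) H(3)[rule_format] H(4)[rule_format] H(5)[rule_format]
  define b where "b = a - (\<Sum>j\<in>J. a j *\<^sub>q g j)"
  have sp: "(\<Sum>j\<in>J. v j *\<^sub>q g j) \<in> seqs.span F" for v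
    by (intro seqs.span_sum seqs.span_scale J)
  have bJ: "b i = 0" if "i \<in> J" for i
  proof -
    have "(\<Sum>j\<in>J. a j *\<^sub>q g j) i = (\<Sum>j\<in>J. if i = j then a j else 0)"
      unfolding sum_fun_apply using that J(4) by (intro sum.cong) (auto simp: seq_scale_def)
    thus ?thesis using that J(1) by (simp add: b_def)
  qed
  have mono: "seqs.span F \<subseteq> seqs.span (insert a F)" by (rule seqs.span_mono) auto
  have bsp: "b \<in> seqs.span (insert a F)"
    unfolding b_def by (intro seqs.span_diff seqs.span_base[of a] subsetD[OF mono sp]) simp
  have dec: "\<exists>k w. w \<in> seqs.span F \<and> v = k *\<^sub>q b + w" if v: "v \<in> seqs.span (insert a F)" for v
  proof -
    obtain k where k: "v - k *\<^sub>q a \<in> seqs.span F" using v seqs.span_breakdown_eq by blast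
    have "k *\<^sub>q b = k *\<^sub>q a - k *\<^sub>q (\<Sum>j\<in>J. a j *\<^sub>q g j)" by (simp add: b_def seqs.scale_right_diff_distrib)
    hence "v = k *\<^sub>q b + ((v - k *\<^sub>q a) + k *\<^sub>q (\<Sum>j\<in>J. a j *\<^sub>q g j))" by simp
    moreover have "(v - k *\<^sub>q a) + k *\<^sub>q (\<Sum>j\<in>J. a j *\<^sub>q g j) \<in> seqs.span F"
      by (intro seqs.span_add k seqs.span_scale sp)
    ultimately show ?thesis by blast
  qed
  show ?case
  proof (cases "b = 0")
    case True
    have "seqs.span (insert a F) \<subseteq> seqs.span F" using dec True by fastforce
    hence "seqs.span (insert a F) = seqs.span F" using mono by auto
    moreover have "card J \<le> card (insert a F)" using J(2) insert by simp
    ultimately show ?thesis using J by (intro exI[of _ J] exI[of _ g]) auto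
  next
    case False
    then obtain i0 where i0: "b i0 \<noteq> 0" by (auto simp: fun_eq_iff)
    have i0J: "i0 \<notin> J" using i0 bJ by auto
    define h where "h = inverse (b i0) *\<^sub>q b"
    have "h \<in> seqs.span (insert a F)" unfolding h_def by (intro seqs.span_scale bsp)
    hence h: "h i0 = 1" "\<And>i. i \<in> J \<Longrightarrow> h i = 0" "h \<in> seqs.span (insert a F)"
      using i0 bJ by (auto simp: h_def seq_scale_def)
    \<comment> \<open>Clears column \<open>i0\<close> from the old basis vectors; their old pivots
      stay intact because \<open>h\<close> vanishes on \<open>J\<close>.\<close>
    define g' where "g' j = (if j = i0 then h else g j - g j i0 *\<^sub>q h)" for j
    have g'sp: "g' j \<in> seqs.span (insert a F)" if "j \<in> insert i0 J" for j
      using that h(3) J(3) mono unfolding g'_def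
      by (auto intro!: seqs.span_diff seqs.span_scale)
    have g'd: "g' j i = (if i = j then 1 else 0)" if "j \<in> insert i0 J" "i \<in> insert i0 J" for i j
      using that h J(4) i0J by (auto simp: g'_def seq_scale_def)
    \<comment> \<open>The pivots separate the points of the enlarged span, so the expansion need
      only be verified at the pivots.\<close>
    have zero: "u = 0" if u: "u \<in> seqs.span (insert a F)" "\<And>i. i \<in> insert i0 J \<Longrightarrow> u i = 0" for u
    proof -
      obtain k w where kw: "w \<in> seqs.span F" "u = k *\<^sub>q b + w" using dec u(1) by blast
      have "w j = 0" if "j \<in> J" for j using u(2)[of j] that bJ kw(2) by (auto simp: seq_scale_def)
      hence "w = 0" using J(5)[OF kw(1)] by simp
      hence "k * b i0 = 0" using u(2)[of i0] kw(2) by (simp add: seq_scale_def)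
      hence "k = 0" using i0 by simp
      thus ?thesis using kw(2) \<open>w = 0\<close> by simp
    qed
    have rep: "v = (\<Sum>j\<in>insert i0 J. v j *\<^sub>q g' j)" if "v \<in> seqs.span (insert a F)" for v
    proof -
      have "v - (\<Sum>j\<in>insert i0 J. v j *\<^sub>q g' j) = 0"
      proof (rule zero)
        show "v - (\<Sum>j\<in>insert i0 J. v j *\<^sub>q g' j) \<in> seqs.span (insert a F)"
          by (intro seqs.span_diff that seqs.span_sum seqs.span_scale g'sp)
      next
        fix i assume i: "i \<in> insert i0 J"
        have "(\<Sum>j\<in>insert i0 J. v j *\<^sub>q g' j) i = (\<Sum>j\<in>insert i0 J. if i = j then v j else 0)"
          unfolding sum_fun_apply using i g'd by (intro sum.cong) (auto simp: seq_scale_def)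
        thus "(v - (\<Sum>j\<in>insert i0 J. v j *\<^sub>q g' j)) i = 0" using i J(1) by (simp del: sum.insert)
      qed
      thus ?thesis by simp
    qed
    have "card (insert i0 J) \<le> card (insert a F)" using J insert by (simp add: card_insert_if)
    thus ?thesis using J(1) g'sp g'd rep
      by (intro exI[of _ "insert i0 J"] exI[of _ g']) blast
  qed
qed

section \<open>Finite sums of powers\<close>

lemma young_powr:
  fixes a b \<alpha> \<beta> :: real
  assumes "0 \<le> \<alpha>" "0 \<le> \<beta>" "\<alpha> + \<beta> = 1" "a \<ge> 0" "b \<ge> 0"
  shows "a powr \<alpha> * b powr \<beta> \<le> \<alpha> * a + \<beta> * b"
  using Youngs_inequality_0[of \<alpha> \<beta> a b] assms by (cases "a = 0 \<or> b = 0") auto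

lemma powr_convex_combination:
  fixes u v s t p :: real
  assumes "p \<ge> 1" "u \<ge> 0" "v \<ge> 0" "s \<ge> 0" "t \<ge> 0" "s + t = 1"
  shows "(s * u + t * v) powr p \<le> s * u powr p + t * v powr p"
proof -
  \<comment> \<open>If \<open>u\<close> or \<open>v\<close> vanishes, the convexity inequality
    reduces to this one for the remaining weight.\<close>
  have le: "r powr p \<le> r" if "0 \<le> r" "r \<le> 1" for r :: real
    using that assms(1) powr_mono'[of 1 p r] by (cases "r = 0") auto
  show ?thesis
  proof (cases "u = 0 \<or> v = 0")
    case True
    thus ?thesis using assms le[of s] le[of t]
      by (auto simp: powr_mult intro!: mult_right_mono)
  next
    case False
    thus ?thesis
      using convex_onD[OF powr_convex[OF assms(1)], of t u v] assms
      by (simp add: algebra_simps flip: eq_diff_eq)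
  qed
qed

section \<open>Minkowski's inequality and the two inequalities for a change of density\<close>

definition lp_norm :: "real \<Rightarrow> 'a set \<Rightarrow> ('a \<Rightarrow> real) \<Rightarrow> real"
  where "lp_norm p F f = (\<Sum>i\<in>F. f i powr p) powr (1 / p)"

lemma lp_norm_nonneg [simp]: "lp_norm p F f \<ge> 0"
  by (simp add: lp_norm_def)

lemma lp_norm_powr: "p > 0 \<Longrightarrow> lp_norm p F f powr p = (\<Sum>i\<in>F. f i powr p)"
  by (simp add: lp_norm_def powr_powr sum_nonneg)

lemma lp_norm_mono:
  assumes "p > 0" and "\<And>i. i \<in> F \<Longrightarrow> 0 \<le> f i \<and> f i \<le> g i"
  shows "lp_norm p F f \<le> lp_norm p F g"
  unfolding lp_norm_def using assms by (intro powr_mono2 sum_mono sum_nonneg) auto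

lemma lp_norm_scale:
  assumes "p > 0" and "c \<ge> 0" and "\<And>i. i \<in> F \<Longrightarrow> 0 \<le> f i"
  shows "lp_norm p F (\<lambda>i. c * f i) = c * lp_norm p F f"
proof -
  have "(\<Sum>i\<in>F. (c * f i) powr p) = c powr p * (\<Sum>i\<in>F. f i powr p)"
    unfolding sum_distrib_left using assms by (intro sum.cong) (auto simp: powr_mult)
  thus ?thesis using assms by (simp add: lp_norm_def powr_mult powr_powr sum_nonneg)
qed

lemma lp_norm_ge:
  assumes "p > 0" "finite F" "i \<in> F" "f i \<ge> 0"
  shows "f i \<le> lp_norm p F f"
proof -
  have "f i powr p \<le> (\<Sum>i\<in>F. f i powr p)" using assms by (intro member_le_sum) auto
  hence "(f i powr p) powr (1 / p) \<le> lp_norm p F f"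
    unfolding lp_norm_def using assms by (intro powr_mono2) auto
  thus ?thesis using assms by (simp add: powr_powr)
qed

lemma lp_norm_le:
  assumes "p > 0" "c \<ge> 0" "(\<Sum>i\<in>F. f i powr p) \<le> c powr p"
  shows "lp_norm p F f \<le> c"
proof -
  have "lp_norm p F f \<le> (c powr p) powr (1 / p)"
    unfolding lp_norm_def using assms by (intro powr_mono2 sum_nonneg) auto
  thus ?thesis using assms by (simp add: powr_powr)
qed

text \<open>Minkowski by normalisation: with \<open>a\<close> and \<open>b\<close> the norms of
  \<open>f\<close> and \<open>g\<close>, the function \<open>(f + g) / (a + b)\<close> is the convex
  combination of \<open>f / a\<close> and \<open>g / b\<close>, both of norm 1, with weights
  \<open>a / (a + b)\<close> and \<open>b / (a + b)\<close>.\<close>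

lemma lp_norm_triangle:
  assumes "p \<ge> 1" "finite F" and f: "\<And>i. i \<in> F \<Longrightarrow> 0 \<le> f i" and g: "\<And>i. i \<in> F \<Longrightarrow> 0 \<le> g i"
  shows "lp_norm p F (\<lambda>i. f i + g i) \<le> lp_norm p F f + lp_norm p F g"
proof -
  define a where "a = lp_norm p F f"
  define b where "b = lp_norm p F g"
  have a0: "a \<ge> 0" "b \<ge> 0" by (auto simp: a_def b_def)
  consider "a = 0" | "b = 0" | "a > 0" "b > 0" using a0 by linarith
  thus ?thesis
  proof cases
    case 1
    hence "f i = 0" if "i \<in> F" for i using lp_norm_ge[of p F i f] f that assms by (force simp: a_def)
    thus ?thesis using 1 by (simp add: lp_norm_def)
  next
    case 2
    hence "g i = 0" if "i \<in> F" for i using lp_norm_ge[of p F i g] g that assms by (force simp: b_def)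
    thus ?thesis using 2 by (simp add: lp_norm_def)
  next
    case 3
    have ab: "a / (a + b) + b / (a + b) = 1" using 3 by (simp flip: add_divide_distrib)
    have "(f i + g i) powr p \<le> (a + b) powr p * (a / (a + b) * (f i / a) powr p + b / (a + b) * (g i / b) powr p)"
      if "i \<in> F" for i
    proof -
      have "(f i + g i) powr p = ((a + b) * (a / (a + b) * (f i / a) + b / (a + b) * (g i / b))) powr p"
      proof -
        have "a / (a + b) * (f i / a) + b / (a + b) * (g i / b) = (f i + g i) / (a + b)"
          using 3 by (simp add: add_divide_distrib)
        thus ?thesis using 3 by (simp only:) simp
      qed
      also have "\<dots> = (a + b) powr p * (a / (a + b) * (f i / a) + b / (a + b) * (g i / b)) powr p"
        by (rule powr_mult)
      also have "\<dots> \<le> (a + b) powr p * (a / (a + b) * (f i / a) powr p + b / (a + b) * (g i / b) powr p)"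
        using 3 f g that assms(1) ab
        by (intro mult_left_mono powr_convex_combination) auto
      finally show ?thesis .
    qed
    hence "(\<Sum>i\<in>F. (f i + g i) powr p)
        \<le> (\<Sum>i\<in>F. (a + b) powr p * (a / (a + b) * (f i / a) powr p + b / (a + b) * (g i / b) powr p))"
      by (rule sum_mono)
    also have "\<dots> = (a + b) powr p * (a / (a + b) * (\<Sum>i\<in>F. (f i / a) powr p) + b / (a + b) * (\<Sum>i\<in>F. (g i / b) powr p))"
      by (simp only: sum.distrib sum_distrib_left[symmetric])
    also have "(\<Sum>i\<in>F. (f i / a) powr p) = 1"
    proof -
      have "(\<Sum>i\<in>F. (f i / a) powr p) = (\<Sum>i\<in>F. f i powr p) / a powr p"
        unfolding sum_divide_distrib using 3 f by (intro sum.cong) (auto simp: powr_divide)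
      thus ?thesis using 3 assms lp_norm_powr[of p F f, folded a_def, symmetric] by simp
    qed
    also have "(\<Sum>i\<in>F. (g i / b) powr p) = 1"
    proof -
      have "(\<Sum>i\<in>F. (g i / b) powr p) = (\<Sum>i\<in>F. g i powr p) / b powr p"
        unfolding sum_divide_distrib using 3 g by (intro sum.cong) (auto simp: powr_divide)
      thus ?thesis using 3 assms lp_norm_powr[of p F g, folded b_def, symmetric] by simp
    qed
    also have "(a + b) powr p * (a / (a + b) * 1 + b / (a + b) * 1) = (a + b) powr p"
      using 3 by (simp flip: add_divide_distrib)
    finally have "lp_norm p F (\<lambda>i. f i + g i) \<le> a + b" using assms a0 by (intro lp_norm_le) auto
    thus ?thesis by (simp add: a_def b_def)
  qed
qed

text \<open>Hoelder's inequality with the weights \<open>p / 2\<close> and \<open>1 - p / 2\<close>,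
  applied to \<open>f powr p = (v powr (- h) * f^2) powr (p / 2) * v powr (1 - p / 2)\<close>. The
  exponent \<open>h\<close> is determined by this splitting, and the total mass of \<open>v\<close>
  being at most 1 removes the second factor.\<close>

lemma lp_norm_le_weighted:
  fixes v f :: "'a \<Rightarrow> real"
  assumes "finite D" and p: "1 \<le> p" "p \<le> 2" and h: "h = 2 / p - 1"
    and v: "\<And>A. A \<in> D \<Longrightarrow> v A \<ge> 0" "(\<Sum>A\<in>D. v A) \<le> 1"
    and f: "\<And>A. A \<in> D \<Longrightarrow> f A \<ge> 0" "\<And>A. A \<in> D \<Longrightarrow> v A = 0 \<Longrightarrow> f A = 0"
  shows "lp_norm p D f \<le> sqrt (\<Sum>A\<in>D. v A powr (- h) * (f A)\<^sup>2)"
proof -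
  define Q where "Q = (\<Sum>A\<in>D. v A powr (- h) * (f A)\<^sup>2)"
  have Q0: "Q \<ge> 0" unfolding Q_def by (intro sum_nonneg) auto
  show ?thesis
  proof (cases "Q = 0")
    case True
    have "f A = 0" if "A \<in> D" for A
    proof -
      have "v A powr (- h) * (f A)\<^sup>2 = 0"
        using True that assms(1) unfolding Q_def by (subst (asm) sum_nonneg_eq_0_iff) auto
      thus ?thesis using f(2)[OF that] by auto
    qed
    thus ?thesis by (simp add: lp_norm_def sum_nonneg)
  next
    case False
    hence Q: "Q > 0" using Q0 by simp
    have "f A powr p \<le> sqrt Q powr p * (p / 2 * (v A powr (- h) * (f A)\<^sup>2 / Q) + (1 - p / 2) * v A)"
      if A: "A \<in> D" for A
    proof (cases "f A = 0")
      case True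
      thus ?thesis using p v(1)[OF A] by simp
    next
      case False
      hence f0: "f A > 0" and v0: "v A > 0" using f[OF A] v(1)[OF A] by force+
      \<comment> \<open>In logarithms an identity between products of powers becomes a linear
        identity between exponents.\<close>
      define F V R where "F = ln (f A)" and "V = ln (v A)" and "R = ln (sqrt Q)"
      have FV: "f A = exp F" "v A = exp V" "sqrt Q = exp R" using f0 v0 Q by (auto simp: F_def V_def R_def)
      have QR: "Q = exp (2 * R)" using FV(3) Q by (metis exp_double real_sqrt_pow2 less_imp_le)
      have "f A powr p = sqrt Q powr p * ((v A powr (- h) * (f A)\<^sup>2 / Q) powr (p / 2) * v A powr (1 - p / 2))"
        using p unfolding FV h unfolding QR
        by (simp add: powr_def field_simps flip: exp_add exp_diff exp_double exp_of_nat_mult)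
      also have "\<dots> \<le> sqrt Q powr p * (p / 2 * (v A powr (- h) * (f A)\<^sup>2 / Q) + (1 - p / 2) * v A)"
        using p Q v0 by (intro mult_left_mono young_powr) auto
      finally show ?thesis .
    qed
    hence "(\<Sum>A\<in>D. f A powr p)
        \<le> (\<Sum>A\<in>D. sqrt Q powr p * (p / 2 * (v A powr (- h) * (f A)\<^sup>2 / Q) + (1 - p / 2) * v A))"
      by (rule sum_mono)
    also have "\<dots> = sqrt Q powr p * (p / 2 * ((\<Sum>A\<in>D. v A powr (- h) * (f A)\<^sup>2) / Q) + (1 - p / 2) * (\<Sum>A\<in>D. v A))"
      by (simp only: sum.distrib sum_distrib_left[symmetric] sum_divide_distrib[symmetric])
    also have "(\<Sum>A\<in>D. v A powr (- h) * (f A)\<^sup>2) = Q" by (simp add: Q_def)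
    also have "sqrt Q powr p * (p / 2 * (Q / Q) + (1 - p / 2) * (\<Sum>A\<in>D. v A))
        \<le> sqrt Q powr p * (p / 2 * (Q / Q) + (1 - p / 2) * 1)"
      using p v(2) by (intro mult_left_mono add_left_mono) auto
    also have "\<dots> = sqrt Q powr p" using Q by simp
    finally show ?thesis unfolding Q_def[symmetric] using p Q by (intro lp_norm_le) auto
  qed
qed

text \<open>The dual estimate. A factor \<open>(f / (v powr (1 / p) * q)) powr h\<close>, which the
  pointwise bound keeps below \<open>\<kappa> powr h\<close>, is split off; what remains is exactly
  in Hoelder position between \<open>v powr (- h) * f^2\<close> and \<open>g powr p\<close>, with
  weights \<open>1 - 1 / p\<close> and \<open>1 / p\<close>. The choice \<open>g = f\<close>
  reverses \<open>lp_norm_le_weighted\<close>; a general \<open>g\<close> is what bounds the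
  projection.\<close>

lemma weighted_sum_le_lp_norm:
  fixes v f g :: "'a \<Rightarrow> real"
  assumes "finite D" and p: "1 \<le> p" "p \<le> 2" and h: "h = 2 / p - 1" and "\<kappa> > 0"
    and v: "\<And>A. A \<in> D \<Longrightarrow> v A \<ge> 0"
    and f: "\<And>A. A \<in> D \<Longrightarrow> f A \<ge> 0" and g: "\<And>A. A \<in> D \<Longrightarrow> g A \<ge> 0"
    and q: "q = sqrt (\<Sum>A\<in>D. v A powr (- h) * (f A)\<^sup>2)"
    and bound: "\<And>A. A \<in> D \<Longrightarrow> f A \<le> \<kappa> * v A powr (1 / p) * q"
  shows "(\<Sum>A\<in>D. v A powr (- h) * f A * g A) \<le> \<kappa> powr h * q * lp_norm p D g"
proof -
  have q0: "q \<ge> 0" unfolding q by (auto intro: sum_nonneg)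
  have q2: "q\<^sup>2 = (\<Sum>A\<in>D. v A powr (- h) * (f A)\<^sup>2)" unfolding q by (simp add: sum_nonneg)
  define G where "G = lp_norm p D g"
  have G0: "G \<ge> 0" by (simp add: G_def)
  have h0: "h \<ge> 0" using p by (simp add: h)
  consider "q = 0" | "G = 0" | "q > 0" "G > 0" using q0 G0 by linarith
  thus ?thesis
  proof cases
    case 1
    hence "f A = 0" if "A \<in> D" for A using bound[OF that] f[OF that] by simp
    thus ?thesis using 1 by simp
  next
    case 2
    hence "g i = 0" if "i \<in> D" for i
      using lp_norm_ge[of p D i g] g that assms by (force simp: G_def)
    thus ?thesis using 2 by (simp add: G_def)
  next
    case 3
    have "v A powr (- h) * f A * g A
        \<le> \<kappa> powr h * q * G * ((1 - 1 / p) * (v A powr (- h) * (f A)\<^sup>2 / q\<^sup>2) + 1 / p * (g A powr p / G powr p))"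
      if A: "A \<in> D" for A
    proof (cases "f A = 0 \<or> g A = 0 \<or> v A = 0")
      case True
      thus ?thesis using p 3 by auto
    next
      case False
      hence f0: "f A > 0" and v0: "v A > 0" and g0: "g A > 0" using f[OF A] v[OF A] g[OF A] by force+
      define F V R H S where "F = ln (f A)" and "V = ln (v A)" and "R = ln q" and "H = ln (g A)" and "S = ln G"
      have FV: "f A = exp F" "v A = exp V" "q = exp R" "g A = exp H" "G = exp S"
        using f0 v0 3 g0 by (auto simp: F_def V_def R_def H_def S_def)
      have "v A powr (- h) * f A * g A = (f A / (v A powr (1 / p) * q)) powr h * q * G *
          ((v A powr (- h) * (f A)\<^sup>2 / q\<^sup>2) powr (1 - 1 / p) * (g A powr p / G powr p) powr (1 / p))"
        using p unfolding FV h
        by (simp add: powr_def field_simps flip: exp_add exp_diff exp_double exp_of_nat_mult)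
      also have "\<dots> \<le> \<kappa> powr h * q * G *
          ((1 - 1 / p) * (v A powr (- h) * (f A)\<^sup>2 / q\<^sup>2) + 1 / p * (g A powr p / G powr p))"
      proof (intro mult_mono young_powr powr_mono2 h0)
        show "f A / (v A powr (1 / p) * q) \<le> \<kappa>" using bound[OF A] 3 v0 by (simp add: divide_simps mult_ac)
      qed (use 3 p f0 g0 v0 in auto)
      finally show ?thesis .
    qed
    hence "(\<Sum>A\<in>D. v A powr (- h) * f A * g A)
       \<le> (\<Sum>A\<in>D. \<kappa> powr h * q * G * ((1 - 1 / p) * (v A powr (- h) * (f A)\<^sup>2 / q\<^sup>2) + 1 / p * (g A powr p / G powr p)))"
      by (rule sum_mono)
    also have "\<dots> = \<kappa> powr h * q * G * ((1 - 1 / p) * ((\<Sum>A\<in>D. v A powr (- h) * (f A)\<^sup>2) / q\<^sup>2)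
        + 1 / p * ((\<Sum>A\<in>D. g A powr p) / G powr p))"
      by (simp only: sum.distrib sum_distrib_left[symmetric] sum_divide_distrib[symmetric])
    also have "(\<Sum>A\<in>D. v A powr (- h) * (f A)\<^sup>2) = q\<^sup>2" by (simp add: q2)
    also have "(\<Sum>A\<in>D. g A powr p) = G powr p" using p by (simp add: G_def lp_norm_powr)
    also have "\<kappa> powr h * q * G * ((1 - 1 / p) * (q\<^sup>2 / q\<^sup>2) + 1 / p * (G powr p / G powr p)) = \<kappa> powr h * q * G"
      using 3 by simp
    finally show ?thesis by (simp add: G_def)
  qed
qed


section \<open>Bases with bounded coordinate functionals\<close>

text \<open>
  By Cramer's rule, vectors whose determinant is at least half the supremum over the given set
  have coordinate functionals that are bounded by 2 on this set (Auerbach's argument).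
\<close>

lemma near_auerbach:
  fixes S :: "(nat \<Rightarrow> 'k::real_normed_field) set"
  assumes M: "\<And>x i. x \<in> S \<Longrightarrow> i < d \<Longrightarrow> norm (x i) \<le> M"
    and r: "r \<noteq> 0" and unit: "\<And>k. k < d \<Longrightarrow> \<exists>x\<in>S. \<forall>i<d. x i = (if i = k then r else 0)"
  shows "\<exists>F. (\<forall>k<d. F k \<in> S) \<and>
      (\<forall>x\<in>S. \<exists>c. (\<forall>k<d. norm (c k) \<le> 2) \<and> (\<forall>i<d. x i = (\<Sum>k<d. c k * F k i)))"
proof -
  define mt where "mt F = mat d d (\<lambda>(i, k). F k i)" for F :: "nat \<Rightarrow> nat \<Rightarrow> 'k"
  have mtc: "mt F \<in> carrier_mat d d" for F by (simp add: mt_def)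
  define P where "P = {F. \<forall>k<d. F k \<in> S}"
  define V where "V = (\<lambda>F. norm (det (mt F))) ` P"
  have bdd: "bdd_above V"
    unfolding V_def
  proof (rule bdd_aboveI2)
    fix F assume F: "F \<in> P"
    have "norm (det (mt F)) \<le> (\<Sum>p\<in>{p. p permutes {0..<d}}. norm (signof p * (\<Prod>i = 0..<d. mt F $$ (i, p i))))"
      unfolding det_def'[OF mtc] by (rule norm_sum)
    also have "\<dots> \<le> (\<Sum>p\<in>{p. p permutes {0..<d}}. M ^ d)"
    proof (rule sum_mono)
      fix p assume p: "p \<in> {p. p permutes {0..<d}}"
      have 1: "norm (signof p :: 'k) = 1" by (simp add: sign_def)
      have "(\<Prod>i = 0..<d. norm (mt F $$ (i, p i))) \<le> (\<Prod>i = 0..<d. M)"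
      proof (rule prod_mono)
        fix i assume i: "i \<in> {0..<d}"
        hence "p i < d" using p permutes_in_image[of p "{0..<d}" i] by simp
        thus "0 \<le> norm (mt F $$ (i, p i)) \<and> norm (mt F $$ (i, p i)) \<le> M"
          using i F M by (auto simp: mt_def P_def)
      qed
      thus "norm (signof p * (\<Prod>i = 0..<d. mt F $$ (i, p i))) \<le> M ^ d"
        using 1 by (simp add: norm_mult prod_norm)
    qed
    finally show "norm (det (mt F)) \<le> (\<Sum>p\<in>{p. p permutes {0..<d}}. M ^ d)" .
  qed
  \<comment> \<open>The scaled unit vectors have determinant \<open>r ^ d\<close>, so the supremum
    is positive and a tuple exceeding half of it is invertible.\<close>
  obtain F0 where F0: "\<And>k. k < d \<Longrightarrow> F0 k \<in> S" "\<And>k i. k < d \<Longrightarrow> i < d \<Longrightarrow> F0 k i = (if i = k then r else 0)"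
    using unit by metis
  have "mt F0 = r \<cdot>\<^sub>m 1\<^sub>m d"
    by (rule eq_matI) (auto simp: mt_def F0)
  hence "det (mt F0) = r ^ d" by (simp add: det_smult)
  hence pos: "norm (det (mt F0)) > 0" using r by simp
  have F0P: "F0 \<in> P" using F0 by (simp add: P_def)
  have le: "norm (det (mt F)) \<le> Sup V" if "F \<in> P" for F
    using that bdd by (intro cSup_upper) (auto simp: V_def)
  have Sup: "Sup V > 0" using le[OF F0P] pos by linarith
  obtain F where F: "F \<in> P" "norm (det (mt F)) > Sup V / 2"
    using less_cSupD[of V "Sup V / 2"] F0P Sup by (auto simp: V_def)
  have detF: "det (mt F) \<noteq> 0" using F(2) Sup by auto
  obtain B where B: "B \<in> carrier_mat d d" "mt F * B = 1\<^sub>m d"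
    using det_non_zero_imp_unit[OF mtc detF, of "()"]
    unfolding Units_def ring_mat_def by auto
  show ?thesis
  proof (intro exI[of _ F] conjI ballI)
    show "\<forall>k<d. F k \<in> S" using F(1) by (simp add: P_def)
  next
    fix x assume x: "x \<in> S"
    define b where "b = vec d x"
    define c where "c = B *\<^sub>v b"
    have bc: "b \<in> carrier_vec d" "c \<in> carrier_vec d" using B by (auto simp: b_def c_def)
    have Ac: "mt F *\<^sub>v c = b"
      unfolding c_def using B bc mtc[of F] assoc_mult_mat_vec[OF mtc B(1) bc(1), of F, symmetric] by simp
    have "norm (c $ k) \<le> 2" if k: "k < d" for k
    proof -
      have "replace_col (mt F) b k = mt (F(k := x))"
        by (rule eq_matI) (auto simp: mt_def replace_col_def b_def)
      hence "det (mt (F(k := x))) = c $ k * det (mt F)"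
        using cramer_lemma_mat[OF mtc bc(2) k, of F] Ac by simp
      moreover have "F(k := x) \<in> P" using F(1) x by (simp add: P_def)
      ultimately have "norm (c $ k) * norm (det (mt F)) \<le> Sup V" using le by (metis norm_mult)
      also have "\<dots> \<le> 2 * norm (det (mt F))" using F(2) by simp
      finally show ?thesis using detF by simp
    qed
    moreover have "x i = (\<Sum>k<d. c $ k * F k i)" if i: "i < d" for i
    proof -
      have "x i = (mt F *\<^sub>v c) $ i" using Ac i by (simp add: b_def)
      also have "\<dots> = (\<Sum>k = 0..<d. F k i * c $ k)"
        using i bc mtc[of F] by (simp add: scalar_prod_def mt_def)
      finally show ?thesis by (simp add: atLeast0LessThan mult.commute)
    qed
    ultimately show "\<exists>c. (\<forall>k<d. norm (c k) \<le> 2) \<and> (\<forall>i<d. x i = (\<Sum>k<d. c k * F k i))"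
      by (intro exI[of _ "\<lambda>k. c $ k"]) blast
  qed
qed

section \<open>Hilbertian subspaces\<close>

lemma op_norm_le:
  assumes "\<And>x. x \<in> S \<Longrightarrow> N x \<le> 1 \<Longrightarrow> N' (T x) \<le> K"
  shows "op_norm S N N' T \<le> ennreal K"
  unfolding op_norm_def using assms by (intro SUP_least ennreal_leI) auto

text \<open>
  The orthogonal projection onto \<open>E\<close> with respect to \<open>H\<close> bounds the complementation constant, and the
  coordinates in an orthonormal basis of \<open>E\<close> bound the distance to Hilbert space.
\<close>

locale hermitian_form =
  fixes S E :: "(nat \<Rightarrow> 'k::{real_normed_field,euclidean_space}) set"
    and N q :: "(nat \<Rightarrow> 'k) \<Rightarrow> real" and H :: "(nat \<Rightarrow> 'k) \<Rightarrow> (nat \<Rightarrow> 'k) \<Rightarrow> 'k" and K :: real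
  assumes S: "seqs.subspace S" and E: "seqs.subspace E" and ES: "E \<subseteq> S" and dimE: "seqs.dim E > 0"
    and add_left: "\<And>g g' f. g \<in> S \<Longrightarrow> g' \<in> S \<Longrightarrow> f \<in> E \<Longrightarrow> H (g + g') f = H g f + H g' f"
    and scale_left: "\<And>c g f. g \<in> S \<Longrightarrow> f \<in> E \<Longrightarrow> H (c *\<^sub>q g) f = c * H g f"
    and add_right: "\<And>g f f'. g \<in> S \<Longrightarrow> f \<in> E \<Longrightarrow> f' \<in> E \<Longrightarrow> H g (f + f') = H g f + H g f'"
    and scale_right: "\<And>c g f. g \<in> S \<Longrightarrow> f \<in> E \<Longrightarrow> H g (c *\<^sub>q f) = cnj_scalar c * H g f"
    and hermitian: "\<And>g f. g \<in> E \<Longrightarrow> f \<in> E \<Longrightarrow> H g f = cnj_scalar (H f g)"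
    and diagonal: "\<And>f. f \<in> E \<Longrightarrow> H f f = of_real ((q f)\<^sup>2)"
    and q_nonneg: "\<And>f. f \<in> E \<Longrightarrow> q f \<ge> 0"
    and q_definite: "\<And>f. f \<in> E \<Longrightarrow> q f = 0 \<Longrightarrow> f = 0"
    and N_le: "\<And>f. f \<in> E \<Longrightarrow> N f \<le> q f"
    and N_nonneg: "\<And>g. N g \<ge> 0" and K_nonneg: "K \<ge> 0"
    and bound: "\<And>g f. g \<in> S \<Longrightarrow> f \<in> E \<Longrightarrow> norm (H g f) \<le> K * q f * N g"
begin

lemma ES': "f \<in> E \<Longrightarrow> f \<in> S"
  using ES by auto

lemma zero_left: "f \<in> E \<Longrightarrow> H 0 f = 0"
  using scale_left[of 0 f 0] seqs.subspace_0[OF S] by simp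

lemma zero_right: "g \<in> S \<Longrightarrow> H g 0 = 0"
  using scale_right[of g 0 0] seqs.subspace_0[OF E] by simp

lemma sum_left:
  assumes "f \<in> E" "\<And>i. i \<in> A \<Longrightarrow> x i \<in> S"
  shows "H (\<Sum>i\<in>A. c i *\<^sub>q x i) f = (\<Sum>i\<in>A. c i * H (x i) f)"
  using assms(2)
proof (induction A rule: infinite_finite_induct)
  case (insert a A)
  have "(\<Sum>i\<in>A. c i *\<^sub>q x i) \<in> S"
    using insert by (intro seqs.subspace_sum[OF S] seqs.subspace_scale[OF S]) auto
  moreover have "c a *\<^sub>q x a \<in> S" "x a \<in> S" using insert by (auto intro: seqs.subspace_scale[OF S])
  moreover have "(\<Sum>i\<in>insert a A. c i *\<^sub>q x i) = c a *\<^sub>q x a + (\<Sum>i\<in>A. c i *\<^sub>q x i)"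
    using insert by (intro sum.insert)
  ultimately show ?case using insert assms(1) by (simp only: add_left scale_left sum.insert) auto
qed (auto simp: assms(1) zero_left)

lemma sum_right:
  assumes "g \<in> S" "\<And>i. i \<in> A \<Longrightarrow> x i \<in> E"
  shows "H g (\<Sum>i\<in>A. c i *\<^sub>q x i) = (\<Sum>i\<in>A. cnj_scalar (c i) * H g (x i))"
  using assms(2)
proof (induction A rule: infinite_finite_induct)
  case (insert a A)
  have "(\<Sum>i\<in>A. c i *\<^sub>q x i) \<in> E"
    using insert by (intro seqs.subspace_sum[OF E] seqs.subspace_scale[OF E]) auto
  moreover have "c a *\<^sub>q x a \<in> E" "x a \<in> E" using insert by (auto intro: seqs.subspace_scale[OF E])
  moreover have "(\<Sum>i\<in>insert a A. c i *\<^sub>q x i) = c a *\<^sub>q x a + (\<Sum>i\<in>A. c i *\<^sub>q x i)"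
    using insert by (intro sum.insert)
  ultimately show ?case using insert assms(1) by (simp only: add_right scale_right sum.insert) auto
qed (auto simp: assms(1) zero_right)

section \<open>Orthonormal families and the projection onto their span\<close>

definition orthonormal :: "nat \<Rightarrow> (nat \<Rightarrow> nat \<Rightarrow> 'k) \<Rightarrow> bool"
  where "orthonormal k e \<longleftrightarrow> (\<forall>i<k. e i \<in> E) \<and> (\<forall>i<k. \<forall>j<k. H (e i) (e j) = (if i = j then 1 else 0))"

lemma orthonormal_inj:
  assumes "orthonormal k e"
  shows "inj_on e {..<k}"
proof (rule inj_onI)
  fix i j assume ij: "i \<in> {..<k}" "j \<in> {..<k}" "e i = e j"
  hence "H (e i) (e j) = 1" using assms by (auto simp: orthonormal_def)
  thus "i = j" using assms ij(1,2) unfolding orthonormal_def by (metis lessThan_iff zero_neq_one)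
qed

lemma orthonormal_independent:
  assumes e: "orthonormal k e"
  shows "\<not> seqs.dependent (e ` {..<k})"
proof
  assume "seqs.dependent (e ` {..<k})"
  then obtain u v where u: "v \<in> e ` {..<k}" "u v \<noteq> 0" "(\<Sum>w\<in>e ` {..<k}. u w *\<^sub>q w) = 0"
    by (subst (asm) seqs.dependent_finite) auto
  then obtain j where j: "j < k" "v = e j" by auto
  have eE: "\<And>i. i < k \<Longrightarrow> e i \<in> E" using e by (auto simp: orthonormal_def)
  have "0 = H (\<Sum>i<k. u (e i) *\<^sub>q e i) (e j)"
    using u(3) zero_left[OF eE[OF j(1)]] by (simp add: sum.reindex[OF orthonormal_inj[OF e]])
  also have "\<dots> = (\<Sum>i<k. u (e i) * H (e i) (e j))" using j eE ES' by (subst sum_left) auto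
  also have "\<dots> = (\<Sum>i<k. if i = j then u (e i) else 0)"
    using e j by (intro sum.cong) (auto simp: orthonormal_def)
  also have "\<dots> = u v" using j by simp
  finally show False using u by simp
qed

text \<open>Only the second slot of \<open>H\<close> is confined to \<open>E\<close>, so the formula
  makes sense on all of \<open>S\<close> and extends the orthogonal projection from \<open>E\<close>
  to the larger space.\<close>

definition proj :: "nat \<Rightarrow> (nat \<Rightarrow> nat \<Rightarrow> 'k) \<Rightarrow> (nat \<Rightarrow> 'k) \<Rightarrow> nat \<Rightarrow> 'k"
  where "proj k e g = (\<Sum>i<k. H g (e i) *\<^sub>q e i)"

lemma combination_in:
  assumes "orthonormal k e"
  shows "(\<Sum>i<k. c i *\<^sub>q e i) \<in> E"
  using assms unfolding orthonormal_def
  by (intro seqs.subspace_sum[OF E] seqs.subspace_scale[OF E]) auto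

lemma coefficient:
  assumes e: "orthonormal k e" and j: "j < k"
  shows "H (\<Sum>i<k. c i *\<^sub>q e i) (e j) = c j"
proof -
  have eE: "\<And>i. i < k \<Longrightarrow> e i \<in> E" using e by (auto simp: orthonormal_def)
  have "H (\<Sum>i<k. c i *\<^sub>q e i) (e j) = (\<Sum>i<k. c i * H (e i) (e j))"
    using j eE ES' by (subst sum_left) auto
  also have "\<dots> = (\<Sum>i<k. if i = j then c i else 0)"
    using e j by (intro sum.cong) (auto simp: orthonormal_def)
  finally show ?thesis using j by simp
qed

lemma q_combination:
  assumes e: "orthonormal k e"
  shows "(q (\<Sum>i<k. c i *\<^sub>q e i))\<^sup>2 = (\<Sum>i<k. (norm (c i))\<^sup>2)"
proof -
  let ?x = "\<Sum>i<k. c i *\<^sub>q e i"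
  have eE: "\<And>i. i < k \<Longrightarrow> e i \<in> E" using e by (auto simp: orthonormal_def)
  have "of_real ((q ?x)\<^sup>2) = H ?x ?x" using diagonal[OF combination_in[OF e]] by simp
  also have "\<dots> = (\<Sum>i<k. cnj_scalar (c i) * H ?x (e i))"
    using eE ES'[OF combination_in[OF e]] by (subst sum_right) auto
  also have "\<dots> = (\<Sum>i<k. (of_real (norm (c i)))\<^sup>2)"
    using coefficient[OF e] by (intro sum.cong) (auto simp: mult_cnj_scalar mult.commute)
  also have "\<dots> = (of_real (\<Sum>i<k. (norm (c i))\<^sup>2) :: 'k)" by simp
  finally show ?thesis by (simp only: of_real_eq_iff)
qed

text \<open>Instead of orthogonalising a given basis, an orthonormal family of greatest length is
  taken, which exists because independence bounds the length by the dimension. A vector moved by its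
  projection would, after subtraction and normalisation, extend the family.\<close>

lemma orthonormal_basis: "\<exists>e. orthonormal (seqs.dim E) e \<and> (\<forall>f\<in>E. proj (seqs.dim E) e f = f)"
proof -
  obtain B where B: "B \<subseteq> E" "seqs.independent B" "E \<subseteq> seqs.span B" "card B = seqs.dim E"
    using seqs.basis_exists by blast
  have finB: "finite B" using B(4) dimE by (metis card.infinite less_nat_zero_code)
  have le: "k \<le> seqs.dim E" if "orthonormal k e" for k e
  proof -
    have "e ` {..<k} \<subseteq> seqs.span B" using that B(3) by (auto simp: orthonormal_def)
    hence "card (e ` {..<k}) \<le> card B"
      using seqs.independent_span_bound[OF finB orthonormal_independent[OF that]] by simp
    thus ?thesis using B(4) card_image[OF orthonormal_inj[OF that]] by simp
  qed
  define k where "k = (GREATEST k. \<exists>e. orthonormal k e)"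
  have ex0: "\<exists>e. orthonormal 0 e" by (auto simp: orthonormal_def)
  have "\<exists>e. orthonormal k e" unfolding k_def
    using GreatestI_nat[of "\<lambda>k. \<exists>e. orthonormal k e" 0 "seqs.dim E"] ex0 le by blast
  then obtain e where e: "orthonormal k e" by blast
  have max: "k' \<le> k" if "orthonormal k' e'" for k' e' unfolding k_def
    using that le by (intro Greatest_le_nat[where b = "seqs.dim E"]) auto
  have proj: "proj k e f = f" if f: "f \<in> E" for f
  proof (rule ccontr)
    assume neq: "proj k e f \<noteq> f"
    define u where "u = f - proj k e f"
    have pE: "proj k e f \<in> E" unfolding proj_def by (rule combination_in[OF e])
    have uE: "u \<in> E" unfolding u_def using f pE by (rule seqs.subspace_diff[OF E])
    have "u \<noteq> 0" using neq by (auto simp: u_def)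
    hence q: "q u > 0" using q_definite[OF uE] q_nonneg[OF uE] by force
    have uj: "H u (e j) = 0" if "j < k" for j
    proof -
      have ej: "e j \<in> E" using e that by (auto simp: orthonormal_def)
      have "H (u + proj k e f) (e j) = H u (e j) + H (proj k e f) (e j)"
        using uE pE ES' ej by (intro add_left) auto
      thus ?thesis using coefficient[OF e that, of "\<lambda>i. H f (e i)"] by (simp add: u_def proj_def)
    qed
    define w where "w = of_real (inverse (q u)) *\<^sub>q u"
    have wE: "w \<in> E" unfolding w_def by (rule seqs.subspace_scale[OF E uE])
    have wj: "H w (e j) = 0" "H (e j) w = 0" if "j < k" for j
    proof -
      have ej: "e j \<in> E" using e that by (auto simp: orthonormal_def)
      show 1: "H w (e j) = 0" unfolding w_def using uj[OF that] ej uE ES' by (simp add: scale_left)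
      show "H (e j) w = 0" using hermitian[OF ej wE] 1 by simp
    qed
    have ww: "H w w = 1"
    proof -
      have "H w w = of_real (inverse (q u)) * (cnj_scalar (of_real (inverse (q u))) * H u u)"
        using uE wE ES' unfolding w_def by (simp add: scale_left scale_right)
      also have "H u u = of_real ((q u)\<^sup>2)" by (rule diagonal[OF uE])
      also have "of_real (inverse (q u)) * (cnj_scalar (of_real (inverse (q u))) * of_real ((q u)\<^sup>2))
          = (of_real (inverse (q u) * (inverse (q u) * (q u)\<^sup>2)) :: 'k)"
        by (simp only: cnj_scalar_of_real of_real_mult)
      also have "inverse (q u) * (inverse (q u) * (q u)\<^sup>2) = 1" using q by (simp add: power2_eq_square field_simps)
      finally show ?thesis by simp
    qed
    have "orthonormal (Suc k) (e(k := w))"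
      using e wE wj ww by (auto simp: orthonormal_def less_Suc_eq)
    thus False using max by fastforce
  qed
  have "k = seqs.dim E"
  proof (rule antisym[OF le[OF e]])
    have "E \<subseteq> seqs.span (e ` {..<k})"
    proof
      fix f assume "f \<in> E"
      hence "f = (\<Sum>i<k. H f (e i) *\<^sub>q e i)" using proj by (simp add: proj_def)
      thus "f \<in> seqs.span (e ` {..<k})"
        by (elim ssubst) (intro seqs.span_sum seqs.span_scale seqs.span_base imageI, simp)
    qed
    hence "card B \<le> card (e ` {..<k})"
      using seqs.independent_span_bound[of "e ` {..<k}" B] B by auto
    also have "\<dots> \<le> k" using card_image_le[of "{..<k}" e] by simp
    finally show "seqs.dim E \<le> k" using B by simp
  qed
  thus ?thesis using e proj by blast
qed

text \<open>Pairing \<open>g\<close> with its own projection gives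
  \<open>H g (proj k e g) = q (proj k e g) ^ 2\<close>; comparing with the bound on \<open>H\<close>
  and cancelling one factor \<open>q\<close> leaves the claim.\<close>

lemma q_proj_le:
  assumes e: "orthonormal k e" and g: "g \<in> S"
  shows "q (proj k e g) \<le> K * N g"
proof -
  have eE: "\<And>i. i < k \<Longrightarrow> e i \<in> E" using e by (auto simp: orthonormal_def)
  have pE: "proj k e g \<in> E" unfolding proj_def by (rule combination_in[OF e])
  have "H g (proj k e g) = (\<Sum>i<k. cnj_scalar (H g (e i)) * H g (e i))"
    unfolding proj_def using g eE by (subst sum_right) auto
  also have "\<dots> = (\<Sum>i<k. (of_real (norm (H g (e i))))\<^sup>2)"
    by (intro sum.cong) (auto simp: mult_cnj_scalar mult.commute)
  also have "\<dots> = of_real ((q (proj k e g))\<^sup>2)"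
    unfolding proj_def q_combination[OF e] by simp
  finally have "norm (H g (proj k e g)) = (q (proj k e g))\<^sup>2" by (simp del: of_real_power)
  hence 1: "q (proj k e g) * q (proj k e g) \<le> q (proj k e g) * (K * N g)"
    using bound[OF g pE] by (simp add: power2_eq_square mult_ac)
  show ?thesis
  proof (cases "q (proj k e g) = 0")
    case True
    have "0 \<le> K * N g" using K_nonneg N_nonneg by simp
    thus ?thesis using True by simp
  next
    case False
    hence "q (proj k e g) > 0" using q_nonneg[OF pE] by simp
    thus ?thesis using 1 by simp
  qed
qed

lemma linear_map_proj:
  assumes e: "orthonormal k e" and "S' \<subseteq> S"
  shows "linear_map S' E (proj k e)"
proof -
  have eE: "\<And>i. i < k \<Longrightarrow> e i \<in> E" using e by (auto simp: orthonormal_def)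
  have "proj k e (x + y) = proj k e x + proj k e y" if "x \<in> S'" "y \<in> S'" for x y
    unfolding proj_def sum.distrib[symmetric] using that assms(2) eE
    by (intro sum.cong) (auto simp: add_left seqs.scale_left_distrib subset_iff)
  moreover have "proj k e (c *\<^sub>q x) = c *\<^sub>q proj k e x" if "x \<in> S'" for c x
    unfolding proj_def seqs.scale_sum_right using that assms(2) eE
    by (intro sum.cong) (auto simp: scale_left subset_iff)
  moreover have "proj k e x \<in> E" for x unfolding proj_def by (rule combination_in[OF e])
  ultimately show ?thesis unfolding linear_map_def by blast
qed

lemma complemented:
  assumes "E \<subseteq> S'" and "S' \<subseteq> S"
  shows "complemented K E S' N"
proof -
  obtain e where e: "orthonormal (seqs.dim E) e" "\<And>f. f \<in> E \<Longrightarrow> proj (seqs.dim E) e f = f"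
    using orthonormal_basis by blast
  have "op_norm S' N N (proj (seqs.dim E) e) \<le> ennreal K"
  proof (rule op_norm_le)
    fix g assume g: "g \<in> S'" "N g \<le> 1"
    have "N (proj (seqs.dim E) e g) \<le> q (proj (seqs.dim E) e g)"
      by (rule N_le) (simp add: proj_def combination_in[OF e(1)])
    also have "\<dots> \<le> K * N g" using g assms by (intro q_proj_le e) auto
    also have "\<dots> \<le> K * 1" using g K_nonneg by (intro mult_left_mono) auto
    finally show "N (proj (seqs.dim E) e g) \<le> K" by simp
  qed
  thus ?thesis unfolding complemented_def using assms e linear_map_proj[OF e(1) assms(2)] by blast
qed

text \<open>The coordinate map carries \<open>q\<close> isometrically to the Euclidean norm.
  Elements of \<open>E\<close> are fixed by the projection, so \<open>q_proj_le\<close> bounds this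
  map by \<open>K\<close>, and \<open>N_le\<close> bounds its inverse by 1.\<close>

lemma banach_mazur_le: "banach_mazur E N (ell2 (seqs.dim E)) (ell2_norm (seqs.dim E)) \<le> ennreal K"
proof -
  define n where "n = seqs.dim E"
  obtain e where e: "orthonormal n e" "\<And>f. f \<in> E \<Longrightarrow> proj n e f = f"
    using orthonormal_basis unfolding n_def by blast
  have eE: "\<And>i. i < n \<Longrightarrow> e i \<in> E" using e by (auto simp: orthonormal_def)
  define T where "T x i = (if i < n then H x (e i) else 0)" for x i
  have lin: "linear_map E (ell2 n) T"
    unfolding linear_map_def
    by (auto simp: T_def ell2_def fun_eq_iff seq_scale_def[of _ "T _"] add_left scale_left ES' eE)
  have inv: "T (\<Sum>i<n. u i *\<^sub>q e i) = u" if "u \<in> ell2 n" for u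
    using that coefficient[OF e(1)] by (auto simp: T_def ell2_def fun_eq_iff)
  have inj: "inj_on T E"
  proof (rule inj_onI)
    fix x y assume xy: "x \<in> E" "y \<in> E" "T x = T y"
    have "H x (e i) = H y (e i)" if "i \<in> {..<n}" for i
      using fun_cong[OF xy(3), of i] that by (simp add: T_def)
    hence "proj n e x = proj n e y" unfolding proj_def by (intro sum.cong refl) simp
    thus "x = y" using e(2) xy by simp
  qed
  have bij: "bij_betw T E (ell2 n)"
    unfolding bij_betw_def
  proof (intro conjI inj subset_antisym subsetI)
    fix u assume "u \<in> T ` E"
    thus "u \<in> ell2 n" using lin by (auto simp: linear_map_def)
  next
    fix u :: "nat \<Rightarrow> 'k" assume "u \<in> ell2 n"
    hence "u = T (\<Sum>i<n. u i *\<^sub>q e i)" using inv by simp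
    thus "u \<in> T ` E" using combination_in[OF e(1)] by (rule image_eqI)
  qed
  have ell2: "ell2_norm n u = q (\<Sum>i<n. u i *\<^sub>q e i)" for u
    using q_combination[OF e(1), of u] q_nonneg[OF combination_in[OF e(1)], of u]
    by (simp add: ell2_norm_def real_sqrt_unique)
  have T_norm: "ell2_norm n (T x) = q x" if x: "x \<in> E" for x
  proof -
    have "(\<Sum>i<n. T x i *\<^sub>q e i) = proj n e x"
      unfolding proj_def by (intro sum.cong) (auto simp: T_def)
    thus ?thesis using ell2[of "T x"] e(2)[OF x] by simp
  qed
  have "op_norm E N (ell2_norm n) T \<le> ennreal K"
  proof (rule op_norm_le)
    fix x assume x: "x \<in> E" "N x \<le> 1"
    have "ell2_norm n (T x) = q (proj n e x)" using T_norm e(2) x by simp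
    also have "\<dots> \<le> K * N x" using x ES' by (intro q_proj_le e) auto
    also have "\<dots> \<le> K * 1" using x K_nonneg by (intro mult_left_mono) auto
    finally show "ell2_norm n (T x) \<le> K" by simp
  qed
  moreover have "op_norm (ell2 n) (ell2_norm n) N (inv_into E T) \<le> ennreal 1"
  proof (rule op_norm_le)
    fix u :: "nat \<Rightarrow> 'k" assume u: "u \<in> ell2 n" "ell2_norm n u \<le> 1"
    have "inv_into E T u = (\<Sum>i<n. u i *\<^sub>q e i)"
      by (intro inv_into_f_eq inj combination_in[OF e(1)] inv u(1))
    hence "N (inv_into E T u) \<le> ell2_norm n u"
      using N_le[OF combination_in[OF e(1)], of u] ell2 by simp
    thus "N (inv_into E T u) \<le> 1" using u by simp
  qed
  ultimately have le: "op_norm E N (ell2_norm n) T * op_norm (ell2 n) (ell2_norm n) N (inv_into E T)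
      \<le> ennreal K * ennreal 1"
    and "op_norm E N (ell2_norm n) T < \<infinity>" "op_norm (ell2 n) (ell2_norm n) N (inv_into E T) < \<infinity>"
    by (rule mult_mono, simp_all add: le_less_trans)
  hence "banach_mazur E N (ell2 n) (ell2_norm n)
      \<le> op_norm E N (ell2_norm n) T * op_norm (ell2 n) (ell2_norm n) N (inv_into E T)"
    unfolding banach_mazur_def using lin bij by (intro INF_lower) auto
  thus ?thesis using le by (simp add: n_def)
qed

end

section \<open>The space \<open>Y\<close>\<close>

lemma dyadic_cover:
  assumes "k \<ge> 2"
  shows "\<exists>j\<ge>1. k \<in> dyadic j"
proof -
  obtain j where j: "2 ^ j \<le> k" "k < 2 ^ (j + 1)" using ex_power_ivl1[of 2 k] assms by auto
  have "j \<noteq> 0" using j assms by (intro notI) simp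
  thus ?thesis using j by (intro exI[of _ j]) (auto simp: dyadic_def)
qed

lemma dyadic_unique: "k \<in> dyadic i \<Longrightarrow> k \<in> dyadic j \<Longrightarrow> i = j"
proof -
  have "i \<le> j" if "k \<in> dyadic i" "k \<in> dyadic j" for i j
  proof -
    have "(2::nat) ^ i < 2 ^ (j + 1)" using that unfolding dyadic_def by (auto intro: le_less_trans)
    hence "i < j + 1" by (rule power_less_imp_less_exp[rotated]) simp
    thus ?thesis by simp
  qed
  thus "k \<in> dyadic i \<Longrightarrow> k \<in> dyadic j \<Longrightarrow> i = j" by (simp add: antisym)
qed

lemma finite_dyadic [simp]: "finite (dyadic j)"
  by (simp add: dyadic_def)

lemma card_dyadic: "card (dyadic j) = 2 ^ j"
  by (simp add: dyadic_def)

lemma exponent_gap_nonneg: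
  assumes "\<epsilon> > 0" "n \<ge> 1"
  shows "exponent_gap \<epsilon> n \<ge> 0"
proof -
  have "real n powr (1 + \<epsilon>) \<ge> 1" using assms by (intro ge_one_powr_ge_zero) auto
  moreover have "(2::real) powr (1 / 8) > 1" by (rule gr_one_powr) auto
  ultimately have "log (2 powr (1 / 8)) (real n powr (1 + \<epsilon>)) \<ge> 0"
    using assms by (subst zero_le_log_cancel_iff) auto
  thus ?thesis unfolding exponent_gap_def by (intro mult_nonneg_nonneg) auto
qed

text \<open>The value 1 is what \<open>1 / (1 / 2 + g)\<close> takes at \<open>g = 1 / 2\<close>, so
  the exceptional branch of \<open>p_exp\<close> amounts to truncating the gap.\<close>

lemma inverse_p_exp: "1 / p_exp \<epsilon> n - 1 / 2 = min (exponent_gap \<epsilon> n) (1 / 2)"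
  by (simp add: p_exp_def)

text \<open>The square root of \<open>layer\<close> for \<open>j \<ge> 1\<close>: it, and not its
  square, is subadditive and homogeneous.\<close>

definition layer_norm ::
    "real \<Rightarrow> (nat \<Rightarrow> nat set set) \<Rightarrow> nat \<Rightarrow> (nat \<Rightarrow> 'k::{real_normed_field,euclidean_space}) \<Rightarrow> real"
  where "layer_norm \<epsilon> \<Delta> j x = lp_norm (p_exp \<epsilon> j) (\<Delta> j) (L2_set (\<lambda>k. norm (x k)))"

locale layered =
  fixes \<epsilon> :: real and \<Delta> :: "nat \<Rightarrow> nat set set"
  assumes eps: "\<epsilon> > 0" and part: "\<And>n. n \<ge> 1 \<Longrightarrow> partition_on (dyadic n) (\<Delta> n)"
begin

abbreviation "p \<equiv> p_exp \<epsilon>"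
abbreviation "L \<equiv> layer_norm \<epsilon> \<Delta>"
abbreviation "Y \<equiv> Y_space \<epsilon> \<Delta>"
abbreviation "nY \<equiv> Y_norm \<epsilon> \<Delta>"

lemma p_bounds: "n \<ge> 1 \<Longrightarrow> 1 \<le> p n" "n \<ge> 1 \<Longrightarrow> p n \<le> 2" "n \<ge> 1 \<Longrightarrow> 0 < p n"
  using exponent_gap_nonneg[OF eps, of n] by (auto simp: p_exp_def field_simps)

lemma finite_parts: "j \<ge> 1 \<Longrightarrow> finite (\<Delta> j)"
  using part finite_elements finite_dyadic by blast

lemma part_subset: "j \<ge> 1 \<Longrightarrow> A \<in> \<Delta> j \<Longrightarrow> A \<subseteq> dyadic j"
  using part partition_onD1 by blast

lemma finite_part: "j \<ge> 1 \<Longrightarrow> A \<in> \<Delta> j \<Longrightarrow> finite A"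
  using part_subset finite_dyadic finite_subset by blast

lemma part_cover: "j \<ge> 1 \<Longrightarrow> k \<in> dyadic j \<Longrightarrow> \<exists>A\<in>\<Delta> j. k \<in> A"
  using part partition_onD1 by blast

lemma layer_eq:
  assumes "j \<ge> 1"
  shows "layer \<epsilon> \<Delta> j x = (L j x)\<^sup>2"
proof -
  have "(\<Sum>k\<in>A. (norm (x k))\<^sup>2) powr (p j / 2) = (L2_set (\<lambda>k. norm (x k)) A) powr p j" for A
    unfolding L2_set_def by (simp add: powr_half_sqrt[symmetric] powr_powr sum_nonneg)
  thus ?thesis
    using p_bounds(3)[OF assms]
    by (simp add: layer_def layer_norm_def lp_norm_def power2_eq_square flip: powr_add)
qed

lemma L_nonneg [simp]: "0 \<le> L j x"
  by (simp add: layer_norm_def)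

lemma L_cong:
  assumes "j \<ge> 1" "\<And>k. k \<in> dyadic j \<Longrightarrow> norm (x k) = norm (y k)"
  shows "L j x = L j y"
  unfolding layer_norm_def lp_norm_def
  using assms part_subset by (intro arg_cong2[where f = "(powr)"] sum.cong refl L2_set_cong) blast+

lemma L_triangle:
  assumes "j \<ge> 1"
  shows "L j (x + y) \<le> L j x + L j y"
proof -
  have "L j (x + y) \<le> lp_norm (p j) (\<Delta> j) (\<lambda>A. L2_set (\<lambda>k. norm (x k)) A + L2_set (\<lambda>k. norm (y k)) A)"
    unfolding layer_norm_def
  proof (intro lp_norm_mono conjI)
    fix A
    have "L2_set (\<lambda>k. norm ((x + y) k)) A \<le> L2_set (\<lambda>k. norm (x k) + norm (y k)) A"
      by (intro L2_set_mono) (auto intro: norm_triangle_ineq)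
    also have "\<dots> \<le> L2_set (\<lambda>k. norm (x k)) A + L2_set (\<lambda>k. norm (y k)) A" by (rule L2_set_triangle_ineq)
    finally show "L2_set (\<lambda>k. norm ((x + y) k)) A \<le> \<dots>" .
  qed (use p_bounds(3)[OF assms] in auto)
  also have "\<dots> \<le> L j x + L j y"
    unfolding layer_norm_def using p_bounds(1)[OF assms] finite_parts[OF assms] by (intro lp_norm_triangle) auto
  finally show ?thesis .
qed

lemma L_scale:
  assumes "j \<ge> 1"
  shows "L j (c *\<^sub>q x) = norm c * L j x"
proof -
  have "L2_set (\<lambda>k. norm ((c *\<^sub>q x) k)) A = norm c * L2_set (\<lambda>k. norm (x k)) A" for A
    by (simp add: seq_scale_def norm_mult L2_set_right_distrib)
  hence "L2_set (\<lambda>k. norm ((c *\<^sub>q x) k)) = (\<lambda>A. norm c * L2_set (\<lambda>k. norm (x k)) A)" by (rule ext)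
  thus ?thesis
    unfolding layer_norm_def using p_bounds(3)[OF assms] by (simp only:) (simp add: lp_norm_scale)
qed

lemma L_zero:
  assumes "j \<ge> 1" "\<And>k. k \<in> dyadic j \<Longrightarrow> x k = 0"
  shows "L j x = 0"
proof -
  have "L j x = L j (0 *\<^sub>q x)" using assms by (intro L_cong) (auto simp: seq_scale_def)
  thus ?thesis using L_scale[OF assms(1), of 0 x] by simp
qed

lemma norm_le_L:
  assumes "j \<ge> 1" "k \<in> dyadic j"
  shows "norm (x k) \<le> L j x"
proof -
  obtain A where A: "A \<in> \<Delta> j" "k \<in> A" using part_cover[OF assms] by blast
  have "norm (x k) \<le> L2_set (\<lambda>k. norm (x k)) A"
    using A finite_part[OF assms(1)] by (intro member_le_L2_set) auto
  also have "\<dots> \<le> L j x" unfolding layer_norm_def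
    using A finite_parts[OF assms(1)] p_bounds(3)[OF assms(1)] by (intro lp_norm_ge) auto
  finally show ?thesis .
qed

lemma mem_Y: "x \<in> Y \<longleftrightarrow> x 0 = 0 \<and> x 1 = 0 \<and> (\<lambda>j. (L j x)\<^sup>2) summable_on {1..}"
proof -
  have "(\<lambda>j. layer \<epsilon> \<Delta> j x) summable_on {1..} \<longleftrightarrow> (\<lambda>j. (L j x)\<^sup>2) summable_on {1..}"
    by (intro summable_on_cong) (simp add: layer_eq)
  thus ?thesis by (auto simp: Y_space_def numeral_2_eq_2 less_Suc_eq)
qed

lemma nY_eq: "nY x = sqrt (\<Sum>\<^sub>\<infinity>j\<in>{1..}. (L j x)\<^sup>2)"
  unfolding Y_norm_def by (intro arg_cong[where f = sqrt] infsum_cong) (simp add: layer_eq)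

lemma nY_nonneg [simp]: "0 \<le> nY x"
  unfolding nY_eq by (intro real_sqrt_ge_zero infsum_nonneg) auto

lemma L2_set_le_nY:
  assumes "x \<in> Y" "finite F" "F \<subseteq> {1..}"
  shows "L2_set (\<lambda>j. L j x) F \<le> nY x"
  unfolding L2_set_def nY_eq using assms by (intro real_sqrt_le_mono finite_sum_le_infsum) (auto simp: mem_Y)

lemma L_le_nY: "x \<in> Y \<Longrightarrow> j \<ge> 1 \<Longrightarrow> L j x \<le> nY x"
  using L2_set_le_nY[of x "{j}"] by simp

lemma norm_le_nY:
  assumes "x \<in> Y"
  shows "norm (x k) \<le> nY x"
proof (cases "k \<ge> 2")
  case True
  then obtain j where "j \<ge> 1" "k \<in> dyadic j" using dyadic_cover by blast
  thus ?thesis using norm_le_L[of j k x] L_le_nY[OF assms, of j] by simp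
next
  case False
  hence "k = 0 \<or> k = 1" by auto
  thus ?thesis using assms by (auto simp: mem_Y)
qed

text \<open>Bounds on finite sets of layers give membership and the norm estimate at once; on finite
  sets the triangle inequality of \<open>L2_set\<close> applies.\<close>

lemma Y_bounded:
  assumes "x 0 = 0" "x 1 = 0" "M \<ge> 0"
    and "\<And>F. finite F \<Longrightarrow> F \<subseteq> {1..} \<Longrightarrow> L2_set (\<lambda>j. L j x) F \<le> M"
  shows "x \<in> Y" "nY x \<le> M"
proof -
  have le: "(\<Sum>j\<in>F. (L j x)\<^sup>2) \<le> M\<^sup>2" if "finite F" "F \<subseteq> {1..}" for F
    using assms(4)[OF that] unfolding L2_set_def by (rule sqrt_le_D)
  have s: "(\<lambda>j. (L j x)\<^sup>2) summable_on {1..}"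
    using le by (intro nonneg_bdd_above_summable_on bdd_aboveI2[where M = "M\<^sup>2"]) auto
  thus "x \<in> Y" using assms by (simp add: mem_Y)
  have "(\<Sum>\<^sub>\<infinity>j\<in>{1..}. (L j x)\<^sup>2) \<le> M\<^sup>2" using le by (intro infsum_le_finite_sums s) auto
  thus "nY x \<le> M" using assms(3) real_le_lsqrt unfolding nY_eq by (simp add: real_sqrt_le_iff real_le_lsqrt infsum_nonneg)
qed

lemma Y_add:
  assumes "x \<in> Y" "y \<in> Y"
  shows "x + y \<in> Y" "nY (x + y) \<le> nY x + nY y"
proof -
  have b: "L2_set (\<lambda>j. L j (x + y)) F \<le> nY x + nY y" if F: "finite F" "F \<subseteq> {1..}" for F
  proof -
    have "L2_set (\<lambda>j. L j (x + y)) F \<le> L2_set (\<lambda>j. L j x + L j y) F"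
      using F by (intro L2_set_mono L_triangle) auto
    also have "\<dots> \<le> L2_set (\<lambda>j. L j x) F + L2_set (\<lambda>j. L j y) F" by (rule L2_set_triangle_ineq)
    also have "\<dots> \<le> nY x + nY y" using assms F by (intro add_mono L2_set_le_nY)
    finally show ?thesis .
  qed
  have "(x + y) 0 = 0" "(x + y) 1 = 0" "nY x + nY y \<ge> 0" using assms by (auto simp: mem_Y)
  note Y_bounded[OF this b]
  thus "x + y \<in> Y" "nY (x + y) \<le> nY x + nY y" by blast+
qed

lemma Y_scale:
  assumes "x \<in> Y"
  shows "c *\<^sub>q x \<in> Y"
proof -
  have "(\<lambda>j. (norm c)\<^sup>2 * (L j x)\<^sup>2) summable_on {1..}"
    using assms by (intro summable_on_cmult_right) (auto simp: mem_Y)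
  hence "(\<lambda>j. (L j (c *\<^sub>q x))\<^sup>2) summable_on {1..}"
    by (rule summable_on_cong[THEN iffD1, rotated]) (auto simp: L_scale power_mult_distrib)
  thus ?thesis using assms by (simp add: mem_Y seq_scale_def)
qed

lemma nY_scale: "nY (c *\<^sub>q x) = norm c * nY x"
proof -
  have "(\<Sum>\<^sub>\<infinity>j\<in>{1..}. (L j (c *\<^sub>q x))\<^sup>2) = (\<Sum>\<^sub>\<infinity>j\<in>{1..}. (norm c)\<^sup>2 * (L j x)\<^sup>2)"
    by (intro infsum_cong) (auto simp: L_scale power_mult_distrib)
  also have "\<dots> = (norm c)\<^sup>2 * (\<Sum>\<^sub>\<infinity>j\<in>{1..}. (L j x)\<^sup>2)" by (rule infsum_cmult_right')
  finally show ?thesis by (simp add: nY_eq real_sqrt_mult)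
qed

lemma Y_zero: "(0 :: nat \<Rightarrow> 'k::{real_normed_field,euclidean_space}) \<in> Y"
  "nY (0 :: nat \<Rightarrow> 'k) = 0"
proof -
  have L0: "L j (0 :: nat \<Rightarrow> 'k) = 0" if "j \<ge> 1" for j using that by (intro L_zero) auto
  have "L2_set (\<lambda>j. L j (0 :: nat \<Rightarrow> 'k)) F \<le> 0" if "finite F" "F \<subseteq> {1..}" for F
  proof -
    have "L2_set (\<lambda>j. L j (0 :: nat \<Rightarrow> 'k)) F = L2_set (\<lambda>j. 0) F" using that L0 by (intro L2_set_cong) auto
    thus ?thesis by (simp add: L2_set_def)
  qed
  note b = Y_bounded[of "0 :: nat \<Rightarrow> 'k" 0, OF _ _ _ this]
  show "(0 :: nat \<Rightarrow> 'k) \<in> Y" using b(1) by simp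
  show "nY (0 :: nat \<Rightarrow> 'k) = 0" using b(2) by (intro antisym nY_nonneg) simp
qed

lemma subspace_Y: "seqs.subspace Y"
  by (intro seqs.subspaceI Y_zero Y_add Y_scale)

lemma nY_minus: "nY (x - y) = nY (y - x)"
proof -
  have "x - y = (-1) *\<^sub>q (y - x)" by (auto simp: seq_scale_def fun_eq_iff)
  thus ?thesis using nY_scale[of "-1" "y - x"] by simp
qed

lemma nY_eq_0: "x \<in> Y \<Longrightarrow> nY x = 0 \<longleftrightarrow> x = 0"
proof
  assume "x \<in> Y" "nY x = 0"
  thus "x = 0" using norm_le_nY[of x] by (auto simp: fun_eq_iff)
qed (simp add: Y_zero)

lemma metric_space_Y:
  "Metric_space (Y :: (nat \<Rightarrow> 'k::{real_normed_field,euclidean_space}) set) (\<lambda>x y. nY (x - y))"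
proof
  fix x y w :: "nat \<Rightarrow> 'k" assume xyz: "x \<in> Y" "y \<in> Y" "w \<in> Y"
  note diff = seqs.subspace_diff[OF subspace_Y]
  have "nY ((x - y) + (y - w)) \<le> nY (x - y) + nY (y - w)" using xyz by (intro Y_add diff)
  thus "nY (x - w) \<le> nY (x - y) + nY (y - w)" by simp
next
  fix x y :: "nat \<Rightarrow> 'k" assume xy: "x \<in> Y" "y \<in> Y"
  show "nY (x - y) = 0 \<longleftrightarrow> x = y" using nY_eq_0[OF seqs.subspace_diff[OF subspace_Y xy]] by simp
qed (auto intro: nY_minus)

lemma sum_Y:
  assumes "\<And>i. i \<in> A \<Longrightarrow> x i \<in> Y"
  shows "(\<Sum>i\<in>A. x i) \<in> Y" "nY (\<Sum>i\<in>A. x i) \<le> (\<Sum>i\<in>A. nY (x i))"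
proof -
  have "(\<Sum>i\<in>A. x i) \<in> Y \<and> nY (\<Sum>i\<in>A. x i) \<le> (\<Sum>i\<in>A. nY (x i))"
    using assms
  proof (induction A rule: infinite_finite_induct)
    case (insert a A)
    have eq: "(\<Sum>i\<in>insert a A. x i) = x a + (\<Sum>i\<in>A. x i)" using insert by (intro sum.insert)
    have "x a \<in> Y" "(\<Sum>i\<in>A. x i) \<in> Y" "nY (\<Sum>i\<in>A. x i) \<le> (\<Sum>i\<in>A. nY (x i))" using insert by auto
    note xA = this
    have "nY (x a + (\<Sum>i\<in>A. x i)) \<le> nY (x a) + (\<Sum>i\<in>A. nY (x i))"
      using Y_add(2)[OF xA(1,2)] xA(3) by linarith
    also have "\<dots> = (\<Sum>i\<in>insert a A. nY (x i))" using insert(1,2) by simp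
    finally show ?case unfolding eq using Y_add(1)[OF xA(1,2)] by blast
  qed (auto simp: Y_zero)
  thus "(\<Sum>i\<in>A. x i) \<in> Y" "nY (\<Sum>i\<in>A. x i) \<le> (\<Sum>i\<in>A. nY (x i))" by auto
qed

text \<open>Within a single block the layer norm is Euclidean whatever the exponent, and the other
  layers are not touched. This is why hypothesis \<open>d\<close> places each \<open>A j\<close>
  inside one block.\<close>

lemma block_norm:
  fixes x :: "nat \<Rightarrow> 'k::{real_normed_field,euclidean_space}"
  assumes j: "j \<ge> 1" and D: "D \<in> \<Delta> j" and A: "A \<subseteq> D"
    and x: "\<And>k. k \<notin> A \<Longrightarrow> x k = 0" "\<And>k. k \<in> A \<Longrightarrow> norm (x k) = 1"
  shows "x \<in> Y" "nY x \<le> sqrt (real (card A))"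
proof -
  have finA: "finite A" using finite_part[OF j D] A finite_subset by blast
  have Ad: "A \<subseteq> dyadic j" using A part_subset[OF j D] by auto
  have other: "L i x = 0" if "i \<ge> 1" "i \<noteq> j" for i
    using that Ad dyadic_unique x(1) by (intro L_zero) blast+
  have block: "L2_set (\<lambda>k. norm (x k)) B = (if B = D then sqrt (card A) else 0)" if B: "B \<in> \<Delta> j" for B
  proof (cases "B = D")
    case True
    have "(\<Sum>k\<in>D. (norm (x k))\<^sup>2) = (\<Sum>k\<in>A. (norm (x k))\<^sup>2)"
      using x(1) A finite_part[OF j D] by (intro sum.mono_neutral_right) auto
    also have "\<dots> = (\<Sum>k\<in>A. 1)" using x(2) by (intro sum.cong) auto
    finally show ?thesis using True by (simp add: L2_set_def)
  next
    case False
    hence "B \<inter> D = {}" using part[OF j] B D unfolding partition_on_def disjoint_def by blast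
    hence "\<And>k. k \<in> B \<Longrightarrow> x k = 0" using x(1) A by blast
    thus ?thesis using False by (simp add: L2_set_def)
  qed
  have "(\<Sum>B\<in>\<Delta> j. L2_set (\<lambda>k. norm (x k)) B powr p j) = (\<Sum>B\<in>\<Delta> j. if B = D then sqrt (card A) powr p j else 0)"
    using block p_bounds(3)[OF j] by (intro sum.cong) auto
  also have "\<dots> = sqrt (card A) powr p j" using D finite_parts[OF j] by simp
  finally have Lj: "L j x = sqrt (card A)" using p_bounds(3)[OF j]
    by (simp add: layer_norm_def lp_norm_def powr_powr)
  have bd: "L2_set (\<lambda>i. L i x) F \<le> sqrt (card A)" if F: "finite F" "F \<subseteq> {1..}" for F
  proof -
    have "(\<Sum>i\<in>F. (L i x)\<^sup>2) \<le> (\<Sum>i\<in>insert j F. (L i x)\<^sup>2)" using F by (intro sum_mono2) auto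
    also have "\<dots> = (\<Sum>i\<in>{j}. (L i x)\<^sup>2)" using F other j by (intro sum.mono_neutral_right) auto
    also have "\<dots> = card A" by (simp add: Lj)
    finally show ?thesis unfolding L2_set_def by (rule real_sqrt_le_mono)
  qed
  have "0 \<notin> A" "1 \<notin> A" using Ad j power_increasing[of 1 j "2::nat"] by (auto simp: dyadic_def)
  hence "x 0 = 0" "x 1 = 0" "sqrt (real (card A)) \<ge> 0" using x(1) by auto
  note Y_bounded[OF this bd]
  thus "x \<in> Y" "nY x \<le> sqrt (real (card A))" by blast+
qed

lemma unit_seq_Y:
  assumes "k \<ge> 2"
  shows "unit_seq k \<in> Y" "nY (unit_seq k) \<le> 1"
proof -
  obtain j where j: "j \<ge> 1" "k \<in> dyadic j" using dyadic_cover[OF assms] by blast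
  then obtain D where "D \<in> \<Delta> j" "k \<in> D" using part_cover by blast
  thus "unit_seq k \<in> Y" "nY (unit_seq k) \<le> 1"
    using block_norm[of j D "{k}" "unit_seq k"] j by (auto simp: unit_seq_def)
qed

end

section \<open>The space \<open>X\<close>\<close>

lemma subspace_W: "seqs.subspace W"
  unfolding W_def by (rule seqs.subspace_span)

lemma z_in_W: "i \<ge> 1 \<Longrightarrow> z i \<in> W"
  unfolding W_def by (intro seqs.span_base) auto

lemma z_eq_0: "k < 2 * i \<Longrightarrow> z i k = 0"
  by (simp add: z_def unit_seq_def)

lemma z'_z: "i \<ge> 1 \<Longrightarrow> z' i (z i) = 1"
  by (simp add: z'_def z_def unit_seq_def)

lemma z'_scale: "z' i (c *\<^sub>q x) = c * z' i x"
  by (simp add: z'_def seq_scale_def algebra_simps)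

lemma z'_diff: "z' i (x - y) = z' i x - z' i y"
  by (simp add: z'_def algebra_simps diff_divide_distrib)

lemma z'_sum: "z' i (\<Sum>j\<in>A. x j) = (\<Sum>j\<in>A. z' i (x j))"
  by (simp add: z'_def sum_fun_apply sum_subtractf[symmetric] sum_divide_distrib)

lemma norm_z': "norm (z' i x) \<le> (norm (x (2 * i)) + norm (x (2 * i + 1))) / 2"
proof -
  have "norm (z' i x) = norm (x (2 * i) - x (2 * i + 1)) / 2"
    by (simp add: z'_def norm_divide)
  thus ?thesis using norm_triangle_ineq4[of "x (2 * i)" "x (2 * i + 1)"] by simp
qed

lemma double_in_dyadic: "i \<in> dyadic n \<Longrightarrow> 2 * i \<in> dyadic (n + 1) \<and> 2 * i + 1 \<in> dyadic (n + 1)"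
  by (auto simp: dyadic_def)

lemma beta_cong:
  assumes "\<And>i k. i \<in> dyadic n \<Longrightarrow> k \<in> dyadic (n + 1) \<Longrightarrow> U (z i) k = V (z i) k"
  shows "beta n U = beta n V"
  unfolding beta_def z'_def using assms double_in_dyadic by (intro arg_cong2[where f = "(*)"] sum.cong refl) auto

lemma dyadic_ge_1: "i \<in> dyadic n \<Longrightarrow> i \<ge> 1"
  by (auto simp: dyadic_def intro: order_trans[OF one_le_power[of 2]])

lemma beta_diff_id: "beta n (\<lambda>x. T x - x) = beta n T - 1"
proof -
  have "(\<Sum>i\<in>dyadic n. z' i (T (z i) - z i)) = (\<Sum>i\<in>dyadic n. z' i (T (z i))) - (\<Sum>i\<in>dyadic n. 1)"
    unfolding sum_subtractf[symmetric] using dyadic_ge_1 by (intro sum.cong) (auto simp: z'_diff z'_z)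
  thus ?thesis unfolding beta_def by (simp add: card_dyadic diff_divide_distrib)
qed

text \<open>The member of a cover that contains 0 contains a ball around 0, hence all but finitely
  many points of \<open>K\<close>.\<close>

lemma compactin_null_set:
  assumes "Metric_space S (\<lambda>x y. N (x - y))" and K: "K \<subseteq> S" "0 \<in> K"
    and minus: "\<And>x. N (0 - x) = N x"
    and fin: "\<And>r. r > 0 \<Longrightarrow> finite {x \<in> K. N x \<ge> r}"
  shows "compactin (norm_topology S N) K"
proof -
  interpret Metric_space S "\<lambda>x y. N (x - y)" by fact
  show ?thesis unfolding compactin_def
  proof (intro conjI allI impI)
    show "K \<subseteq> topspace mtopology" using K by simp
  next
    fix \<U> assume U: "(\<forall>U\<in>\<U>. openin mtopology U) \<and> K \<subseteq> \<Union>\<U>"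
    then obtain u where u: "u \<in> \<U>" "0 \<in> u" using K by auto
    then obtain r where r: "r > 0" "mball 0 r \<subseteq> u" using U openin_mtopology by meson
    have "\<forall>x\<in>{x \<in> K. N x \<ge> r}. \<exists>V\<in>\<U>. x \<in> V" using U by auto
    then obtain V where V: "\<And>x. x \<in> {x \<in> K. N x \<ge> r} \<Longrightarrow> V x \<in> \<U> \<and> x \<in> V x" by metis
    have "K \<subseteq> \<Union> (insert u (V ` {x \<in> K. N x \<ge> r}))"
    proof
      fix x assume x: "x \<in> K"
      show "x \<in> \<Union> (insert u (V ` {x \<in> K. N x \<ge> r}))"
      proof (cases "N x \<ge> r")
        case True
        thus ?thesis using x V by blast
      next
        case False
        hence "x \<in> mball 0 r" using x K minus[of x] by (auto simp: in_mball)
        thus ?thesis using r by auto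
      qed
    qed
    moreover have "finite (insert u (V ` {x \<in> K. N x \<ge> r}))" using fin[OF r(1)] by simp
    moreover have "insert u (V ` {x \<in> K. N x \<ge> r}) \<subseteq> \<U>" using u V by auto
    ultimately show "\<exists>\<F>. finite \<F> \<and> \<F> \<subseteq> \<U> \<and> K \<subseteq> \<Union>\<F>" by blast
  qed
qed

text \<open>
  Under a change of one sign the off-diagonal terms involving it change sign, so for one of the two
  choices they do not decrease the norm.
\<close>

lemma exists_signs:
  fixes a :: "'i \<Rightarrow> 'i \<Rightarrow> 'k::real_normed_field"
  assumes "finite B"
  shows "\<exists>s. (\<forall>i. s i \<in> {1, -1}) \<and>
    norm (c + (\<Sum>i\<in>B. a i i)) \<le> norm (c + (\<Sum>i\<in>B. \<Sum>j\<in>B. s i * s j * a i j))"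
  using assms
proof (induction B arbitrary: c rule: finite_induct)
  case empty
  show ?case by (rule exI[of _ "\<lambda>_. 1"]) auto
next
  case (insert b B)
  \<comment> \<open>The offset \<open>c\<close> absorbs the new diagonal entry \<open>a b b\<close>,
    which no choice of signs affects.\<close>
  obtain s where s: "\<And>i. s i \<in> {1, -1}"
    "norm ((c + a b b) + (\<Sum>i\<in>B. a i i)) \<le> norm ((c + a b b) + (\<Sum>i\<in>B. \<Sum>j\<in>B. s i * s j * a i j))"
    using insert.IH[of "c + a b b"] by blast
  define P where "P = (c + a b b) + (\<Sum>i\<in>B. \<Sum>j\<in>B. s i * s j * a i j)"
  define Q where "Q = (\<Sum>i\<in>B. s i * (a i b + a b i))"
  have ev: "c + (\<Sum>i\<in>insert b B. \<Sum>j\<in>insert b B. (s(b := t)) i * (s(b := t)) j * a i j) = P + t * Q"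
    if t: "t * t = 1" for t
  proof -
    have neq: "i \<noteq> b" if "i \<in> B" for i using that insert by auto
    have "(\<Sum>i\<in>insert b B. \<Sum>j\<in>insert b B. (s(b := t)) i * (s(b := t)) j * a i j)
        = (t * t * a b b + (\<Sum>j\<in>B. t * s j * a b j)) + (\<Sum>i\<in>B. s i * t * a i b + (\<Sum>j\<in>B. s i * s j * a i j))"
      using insert neq by (simp cong: sum.cong)
    thus ?thesis
      using t by (simp add: P_def Q_def sum.distrib sum_distrib_left algebra_simps)
  qed
  have "2 * norm P = norm ((P + Q) + (P - Q))" by (simp add: norm_mult flip: mult_2)
  also have "\<dots> \<le> norm (P + Q) + norm (P - Q)" by (rule norm_triangle_ineq)
  finally have "norm P \<le> norm (P + 1 * Q) \<or> norm P \<le> norm (P + (-1) * Q)" by auto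
  then obtain t where t: "t \<in> {1, -1}" "norm P \<le> norm (P + t * Q)" by blast
  have "norm (c + (\<Sum>i\<in>insert b B. a i i)) = norm ((c + a b b) + (\<Sum>i\<in>B. a i i))"
    using insert by (simp add: add.assoc)
  also have "\<dots> \<le> norm P" unfolding P_def by (rule s)
  also have "\<dots> \<le> norm (c + (\<Sum>i\<in>insert b B. \<Sum>j\<in>insert b B. (s(b := t)) i * (s(b := t)) j * a i j))"
    using t by (subst ev) auto
  finally show ?case using s(1) t(1) by (intro exI[of _ "s(b := t)"]) auto
qed

section \<open>The closure of W, finite rank maps, and sums over transversal blocks\<close>

context layered
begin

abbreviation "X \<equiv> X_space \<epsilon> \<Delta>"

lemma z_in_Y:
  assumes "i \<ge> 1"
  shows "(z i :: nat \<Rightarrow> 'k::{real_normed_field,euclidean_space}) \<in> Y" "nY (z i :: nat \<Rightarrow> 'k) \<le> 6"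
proof -
  let ?e = "\<lambda>k. unit_seq k :: nat \<Rightarrow> 'k"
  have e: "?e k \<in> Y" "nY (?e k) \<le> 1" "c *\<^sub>q ?e k \<in> Y" if "k \<ge> 2" for k c
    using unit_seq_Y[OF that] Y_scale by auto
  define ks where "ks = [(2 * i, 1 :: 'k), (2 * i + 1, -1), (4 * i, 1), (4 * i + 1, 1), (4 * i + 2, 1), (4 * i + 3, 1)]"
  have zs: "(z i :: nat \<Rightarrow> 'k) = (\<Sum>l<6. snd (ks ! l) *\<^sub>q ?e (fst (ks ! l)))"
    by (simp add: z_def ks_def numeral_eq_Suc lessThan_Suc fun_eq_iff seq_scale_def sum_fun_apply)
  have ge: "fst (ks ! l) \<ge> 2" "norm (snd (ks ! l)) = 1" if "l < 6" for l
    using that assms by (auto simp: ks_def less_Suc_eq numeral_eq_Suc)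
  show "(z i :: nat \<Rightarrow> 'k) \<in> Y" unfolding zs using e ge by (intro sum_Y) auto
  have "nY (z i :: nat \<Rightarrow> 'k) \<le> (\<Sum>l<6. nY (snd (ks ! l) *\<^sub>q ?e (fst (ks ! l))))"
    unfolding zs using e ge by (intro sum_Y) auto
  also have "\<dots> \<le> (\<Sum>l<6::nat. 1)" using e ge by (intro sum_mono) (auto simp: nY_scale)
  finally show "nY (z i :: nat \<Rightarrow> 'k) \<le> 6" by simp
qed

lemma W_subset_Y: "W \<subseteq> Y"
  unfolding W_def using z_in_Y by (intro seqs.span_minimal subspace_Y) auto

lemma mem_X: "x \<in> X \<longleftrightarrow> x \<in> Y \<and> (\<forall>r>0. \<exists>w\<in>W. nY (x - w) < r)"
proof -
  interpret Metric_space "Y :: (nat \<Rightarrow> 'a) set" "\<lambda>x y. nY (x - y)" by (rule metric_space_Y)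
  show ?thesis unfolding X_space_def metric_closure_of mem_Collect_eq in_mball using W_subset_Y by blast
qed

lemma X_subset_Y: "X \<subseteq> Y"
  by (auto simp: mem_X)

lemma W_subset_X: "(W :: (nat \<Rightarrow> 'k::{real_normed_field,euclidean_space}) set) \<subseteq> X"
proof
  fix x :: "nat \<Rightarrow> 'k" assume x: "x \<in> W"
  have "\<exists>w\<in>W. nY (x - w) < r" if "r > 0" for r using x that by (intro bexI[of _ x]) (auto simp: Y_zero)
  thus "x \<in> X" using x W_subset_Y by (auto simp: mem_X)
qed

lemma subspace_X: "seqs.subspace (X :: (nat \<Rightarrow> 'k::{real_normed_field,euclidean_space}) set)"
proof (intro seqs.subspaceI)
  show "0 \<in> X" using W_subset_X seqs.subspace_0[OF subspace_W] by auto
next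
  fix x y :: "nat \<Rightarrow> 'k" assume x: "x \<in> X" and y: "y \<in> X"
  have xy: "x \<in> Y" "y \<in> Y" using x y X_subset_Y by auto
  have "\<exists>w\<in>W. nY (x + y - w) < r" if r: "r > 0" for r
  proof -
    obtain u where u: "u \<in> W" "nY (x - u) < r / 2" using x r by (auto simp: mem_X dest!: spec[of _ "r / 2"])
    obtain v where v: "v \<in> W" "nY (y - v) < r / 2" using y r by (auto simp: mem_X dest!: spec[of _ "r / 2"])
    have uv: "u \<in> Y" "v \<in> Y" using u v W_subset_Y by auto
    have eq: "x + y - (u + v) = (x - u) + (y - v)" by simp
    have "nY (x + y - (u + v)) \<le> nY (x - u) + nY (y - v)"
      unfolding eq using xy uv by (intro Y_add seqs.subspace_diff[OF subspace_Y])
    thus ?thesis using u v by (intro bexI[of _ "u + v"] seqs.subspace_add[OF subspace_W]) auto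
  qed
  thus "x + y \<in> X" using Y_add[OF xy] by (simp add: mem_X)
next
  fix c and x :: "nat \<Rightarrow> 'k" assume x: "x \<in> X"
  have xY: "x \<in> Y" using x X_subset_Y by auto
  have "\<exists>w\<in>W. nY (c *\<^sub>q x - w) < r" if r: "r > 0" for r
  proof -
    obtain u where u: "u \<in> W" "nY (x - u) < r / (norm c + 1)"
      using x r by (auto simp: mem_X dest!: spec[of _ "r / (norm c + 1)"]) (smt (verit) divide_pos_pos norm_ge_zero)
    have "nY (c *\<^sub>q x - c *\<^sub>q u) = norm c * nY (x - u)"
      by (simp add: nY_scale flip: seqs.scale_right_diff_distrib)
    also have "\<dots> \<le> (norm c + 1) * nY (x - u)" by (intro mult_right_mono) auto
    also have "\<dots> < r" using u(2) by (simp add: field_simps add_pos_nonneg)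
    finally show ?thesis using u by (intro bexI[of _ "c *\<^sub>q u"] seqs.subspace_scale[OF subspace_W]) auto
  qed
  thus "c *\<^sub>q x \<in> X" using Y_scale[OF xY] by (simp add: mem_X)
qed

lemma metric_space_X:
  "Metric_space (X :: (nat \<Rightarrow> 'k::{real_normed_field,euclidean_space}) set) (\<lambda>x y. nY (x - y))"
  using Metric_space.subspace[OF metric_space_Y X_subset_Y] .

text \<open>
  Since \<open>beta\<close> and the right-hand side of its recursion see only finitely many coordinates, a map into
  the closure of \<open>W\<close> may be composed with \<open>R\<close>, and hypothesis \<open>a\<close> extends to such maps.
\<close>

lemma X_selection:
  "\<exists>R :: (nat \<Rightarrow> 'k) \<Rightarrow> nat \<Rightarrow> 'k::{real_normed_field,euclidean_space}.
    (\<forall>x. R x \<in> W) \<and> (\<forall>x y. R (x + y) = R x + R y) \<and> (\<forall>c x. R (c *\<^sub>q x) = c *\<^sub>q R x) \<and>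
    (\<forall>x\<in>X. \<forall>k<M. R x k = x k)"
proof -
  define r :: "(nat \<Rightarrow> 'k) \<Rightarrow> nat \<Rightarrow> 'k" where "r = seq_restrict {..<M}"
  define F where "F = r ` z ` {1..}"
  \<comment> \<open>\<open>z i\<close> starts at index \<open>2 * i\<close>, so all but finitely
    many restrictions vanish. Hence \<open>W\<close> is finite-dimensional when seen below
    \<open>M\<close>, and the pivot basis of its restriction lifts to vectors \<open>w j\<close> in
    \<open>W\<close>.\<close>
  have "F \<subseteq> insert 0 (r ` z ` {1..M})"
  proof
    fix v assume "v \<in> F"
    then obtain i where i: "i \<ge> 1" "v = r (z i)" by (auto simp: F_def)
    show "v \<in> insert 0 (r ` z ` {1..M})"
    proof (cases "i \<le> M")
      case True
      thus ?thesis using i by auto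
    next
      case False
      hence "v = 0" using i by (auto simp: r_def seq_restrict_def fun_eq_iff z_eq_0)
      thus ?thesis by simp
    qed
  qed
  hence finF: "finite F" by (rule finite_subset) auto
  have span_F: "seqs.span F = r ` W" unfolding F_def r_def W_def by (rule span_seq_restrict)
  obtain J g where J: "finite J" "\<forall>j\<in>J. g j \<in> seqs.span F"
    "\<forall>j\<in>J. \<forall>i\<in>J. g j i = (if i = j then 1 else 0)"
    "\<forall>v\<in>seqs.span F. v = (\<Sum>j\<in>J. v j *\<^sub>q g j)"
    using span_coordinates[OF finF] by blast
  have "\<forall>j\<in>J. \<exists>w\<in>W. g j = r w" using J(2) unfolding span_F by blast
  then obtain w where w: "\<And>j. j \<in> J \<Longrightarrow> w j \<in> W" "\<And>j. j \<in> J \<Longrightarrow> g j = r (w j)" by metis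
  have JM: "j < M" if "j \<in> J" for j
  proof (rule ccontr)
    assume "\<not> j < M"
    hence "g j j = 0" using w(2)[OF that] by (simp add: r_def seq_restrict_def)
    thus False using J(3) that by simp
  qed
  define R where "R x = (\<Sum>j\<in>J. x j *\<^sub>q w j)" for x
  have RW: "R v k = v k" if v: "v \<in> W" and k: "k < M" for v k
  proof -
    have "v k = r v k" using k by (simp add: r_def seq_restrict_def)
    also have "\<dots> = (\<Sum>j\<in>J. r v j *\<^sub>q g j) k" using bspec[OF J(4)[unfolded span_F] imageI[OF v]] by (rule arg_cong)
    also have "\<dots> = (\<Sum>j\<in>J. v j * w j k)"
      unfolding sum_fun_apply using JM w(2) k by (intro sum.cong) (auto simp: seq_scale_def r_def seq_restrict_def)
    also have "\<dots> = R v k" by (simp add: R_def sum_fun_apply seq_scale_def)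
    finally show ?thesis by simp
  qed
  \<comment> \<open>The difference of the two sides depends on finitely many entries of
    \<open>x\<close>, each bounded by \<open>nY\<close>. So it is continuous, with Lipschitz
    constant \<open>G\<close>, and vanishes on the closure of \<open>W\<close> as it does on
    \<open>W\<close>.\<close>
  have RX: "R x k = x k" if x: "x \<in> X" and k: "k < M" for x k
  proof (rule ccontr)
    assume neq: "R x k \<noteq> x k"
    define G where "G = 1 + (\<Sum>j\<in>J. norm (w j k))"
    have G: "G > 0" unfolding G_def by (intro add_pos_nonneg sum_nonneg) auto
    have "norm (R x k - x k) / G > 0" using neq G by simp
    then obtain v where v: "v \<in> W" "nY (x - v) < norm (R x k - x k) / G" using x by (auto simp: mem_X)
    have "x - v \<in> Y" using x v X_subset_Y W_subset_Y by (intro seqs.subspace_diff[OF subspace_Y]) auto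
    note le = norm_le_nY[OF this]
    have "R x k - x k = (\<Sum>j\<in>J. (x - v) j * w j k) - (x - v) k"
      using RW[OF v(1) k] by (simp add: R_def sum_fun_apply seq_scale_def algebra_simps sum_subtractf)
    also have "norm \<dots> \<le> norm (\<Sum>j\<in>J. (x - v) j * w j k) + norm ((x - v) k)" by (rule norm_triangle_ineq4)
    also have "\<dots> \<le> (\<Sum>j\<in>J. nY (x - v) * norm (w j k)) + nY (x - v)"
      using le by (intro add_mono sum_norm_le) (auto simp: norm_mult intro!: mult_right_mono simp del: fun_diff_def)
    also have "\<dots> = nY (x - v) * G" by (simp add: G_def algebra_simps sum_distrib_left)
    also have "\<dots> < norm (R x k - x k)" using v(2) G by (simp add: field_simps)
    finally show False by simp
  qed
  have "R x \<in> W" for x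
    unfolding R_def using w by (intro seqs.subspace_sum[OF subspace_W] seqs.subspace_scale[OF subspace_W])
  moreover have "R (x + y) = R x + R y" for x y
    by (simp add: R_def fun_eq_iff sum_fun_apply seq_scale_def algebra_simps sum.distrib)
  moreover have "R (c *\<^sub>q x) = c *\<^sub>q R x" for c x
    by (simp add: R_def fun_eq_iff sum_fun_apply seq_scale_def sum_distrib_left mult_ac)
  ultimately show ?thesis using RX by blast
qed

lemma L_tendsto_0:
  assumes "x \<in> Y"
  shows "(\<lambda>n. L (n + 1) x) \<longlonglongrightarrow> 0"
proof -
  have "range Suc = {1..}" by (auto simp: image_iff Suc_le_eq gr0_conv_Suc)
  hence "(\<lambda>j. (L j x)\<^sup>2) summable_on (range Suc)" using assms by (simp only: mem_Y)
  hence "((\<lambda>j. (L j x)\<^sup>2) \<circ> Suc) summable_on UNIV" by (subst (asm) summable_on_reindex) auto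
  hence "(\<lambda>n. (L (n + 1) x)\<^sup>2) \<longlonglongrightarrow> 0"
    by (auto dest!: summable_on_imp_summable summable_LIMSEQ_zero simp: o_def)
  hence "(\<lambda>n. sqrt ((L (n + 1) x)\<^sup>2)) \<longlonglongrightarrow> sqrt 0" by (rule tendsto_real_sqrt)
  thus ?thesis by simp
qed

lemma norm_z'_le_L: "i \<in> dyadic n \<Longrightarrow> norm (z' i x) \<le> L (n + 1) x"
  using norm_z'[of i x] norm_le_L[of "n + 1" "2 * i" x] norm_le_L[of "n + 1" "2 * i + 1" x] double_in_dyadic[of i n]
  by auto

text \<open>\<open>T (z i)\<close> is a combination of finitely many fixed vectors
  \<open>g j\<close> whose coefficients are entries of \<open>T (z i)\<close>, hence bounded by
  \<open>6 * M\<close>. For \<open>i\<close> in \<open>dyadic n\<close> the functional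
  \<open>z' i\<close> reads only layer \<open>n + 1\<close> of the \<open>g j\<close>, and the
  layers of a fixed element of \<open>Y\<close> tend to 0.\<close>

lemma beta_finite_rank:
  fixes T :: "(nat \<Rightarrow> 'k) \<Rightarrow> nat \<Rightarrow> 'k::{real_normed_field,euclidean_space}"
  assumes T: "linear_map X X T" and bdd: "op_norm X nY nY T < \<infinity>" and fr: "finite_rank X T"
  shows "(\<lambda>n. beta n T) \<longlonglongrightarrow> 0"
proof -
  have Tadd: "T (x + y) = T x + T y" if "x \<in> X" "y \<in> X" for x y
    using T that unfolding linear_map_def by blast
  have Tscale: "T (c *\<^sub>q x) = c *\<^sub>q T x" if "x \<in> X" for c x
    using T that unfolding linear_map_def by blast
  have TX: "T x \<in> X" if "x \<in> X" for x
    using T that unfolding linear_map_def by blast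
  have zX: "z i \<in> X" if "i \<ge> 1" for i using z_in_W[OF that] W_subset_X by auto
  have subT: "seqs.subspace (T ` X)"
  proof (intro seqs.subspaceI)
    have "T (0 *\<^sub>q 0) = 0 *\<^sub>q T 0" by (intro Tscale seqs.subspace_0[OF subspace_X])
    thus "0 \<in> T ` X" using seqs.subspace_0[OF subspace_X] by (metis image_eqI seqs.scale_zero_left)
  next
    fix u v assume "u \<in> T ` X" "v \<in> T ` X"
    then obtain x y where xy: "x \<in> X" "y \<in> X" "u = T x" "v = T y" by blast
    have "u + v = T (x + y)" using Tadd[OF xy(1,2)] xy(3,4) by simp
    thus "u + v \<in> T ` X" using seqs.subspace_add[OF subspace_X xy(1,2)] by (rule image_eqI)
  next
    fix c u assume "u \<in> T ` X"
    then obtain x where x: "x \<in> X" "u = T x" by blast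
    have "c *\<^sub>q u = T (c *\<^sub>q x)" using Tscale[OF x(1)] x(2) by simp
    thus "c *\<^sub>q u \<in> T ` X" using seqs.subspace_scale[OF subspace_X x(1)] by (rule image_eqI)
  qed
  obtain F where F: "finite F" "T ` X \<subseteq> seqs.span F" using fr unfolding finite_rank_def by blast
  \<comment> \<open>The spanning set \<open>F\<close> may contain sequences outside
    \<open>Y\<close>; a basis chosen inside the range puts the vectors \<open>g j\<close> into
    \<open>Y\<close>.\<close>
  obtain B where B: "B \<subseteq> T ` X" "seqs.independent B" "T ` X \<subseteq> seqs.span B"
    by (rule seqs.basis_exists[of "T ` X"])
  have finB: "finite B" using seqs.independent_span_bound[OF F(1) B(2) subset_trans[OF B(1) F(2)]] ..
  obtain J g where J: "finite J" "\<forall>j\<in>J. g j \<in> seqs.span B"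
    "\<forall>v\<in>seqs.span B. v = (\<Sum>j\<in>J. v j *\<^sub>q g j)"
    using span_coordinates[OF finB] by (elim exE conjE)
  have "T ` X \<subseteq> Y" using TX X_subset_Y by blast
  hence gY: "g j \<in> Y" if "j \<in> J" for j
    using J(2) that seqs.span_minimal[OF B(1) subT] by blast
  obtain M where M: "op_norm X nY nY T = ennreal M" "M \<ge> 0" using bdd by (cases "op_norm X nY nY T") auto
  have Tz: "nY (T (z i)) \<le> 6 * M" if i: "i \<ge> 1" for i
  proof -
    define u :: "nat \<Rightarrow> 'k" where "u = of_real (1 / 6) *\<^sub>q z i"
    have uX: "u \<in> X" unfolding u_def by (intro seqs.subspace_scale[OF subspace_X] zX i)
    have "nY u = norm (of_real (1 / 6) :: 'k) * nY (z i :: nat \<Rightarrow> 'k)" unfolding u_def by (rule nY_scale)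
    hence "nY u \<le> 1" using z_in_Y(2)[OF i, where 'k = 'k] unfolding norm_of_real by simp
    hence "ennreal (nY (T u)) \<le> ennreal M" unfolding M(1)[symmetric] op_norm_def using uX by (intro SUP_upper) auto
    hence "nY (T u) \<le> M" using M(2) by simp
    moreover have "nY (T u) = norm (of_real (1 / 6) :: 'k) * nY (T (z i))"
      unfolding u_def Tscale[OF zX[OF i]] by (rule nY_scale)
    ultimately show ?thesis unfolding norm_of_real by simp
  qed
  have le: "norm (beta n T) \<le> (\<Sum>j\<in>J. 6 * M * L (n + 1) (g j))" for n
  proof -
    have "norm (z' i (T (z i))) \<le> (\<Sum>j\<in>J. 6 * M * L (n + 1) (g j))" if i: "i \<in> dyadic n" for i
    proof -
      have i1: "i \<ge> 1" using dyadic_ge_1[OF i] .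
      have "T (z i) \<in> seqs.span B" using B(3) zX[OF i1] by blast
      hence "z' i (T (z i)) = z' i (\<Sum>j\<in>J. T (z i) j *\<^sub>q g j)" using J(3) by auto
      also have "\<dots> = (\<Sum>j\<in>J. T (z i) j * z' i (g j))" by (simp add: z'_sum z'_scale)
      also have "norm \<dots> \<le> (\<Sum>j\<in>J. 6 * M * L (n + 1) (g j))"
      proof (rule sum_norm_le)
        fix j assume "j \<in> J"
        have "norm (T (z i) j) \<le> 6 * M"
          using norm_le_nY[of "T (z i)" j] TX[OF zX[OF i1]] X_subset_Y Tz[OF i1] by force
        thus "norm (T (z i) j * z' i (g j)) \<le> 6 * M * L (n + 1) (g j)"
          unfolding norm_mult using norm_z'_le_L[OF i] M(2) by (intro mult_mono) auto
      qed
      finally show ?thesis .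
    qed
    hence "norm (\<Sum>i\<in>dyadic n. z' i (T (z i))) \<le> of_nat (card (dyadic n)) * (\<Sum>j\<in>J. 6 * M * L (n + 1) (g j))"
      by (rule sum_norm_bound)
    thus ?thesis by (simp add: beta_def norm_mult norm_divide norm_power card_dyadic field_simps)
  qed
  have "(\<lambda>n. \<Sum>j\<in>J. 6 * M * L (n + 1) (g j)) \<longlonglongrightarrow> (\<Sum>j\<in>J. 6 * M * 0)"
    using gY by (intro tendsto_sum tendsto_mult tendsto_const L_tendsto_0)
  hence "(\<lambda>n. \<Sum>j\<in>J. 6 * M * L (n + 1) (g j)) \<longlonglongrightarrow> 0" by simp
  thus ?thesis by (rule Lim_null_comparison[rotated]) (use le in auto)
qed

text \<open>Each block of \<open>\<Delta> N\<close> contains at most one point of \<open>B\<close>,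
  so the entries on \<open>B\<close> are dominated by distinct block norms and their lp norm by the
  layer norm. Hoelder's inequality from lp to l1 on \<open>B\<close> gives the power of
  \<open>card B\<close>.\<close>

lemma block_sum_le:
  assumes N: "N \<ge> 1" and B: "B \<subseteq> dyadic N" and one: "\<And>A. A \<in> \<Delta> N \<Longrightarrow> card (A \<inter> B) \<le> 1"
  shows "(\<Sum>j\<in>B. norm (x j)) \<le> real (card B) powr (1 - 1 / p N) * L N x"
proof -
  note pN = p_bounds[OF N]
  have finB: "finite B" using B finite_dyadic finite_subset by blast
  define t where "t j = norm (x j)" for j
  define S where "S = lp_norm (p N) B t"
  have "(\<Sum>j\<in>B. t j powr p N) = (\<Sum>A\<in>\<Delta> N. \<Sum>j\<in>A \<inter> B. t j powr p N)"
  proof -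
    have "B = (\<Union>A\<in>\<Delta> N. A \<inter> B)" using B part_cover[OF N] by blast
    moreover have "(\<Sum>j\<in>(\<Union>A\<in>\<Delta> N. A \<inter> B). t j powr p N) = (\<Sum>A\<in>\<Delta> N. \<Sum>j\<in>A \<inter> B. t j powr p N)"
      using part[OF N] finB unfolding partition_on_def disjoint_def
      by (intro sum.UNION_disjoint finite_parts[OF N]) auto
    ultimately show ?thesis by simp
  qed
  also have "\<dots> \<le> (\<Sum>A\<in>\<Delta> N. L2_set (\<lambda>k. norm (x k)) A powr p N)"
  proof (rule sum_mono)
    fix A assume A: "A \<in> \<Delta> N"
    show "(\<Sum>j\<in>A \<inter> B. t j powr p N) \<le> L2_set (\<lambda>k. norm (x k)) A powr p N"
    proof (cases "A \<inter> B = {}")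
      case False
      hence "card (A \<inter> B) = 1" using one[OF A] finB by (simp add: le_Suc_eq)
      then obtain j where j: "A \<inter> B = {j}" by (auto simp: card_1_singleton_iff)
      have "t j \<le> L2_set (\<lambda>k. norm (x k)) A" unfolding t_def
        using j finite_part[OF N A] by (intro member_le_L2_set) auto
      thus ?thesis using pN by (simp add: j t_def powr_mono2)
    qed simp
  qed
  finally have SL: "S \<le> L N x"
    unfolding S_def layer_norm_def lp_norm_def using pN by (intro powr_mono2 sum_nonneg) auto
  have "(\<Sum>j\<in>B. t j) \<le> real (card B) powr (1 - 1 / p N) * S"
  proof (cases "S = 0 \<or> B = {}")
    case True
    hence "t j = 0" if "j \<in> B" for j
      using lp_norm_ge[of "p N" B j t] pN finB that unfolding S_def[symmetric] t_def by auto
    thus ?thesis by (simp add: S_def)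
  next
    case False
    define mm where "mm = real (card B)"
    have mm: "mm > 0" using False finB by (auto simp: mm_def card_gt_0_iff)
    have S0: "S > 0" using False by (simp add: S_def less_le)
    \<comment> \<open>The p-mean of the entries: after scaling by it, Young's inequality sums to
      exactly \<open>a * mm\<close>, the Hoelder bound.\<close>
    define a where "a = S / mm powr (1 / p N)"
    have a: "a > 0" using S0 mm by (simp add: a_def)
    have "t j \<le> a * ((1 - 1 / p N) * 1 + 1 / p N * (t j powr p N / a powr p N))" for j
    proof -
      have "t j = a * (1 powr (1 - 1 / p N) * (t j powr p N / a powr p N) powr (1 / p N))"
        using a pN by (simp add: t_def powr_divide powr_powr)
      also have "\<dots> \<le> a * ((1 - 1 / p N) * 1 + 1 / p N * (t j powr p N / a powr p N))"
        using a pN by (intro mult_left_mono young_powr) auto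
      finally show ?thesis .
    qed
    hence "(\<Sum>j\<in>B. t j) \<le> (\<Sum>j\<in>B. a * ((1 - 1 / p N) * 1 + 1 / p N * (t j powr p N / a powr p N)))"
      by (rule sum_mono)
    also have "\<dots> = a * ((1 - 1 / p N) * (\<Sum>j\<in>B. 1) + 1 / p N * ((\<Sum>j\<in>B. t j powr p N) / a powr p N))"
      by (simp only: sum.distrib sum_distrib_left[symmetric] sum_divide_distrib[symmetric])
    also have "(\<Sum>j\<in>B. t j powr p N) = a powr p N * mm"
      using pN mm S0 lp_norm_powr[of "p N" B t] by (simp add: S_def[symmetric] a_def powr_divide powr_powr)
    also have "a * ((1 - 1 / p N) * (\<Sum>j\<in>B. 1) + 1 / p N * (a powr p N * mm / a powr p N)) = a * mm"
      using a by (simp add: mm_def[symmetric] algebra_simps)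
    also have "\<dots> = mm powr (1 - 1 / p N) * S"
      using mm by (simp add: a_def powr_diff)
    finally show ?thesis by (simp add: mm_def)
  qed
  also have "\<dots> \<le> real (card B) powr (1 - 1 / p N) * L N x" using SL by (intro mult_left_mono) auto
  finally show ?thesis by (simp add: t_def)
qed

end

section \<open>Failure of the approximation property\<close>

text \<open>The base \<open>2 powr (1 / 8)\<close> of the logarithm in the gap is made for this
  identity. It turns the bounds on \<open>m n\<close> from below and on the number of blocks of
  \<open>\<Delta> n\<close> from above into the same power of \<open>n\<close>.\<close>

lemma two_powr_gap:
  assumes "n \<ge> 1"
  shows "(2 powr (real n / 8)) powr exponent_gap \<epsilon> n = real n powr (1 + \<epsilon>)"
proof -
  have l: "ln (2 powr (1 / 8) :: real) = ln 2 / 8" by (simp add: ln_powr)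
  have "exponent_gap \<epsilon> n = (1 / real n) * ((1 + \<epsilon>) * ln (real n) / (ln 2 / 8))"
    using assms by (simp add: exponent_gap_def log_def l ln_powr)
  hence "real n / 8 * exponent_gap \<epsilon> n * ln 2 = (1 + \<epsilon>) * ln (real n)"
    using assms by (simp add: field_simps)
  thus ?thesis using assms by (simp add: powr_powr powr_def mult_ac)
qed

lemma exponent_gap_eq:
  assumes "n \<ge> 1"
  shows "exponent_gap \<epsilon> n = 8 * (1 + \<epsilon>) / ln 2 * (ln (real n) / real n)"
proof -
  have l: "ln (2 powr (1 / 8) :: real) = ln 2 / 8" by (simp add: ln_powr)
  show ?thesis using assms by (simp add: exponent_gap_def log_def l ln_powr field_simps)
qed

lemma exponent_gap_tendsto_0: "exponent_gap \<epsilon> \<longlonglongrightarrow> 0"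
proof -
  have "(\<lambda>n. 8 * (1 + \<epsilon>) / ln 2 * (ln (real n) / real n)) \<longlonglongrightarrow> 8 * (1 + \<epsilon>) / ln 2 * 0"
    by (intro tendsto_mult tendsto_const lim_ln_over_n)
  hence "(\<lambda>n. 8 * (1 + \<epsilon>) / ln 2 * (ln (real n) / real n)) \<longlonglongrightarrow> 0" by simp
  thus ?thesis
    by (rule Lim_transform_eventually) (auto intro!: eventually_mono[OF eventually_ge_at_top[of 1]] simp: exponent_gap_eq)
qed

locale szankowski = layered \<epsilon> \<Delta> for \<epsilon> \<Delta> +
  fixes C :: real and Nabla :: "nat \<Rightarrow> nat set set" and m :: "nat \<Rightarrow> nat"
    and y :: "nat \<Rightarrow> nat \<Rightarrow> 'k::{real_normed_field,euclidean_space}"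
  assumes C: "C > 0"
    and Nabla: "\<And>n. n \<ge> 1 \<Longrightarrow> partition_on (dyadic n) (Nabla n)"
    and y_W: "\<And>j. j \<ge> 1 \<Longrightarrow> y j \<in> W"
    and m_ge_1: "\<And>n. n \<ge> 1 \<Longrightarrow> m n \<ge> 1"
    and a: "\<And>U n. \<lbrakk>linear_map W W U; n \<ge> 2\<rbrakk> \<Longrightarrow>
          beta n U - beta (n - 1) U = (1 / 2 ^ (n + 1)) * (\<Sum>j\<in>dyadic (n + 1). U (y j) j)"
    and b: "\<And>n B. \<lbrakk>n \<ge> 1; B \<in> Nabla n\<rbrakk> \<Longrightarrow> card B = m n"
           "\<And>n. n \<ge> 1 \<Longrightarrow> real (m n) \<ge> C * 2 powr (real n / 8)"
    and c: "\<And>n A B. \<lbrakk>n \<ge> 1; A \<in> \<Delta> n; B \<in> Nabla n\<rbrakk> \<Longrightarrow>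
          card (A \<inter> B) \<le> 1 \<and> real (card A) \<ge> C * 2 powr (7 * real n / 8)"
    and d: "\<And>n B s. \<lbrakk>n \<ge> 2; B \<in> Nabla n; \<forall>i\<in>B. s i \<in> {1, -1}\<rbrakk> \<Longrightarrow>
          \<exists>A \<eta>. (\<forall>j\<in>{1..10::nat}.
                   (\<exists>D \<in> \<Delta> (n - 1) \<union> \<Delta> n \<union> \<Delta> (n + 1). A j \<subseteq> D) \<and>
                   card (A j) = card B \<and> (\<forall>i\<in>A j. \<eta> j i \<in> {1, -1})) \<and>
                (\<Sum>i\<in>B. s i *\<^sub>q y i) = (\<Sum>j=1..10. \<Sum>i\<in>A j. \<eta> j i *\<^sub>q unit_seq i)"
begin

text \<open>Each of the ten pieces lies in one block and has \<open>m n\<close> entries of norm 1,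
  so \<open>block_norm\<close> bounds it by \<open>sqrt (m n)\<close>.\<close>

lemma signed_sum_norm:
  assumes "n \<ge> 2" "B \<in> Nabla n" "\<forall>i\<in>B. s i \<in> {1, -1}"
  shows "nY (\<Sum>i\<in>B. s i *\<^sub>q y i) \<le> 10 * sqrt (real (m n))"
proof -
  obtain A \<eta> where H: "\<forall>j\<in>{1..10::nat}. (\<exists>D \<in> \<Delta> (n - 1) \<union> \<Delta> n \<union> \<Delta> (n + 1). A j \<subseteq> D) \<and>
      card (A j) = card B \<and> (\<forall>i\<in>A j. \<eta> j i \<in> {1, -1})"
    and eq: "(\<Sum>i\<in>B. s i *\<^sub>q y i) = (\<Sum>j=1..10. \<Sum>i\<in>A j. \<eta> j i *\<^sub>q unit_seq i)"
    using d[OF assms] by (elim exE conjE)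
  have A: "\<exists>D \<in> \<Delta> (n - 1) \<union> \<Delta> n \<union> \<Delta> (n + 1). A j \<subseteq> D" "card (A j) = card B"
    "\<And>i. i \<in> A j \<Longrightarrow> \<eta> j i \<in> {1, -1}" if "j \<in> {1..10}" for j
    using bspec[OF H that] by blast+
  have cB: "card B = m n" using b(1) assms by simp
  have blk: "(\<Sum>i\<in>A j. \<eta> j i *\<^sub>q unit_seq i) \<in> Y \<and> nY (\<Sum>i\<in>A j. \<eta> j i *\<^sub>q unit_seq i) \<le> sqrt (real (m n))"
    if j: "j \<in> {1..10}" for j
  proof -
    obtain D where D': "D \<in> \<Delta> (n - 1) \<union> \<Delta> n \<union> \<Delta> (n + 1)" "A j \<subseteq> D" using A(1)[OF j] by blast
    \<comment> \<open>The exponents and partitions are controlled only from layer 1 on, hence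
      \<open>n \<ge> 2\<close>.\<close>
    have "n - 1 \<ge> 1" "n \<ge> 1" "n + 1 \<ge> 1" using assms(1) by auto
    then obtain N where D: "N \<ge> 1" "D \<in> \<Delta> N" "A j \<subseteq> D" using D' by blast
    have finA: "finite (A j)" using D finite_part finite_subset by blast
    have ev: "(\<Sum>i\<in>A j. \<eta> j i *\<^sub>q unit_seq i) k = (if k \<in> A j then \<eta> j k else 0)" for k
    proof -
      have "(\<Sum>i\<in>A j. \<eta> j i *\<^sub>q unit_seq i) k = (\<Sum>i\<in>A j. if k = i then \<eta> j i else 0)"
        unfolding sum_fun_apply by (intro sum.cong) (auto simp: seq_scale_def unit_seq_def)
      thus ?thesis using finA by simp
    qed
    have nrm: "norm (\<eta> j k) = 1" if "k \<in> A j" for k using A(3)[OF j that] by auto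
    show ?thesis
      using block_norm[OF D, of "\<Sum>i\<in>A j. \<eta> j i *\<^sub>q unit_seq i"] A(2)[OF j] cB nrm unfolding ev by auto
  qed
  have "nY (\<Sum>i\<in>B. s i *\<^sub>q y i) \<le> (\<Sum>j=1..10. nY (\<Sum>i\<in>A j. \<eta> j i *\<^sub>q unit_seq i))"
    unfolding eq using blk by (intro sum_Y(2)) blast
  also have "\<dots> \<le> (\<Sum>j=1..10::nat. sqrt (real (m n)))" using blk by (intro sum_mono) auto
  finally show ?thesis by simp
qed

lemma beta_recursion:
  assumes "linear_map W X U" "n \<ge> 2"
  shows "beta n U - beta (n - 1) U = (1 / 2 ^ (n + 1)) * (\<Sum>j\<in>dyadic (n + 1). U (y j) j)"
proof -
  \<comment> \<open>\<open>2 ^ (n + 2)\<close> is the end of \<open>dyadic (n + 1)\<close>.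
    \<open>beta n\<close> and the trace read entries in this layer and \<open>beta (n - 1)\<close>
    reads entries in \<open>dyadic n\<close>, so composing \<open>U\<close> with \<open>R\<close>
    changes neither side.\<close>
  obtain R :: "(nat \<Rightarrow> 'k) \<Rightarrow> nat \<Rightarrow> 'k" where R: "\<forall>x. R x \<in> W" "\<forall>x y. R (x + y) = R x + R y"
    "\<forall>c x. R (c *\<^sub>q x) = c *\<^sub>q R x" "\<forall>x\<in>X. \<forall>k<2 ^ (n + 2). R x k = x k"
    using X_selection[of "2 ^ (n + 2)"] by (elim exE conjE)
  have lt: "k < 2 ^ (n + 2)" if "k \<in> dyadic (n + 1) \<or> k \<in> dyadic n" for k
    using that by (auto simp: dyadic_def)
  have UX: "U x \<in> X" if "x \<in> W" for x using assms(1) that unfolding linear_map_def by blast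
  have lin: "linear_map W W (\<lambda>x. R (U x))"
    using assms(1) R(1) unfolding linear_map_def by (auto simp: R(2,3)[rule_format])
  have Req: "R (U x) k = U x k" if "x \<in> W" "k \<in> dyadic (n + 1) \<or> k \<in> dyadic n" for x k
    using R(4) UX[OF that(1)] lt[OF that(2)] by blast
  have beq: "beta n (\<lambda>x. R (U x)) = beta n U"
    by (intro beta_cong Req z_in_W disjI1) (rule dyadic_ge_1)
  have "n - 1 + 1 = n" using assms(2) by simp
  hence beq': "beta (n - 1) (\<lambda>x. R (U x)) = beta (n - 1) U"
    by (intro beta_cong Req z_in_W disjI2) (rule dyadic_ge_1, assumption, simp)
  have "(\<Sum>j\<in>dyadic (n + 1). R (U (y j)) j) = (\<Sum>j\<in>dyadic (n + 1). U (y j) j)"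
    using dyadic_ge_1 y_W by (intro sum.cong Req disjI1) blast+
  thus ?thesis using a[OF lin assms(2)] unfolding beq beq' by simp
qed

text \<open>The signed sums have norm at most \<open>10 * sqrt (m N)\<close>. Division by the root
  makes them bounded, and the factor \<open>N powr (- \<epsilon> / 2)\<close> makes them tend to 0
  at the expense of only half of \<open>\<epsilon>\<close>.\<close>

definition test_vec :: "nat \<Rightarrow> nat set \<Rightarrow> (nat \<Rightarrow> 'k) \<Rightarrow> nat \<Rightarrow> 'k"
  where "test_vec N B s = of_real (real N powr (- \<epsilon> / 2) / sqrt (real (m N))) *\<^sub>q (\<Sum>i\<in>B. s i *\<^sub>q y i)"

text \<open>Extensional functions, so that a block carries only finitely many sign patterns.\<close>

definition signs :: "nat set \<Rightarrow> (nat \<Rightarrow> 'k) set"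
  where "signs B = B \<rightarrow>\<^sub>E {1, -1}"

definition test_vecs :: "nat \<Rightarrow> (nat \<Rightarrow> 'k) set"
  where "test_vecs N = (\<Union>B\<in>Nabla N. test_vec N B ` signs B)"

text \<open>\<open>z 2\<close> and \<open>z 3\<close> control \<open>beta 1\<close>, as
  \<open>dyadic 1 = {2, 3}\<close>. The step from \<open>beta (n - 1)\<close> to
  \<open>beta n\<close> with \<open>n \<ge> 2\<close> tests blocks of layer \<open>n + 1\<close>,
  hence the start at 3.\<close>

definition test_set :: "(nat \<Rightarrow> 'k) set"
  where "test_set = insert 0 (z ` {2, 3} \<union> (\<Union>N\<in>{3..}. test_vecs N))"

lemma block_subset: "N \<ge> 1 \<Longrightarrow> B \<in> Nabla N \<Longrightarrow> B \<subseteq> dyadic N"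
  using Nabla partition_onD1 by blast

lemma finite_Nabla: "N \<ge> 1 \<Longrightarrow> finite (Nabla N)"
  using Nabla finite_elements finite_dyadic by blast

lemma finite_test_vecs:
  assumes "N \<ge> 1"
  shows "finite (test_vecs N)"
proof -
  have "finite B" if "B \<in> Nabla N" for B
    by (rule finite_subset[OF block_subset[OF assms that] finite_dyadic])
  thus ?thesis unfolding test_vecs_def signs_def
    by (intro finite_UN_I finite_Nabla[OF assms] finite_imageI finite_PiE) auto
qed

lemma signed_sum_W:
  assumes "N \<ge> 1" "B \<in> Nabla N"
  shows "(\<Sum>i\<in>B. s i *\<^sub>q y i) \<in> W"
proof (intro seqs.subspace_sum[OF subspace_W] seqs.subspace_scale[OF subspace_W] y_W)
  fix i assume "i \<in> B"
  thus "i \<ge> 1" using block_subset[OF assms] dyadic_ge_1 by blast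
qed

lemma test_vec_W: "N \<ge> 1 \<Longrightarrow> B \<in> Nabla N \<Longrightarrow> test_vec N B s \<in> W"
  unfolding test_vec_def by (intro seqs.subspace_scale[OF subspace_W] signed_sum_W)

lemma test_vecs_norm:
  assumes "N \<ge> 3" "v \<in> test_vecs N"
  shows "nY v \<le> 10 * real N powr (- \<epsilon> / 2)"
proof -
  obtain B s where B: "B \<in> Nabla N" "s \<in> signs B" "v = test_vec N B s"
    using assms(2) by (auto simp: test_vecs_def)
  have s: "\<forall>i\<in>B. s i \<in> {1, -1}" using B(2) by (auto simp: signs_def)
  have m: "sqrt (real (m N)) > 0" using m_ge_1[of N] assms by simp
  have "nY v = real N powr (- \<epsilon> / 2) / sqrt (real (m N)) * nY (\<Sum>i\<in>B. s i *\<^sub>q y i)"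
    unfolding B(3) test_vec_def nY_scale norm_of_real by simp
  also have "\<dots> \<le> real N powr (- \<epsilon> / 2) / sqrt (real (m N)) * (10 * sqrt (real (m N)))"
    using signed_sum_norm[OF _ B(1) s] assms(1) by (intro mult_left_mono) auto
  finally show ?thesis using m by simp
qed

lemma test_set_X: "test_set \<subseteq> X"
proof -
  have "test_set \<subseteq> W"
    by (auto simp: test_set_def test_vecs_def intro: seqs.subspace_0[OF subspace_W] z_in_W test_vec_W)
  thus ?thesis using W_subset_X by auto
qed

lemma compactin_test_set: "compactin (norm_topology X nY) test_set"
proof (rule compactin_null_set)
  show "Metric_space X (\<lambda>x y. nY (x - y))" by (rule metric_space_X)
  show "test_set \<subseteq> X" by (rule test_set_X)
  show "0 \<in> test_set" by (simp add: test_set_def)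
  show "nY (0 - x) = nY x" for x using nY_minus[of 0 x] by simp
next
  fix r :: real assume r: "r > 0"
  have "(\<lambda>N. 10 * real N powr (- \<epsilon> / 2)) \<longlonglongrightarrow> 10 * 0"
    using eps by (intro tendsto_mult tendsto_const tendsto_neg_powr filterlim_real_sequentially) auto
  hence "\<forall>\<^sub>F N in sequentially. 10 * real N powr (- \<epsilon> / 2) < r"
    using r by (intro order_tendstoD(2)) auto
  then obtain N0 where N0: "\<And>N. N \<ge> N0 \<Longrightarrow> 10 * real N powr (- \<epsilon> / 2) < r"
    by (auto simp: eventually_sequentially)
  have "{x \<in> test_set. nY x \<ge> r} \<subseteq> z ` {2, 3} \<union> (\<Union>N\<in>{3..N0}. test_vecs N)"
  proof
    fix x assume x: "x \<in> {x \<in> test_set. nY x \<ge> r}"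
    hence "x \<noteq> 0" using r Y_zero(2)[where 'k = 'k] by auto
    hence "x \<in> z ` {2, 3} \<or> (\<exists>N\<in>{3..}. x \<in> test_vecs N)" using x unfolding test_set_def by blast
    thus "x \<in> z ` {2, 3} \<union> (\<Union>N\<in>{3..N0}. test_vecs N)"
    proof (elim disjE bexE)
      fix N assume N: "N \<in> {3..}" "x \<in> test_vecs N"
      have "nY x \<le> 10 * real N powr (- \<epsilon> / 2)" using N by (intro test_vecs_norm) auto
      hence "N \<le> N0" using N0[of N] x by (cases "N \<le> N0") auto
      thus ?thesis using N by (intro UnI2 UN_I) auto
    qed (rule UnI1)
  qed
  thus "finite {x \<in> test_set. nY x \<ge> r}" by (rule finite_subset) (auto intro: finite_test_vecs)
qed

section \<open>Increments of beta and their summability\<close>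

definition majorant :: "nat \<Rightarrow> real"
  where "majorant N = real N powr (\<epsilon> / 2) * real (m N) powr (1 / 2 - 1 / p N)"

text \<open>For large \<open>N\<close> the gap is not truncated, and the lower bound on
  \<open>m N\<close> turns \<open>m N powr (- g)\<close> into a constant times
  \<open>N powr (- (1 + \<epsilon>))\<close>. Undoing the normalisation costs
  \<open>N powr (\<epsilon> / 2)\<close>, which leaves
  \<open>N powr (- 1 - \<epsilon> / 2)\<close>.\<close>

lemma summable_majorant: "summable majorant"
proof (rule summable_comparison_test_ev)
  have "\<forall>\<^sub>F N in sequentially. exponent_gap \<epsilon> N < 1 / 2"
    by (rule order_tendstoD(2)[OF exponent_gap_tendsto_0]) simp
  moreover have "\<forall>\<^sub>F N in sequentially. N \<ge> (1::nat)" by (rule eventually_ge_at_top)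
  ultimately show "\<forall>\<^sub>F N in sequentially. norm (majorant N) \<le> max 1 (C powr (- 1 / 2)) * real N powr (- 1 - \<epsilon> / 2)"
  proof eventually_elim
    case (elim N)
    define g where "g = exponent_gap \<epsilon> N"
    have g: "0 \<le> g" "g < 1 / 2" using exponent_gap_nonneg[OF eps elim(2)] elim(1) by (auto simp: g_def)
    have e: "1 / 2 - 1 / p N = - g" using inverse_p_exp[of \<epsilon> N] g by (simp add: g_def)
    have mN: "C * 2 powr (real N / 8) \<le> real (m N)" using b(2)[OF elim(2)] .
    have "real (m N) powr (- g) \<le> (C * 2 powr (real N / 8)) powr (- g)"
      using mN g C by (intro powr_mono2') auto
    also have "\<dots> = C powr (- g) * (2 powr (real N / 8)) powr (- g)" by (rule powr_mult)
    also have "(2 powr (real N / 8)) powr (- g) = inverse ((2 powr (real N / 8)) powr g)" by (rule powr_minus)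
    also have "\<dots> = inverse (real N powr (1 + \<epsilon>))" unfolding g_def two_powr_gap[OF elim(2)] ..
    also have "\<dots> = real N powr (- (1 + \<epsilon>))" by (rule powr_minus[symmetric])
    finally have mg: "real (m N) powr (- g) \<le> C powr (- g) * real N powr (- (1 + \<epsilon>))" .
    \<comment> \<open>\<open>g\<close> varies with \<open>N\<close> but stays between 0 and 1/2, and
      \<open>C powr (- g)\<close> is monotone in \<open>g\<close>, so it is at most its larger end
      value.\<close>
    have "C powr (- g) \<le> max 1 (C powr (- 1 / 2))"
    proof (cases "C \<ge> 1")
      case True
      have "C powr (- g) \<le> C powr 0" using True g by (intro powr_mono) auto
      thus ?thesis using C by simp
    next
      case False
      have "C powr (- g) \<le> C powr (- 1 / 2)" using False C g by (intro powr_mono') auto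
      thus ?thesis by simp
    qed
    hence "C powr (- g) * real N powr (- (1 + \<epsilon>)) \<le> max 1 (C powr (- 1 / 2)) * real N powr (- (1 + \<epsilon>))"
      by (intro mult_right_mono) auto
    with mg have "real (m N) powr (- g) \<le> max 1 (C powr (- 1 / 2)) * real N powr (- (1 + \<epsilon>))"
      by (rule order_trans)
    hence "majorant N \<le> real N powr (\<epsilon> / 2) * (max 1 (C powr (- 1 / 2)) * real N powr (- (1 + \<epsilon>)))"
      unfolding majorant_def e by (intro mult_left_mono) auto
    also have "\<dots> = max 1 (C powr (- 1 / 2)) * (real N powr (\<epsilon> / 2) * real N powr (- (1 + \<epsilon>)))"
      by (simp only: mult_ac)
    also have "real N powr (\<epsilon> / 2) * real N powr (- (1 + \<epsilon>)) = real N powr (- 1 - \<epsilon> / 2)"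
    proof -
      have "\<epsilon> / 2 + - (1 + \<epsilon>) = - 1 - \<epsilon> / 2" by (simp add: field_simps)
      thus ?thesis by (simp only: powr_add[symmetric])
    qed
    finally show ?case by (simp add: majorant_def)
  qed
  show "summable (\<lambda>N. max 1 (C powr (- 1 / 2)) * real N powr (- 1 - \<epsilon> / 2))"
    using eps by (intro summable_mult) (simp add: summable_real_powr_iff)
qed

text \<open>After the choice of signs, the double sum is \<open>\<Sum>j\<in>B. s j * U x j\<close>
  for the single vector \<open>x = (\<Sum>i\<in>B. s i *\<^sub>q y i)\<close>. This \<open>x\<close>
  is a multiple of a test vector, so \<open>U x\<close> is controlled, and
  \<open>block_sum_le\<close> sums its entries over the transversal block.\<close>

lemma block_trace_le:
  assumes U: "linear_map W X U" and small: "\<And>x. x \<in> test_set \<Longrightarrow> x \<in> W \<Longrightarrow> nY (U x) \<le> \<delta>"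
    and N: "N \<ge> 3" and B: "B \<in> Nabla N"
  shows "norm (\<Sum>i\<in>B. U (y i) i) \<le> real (m N) * (\<delta> * majorant N)"
proof -
  have Uadd: "U (x + x') = U x + U x'" if "x \<in> W" "x' \<in> W" for x x'
    using U that unfolding linear_map_def by blast
  have Uscale: "U (c *\<^sub>q x) = c *\<^sub>q U x" if "x \<in> W" for c x
    using U that unfolding linear_map_def by blast
  have UX: "U x \<in> X" if "x \<in> W" for x
    using U that unfolding linear_map_def by blast
  have N1: "N \<ge> 1" using N by simp
  have finB: "finite B" using block_subset[OF N1 B] finite_dyadic finite_subset by blast
  have yB: "y i \<in> W" if "i \<in> B" for i using that block_subset[OF N1 B] dyadic_ge_1 y_W by blast
  obtain s0 :: "nat \<Rightarrow> 'k" where s0: "\<And>i. s0 i \<in> {1, -1}"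
    "norm (0 + (\<Sum>i\<in>B. U (y i) i)) \<le> norm (0 + (\<Sum>i\<in>B. \<Sum>j\<in>B. s0 i * s0 j * U (y i) j))"
    using exists_signs[OF finB, of 0 "\<lambda>i j. U (y i) j"] by blast
  define s where "s = restrict s0 B"
  have sB: "s \<in> signs B" using s0(1) by (auto simp: s_def signs_def)
  define x where "x = (\<Sum>i\<in>B. s i *\<^sub>q y i)"
  have xW: "x \<in> W" unfolding x_def by (rule signed_sum_W[OF N1 B])
  have Usum: "U (\<Sum>i\<in>A. s i *\<^sub>q y i) = (\<Sum>i\<in>A. s i *\<^sub>q U (y i))" if "A \<subseteq> B" for A
    using finite_subset[OF that finB] that
  proof (induction A rule: finite_induct)
    case empty
    have "U (0 *\<^sub>q 0) = 0 *\<^sub>q U 0" by (intro Uscale seqs.subspace_0[OF subspace_W])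
    thus ?case by (simp only: seqs.scale_zero_left sum.empty)
  next
    case (insert i A)
    have 1: "s i *\<^sub>q y i \<in> W" using insert yB by (intro seqs.subspace_scale[OF subspace_W]) auto
    have 2: "(\<Sum>i\<in>A. s i *\<^sub>q y i) \<in> W"
      using insert yB by (intro seqs.subspace_sum[OF subspace_W] seqs.subspace_scale[OF subspace_W]) auto
    have "U (\<Sum>i\<in>insert i A. s i *\<^sub>q y i) = U (s i *\<^sub>q y i + (\<Sum>i\<in>A. s i *\<^sub>q y i))"
      using insert(1,2) by (intro arg_cong[where f = U] sum.insert)
    also have "\<dots> = s i *\<^sub>q U (y i) + (\<Sum>i\<in>A. s i *\<^sub>q U (y i))"
      unfolding Uadd[OF 1 2] using insert yB Uscale by (intro arg_cong2[where f = "(+)"]) auto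
    also have "\<dots> = (\<Sum>i\<in>insert i A. s i *\<^sub>q U (y i))"
      using insert(1,2) by (intro sum.insert[symmetric])
    finally show ?case .
  qed
  have "(\<Sum>i\<in>B. \<Sum>j\<in>B. s0 i * s0 j * U (y i) j) = (\<Sum>j\<in>B. s j * U x j)"
  proof -
    have "(\<Sum>i\<in>B. \<Sum>j\<in>B. s0 i * s0 j * U (y i) j) = (\<Sum>j\<in>B. \<Sum>i\<in>B. s0 i * s0 j * U (y i) j)"
      by (rule sum.swap)
    also have "\<dots> = (\<Sum>j\<in>B. s j * U x j)"
      unfolding x_def Usum[OF subset_refl] sum_fun_apply sum_distrib_left
      by (intro sum.cong refl) (auto simp: s_def seq_scale_def)
    finally show ?thesis .
  qed
  hence "norm (\<Sum>i\<in>B. U (y i) i) \<le> norm (\<Sum>j\<in>B. s j * U x j)" using s0(2) by simp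
  also have "\<dots> \<le> (\<Sum>j\<in>B. norm (U x j))"
  proof (rule sum_norm_le)
    fix j assume "j \<in> B"
    hence "norm (s j) = 1" using s0(1)[of j] by (auto simp: s_def)
    thus "norm (s j * U x j) \<le> norm (U x j)" by (simp add: norm_mult)
  qed
  also have "\<dots> \<le> real (card B) powr (1 - 1 / p N) * L N (U x)"
    using c[OF N1 _ B] by (intro block_sum_le N1 block_subset[OF N1 B]) blast
  also have "\<dots> \<le> real (card B) powr (1 - 1 / p N) * (sqrt (real (m N)) * real N powr (\<epsilon> / 2) * \<delta>)"
  proof (intro mult_left_mono)
    have mN: "sqrt (real (m N)) > 0" using m_ge_1[OF N1] by simp
    have NN: "real N powr (\<epsilon> / 2) > 0" using N by simp
    have "test_vec N B s \<in> test_set" using N B sB by (auto simp: test_set_def test_vecs_def)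
    hence "nY (U (test_vec N B s)) \<le> \<delta>" using test_vec_W[OF N1 B] by (rule small)
    also have "U (test_vec N B s) = of_real (real N powr (- \<epsilon> / 2) / sqrt (real (m N))) *\<^sub>q U x"
      unfolding test_vec_def x_def[symmetric] by (rule Uscale[OF xW])
    finally have "real N powr (- \<epsilon> / 2) / sqrt (real (m N)) * nY (U x) \<le> \<delta>"
      unfolding nY_scale norm_of_real by simp
    hence "nY (U x) \<le> sqrt (real (m N)) * real N powr (\<epsilon> / 2) * \<delta>"
      using mN NN by (simp add: powr_minus field_simps)
    moreover have "L N (U x) \<le> nY (U x)" using UX[OF xW] X_subset_Y N1 by (intro L_le_nY) auto
    ultimately show "L N (U x) \<le> sqrt (real (m N)) * real N powr (\<epsilon> / 2) * \<delta>" by simp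
  qed auto
  \<comment> \<open>Since \<open>(1 - 1 / p) + 1 / 2 = 1 + (1 / 2 - 1 / p)\<close>, one full power
    of \<open>m N\<close> splits off; it will cancel against the number of blocks.\<close>
  also have "\<dots> = real (m N) * (\<delta> * majorant N)"
  proof -
    have "real (m N) powr (1 - 1 / p N) * sqrt (real (m N)) = real (m N) powr (1 - 1 / p N + 1 / 2)"
      unfolding powr_add by (simp add: powr_half_sqrt)
    also have "\<dots> = real (m N) powr (1 + (1 / 2 - 1 / p N))" by (simp add: algebra_simps)
    also have "\<dots> = real (m N) * real (m N) powr (1 / 2 - 1 / p N)"
      unfolding powr_add using m_ge_1[OF N1] by simp
    finally show ?thesis using b(1)[OF N1 B] by (simp add: majorant_def mult_ac)
  qed
  finally show ?thesis .
qed

text \<open>With \<open>N = n + 1\<close> there are \<open>2 ^ N / m N\<close> blocks, so the factor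
  \<open>m N\<close> in the bound for each block and the normalisation
  \<open>1 / 2 ^ (n + 1)\<close> cancel exactly.\<close>

lemma beta_step_le:
  assumes U: "linear_map W X U" and small: "\<And>x. x \<in> test_set \<Longrightarrow> x \<in> W \<Longrightarrow> nY (U x) \<le> \<delta>" and n: "n \<ge> 2"
  shows "norm (beta n U - beta (n - 1) U) \<le> \<delta> * majorant (n + 1)"
proof -
  define N where "N = n + 1"
  have N: "N \<ge> 3" "N \<ge> 1" using n by (auto simp: N_def)
  have U_eq: "\<Union> (Nabla N) = dyadic N" using Nabla[OF N(2)] partition_onD1 by blast
  have disj: "\<forall>A\<in>Nabla N. \<forall>B\<in>Nabla N. A \<noteq> B \<longrightarrow> A \<inter> B = {}"
    using Nabla[OF N(2)] unfolding partition_on_def disjoint_def by blast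
  have finB: "\<forall>A\<in>Nabla N. finite A"
    using block_subset[OF N(2)] finite_dyadic finite_subset by blast
  have "(\<Sum>j\<in>dyadic N. U (y j) j) = (\<Sum>B\<in>Nabla N. \<Sum>j\<in>B. U (y j) j)"
    unfolding U_eq[symmetric] using sum.Union_disjoint[OF finB disj] by simp
  also have "norm \<dots> \<le> (\<Sum>B\<in>Nabla N. real (m N) * (\<delta> * majorant N))"
    by (intro sum_norm_le block_trace_le[OF U small N(1)])
  also have "\<dots> = real (card (Nabla N) * m N) * (\<delta> * majorant N)" by simp
  also have "card (Nabla N) * m N = 2 ^ N"
  proof -
    have "card (dyadic N) = (\<Sum>B\<in>Nabla N. card B)"
      unfolding U_eq[symmetric] using disj finB finite_Nabla[OF N(2)]
      by (intro card_Union_disjoint) (auto simp: pairwise_def disjnt_def)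
    also have "\<dots> = (\<Sum>B\<in>Nabla N. m N)" using b(1)[OF N(2)] by (intro sum.cong) auto
    finally show ?thesis by (simp add: card_dyadic)
  qed
  finally have "norm (\<Sum>j\<in>dyadic N. U (y j) j) \<le> 2 ^ N * (\<delta> * majorant N)" by simp
  thus ?thesis unfolding beta_recursion[OF U n] N_def[symmetric]
    by (simp add: norm_mult norm_divide norm_power field_simps)
qed

lemma no_approximation_property: "\<not> approximation_property (X :: (nat \<Rightarrow> 'k) set) nY"
proof
  assume AP: "approximation_property (X :: (nat \<Rightarrow> 'k) set) nY"
  define S where "S = (\<Sum>N. majorant N)"
  have maj0: "majorant N \<ge> 0" for N by (simp add: majorant_def)
  have S0: "S \<ge> 0" unfolding S_def by (intro suminf_nonneg summable_majorant maj0)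
  \<comment> \<open>Chosen so that \<open>\<delta> + \<delta> * S = 1 / 2\<close>:
    \<open>beta 1 U\<close> contributes at most \<open>\<delta>\<close> and all increments together
    at most \<open>\<delta> * S\<close>.\<close>
  define \<delta> where "\<delta> = 1 / (2 * (1 + S))"
  have \<delta>: "\<delta> > 0" using S0 by (simp add: \<delta>_def)
  obtain T where T: "linear_map X X T" "op_norm X nY nY T < \<infinity>" "finite_rank X T"
    "\<And>x. x \<in> test_set \<Longrightarrow> nY (T x - x) \<le> \<delta>"
    using AP[unfolded approximation_property_def, rule_format, OF conjI[OF compactin_test_set \<delta>]]
    by (auto simp: top_ennreal_def)
  define U where "U x = T x - x" for x
  have U: "linear_map W X U"
    unfolding linear_map_def
  proof (intro conjI ballI allI funcsetI)
    fix x x' :: "nat \<Rightarrow> 'k" and c assume x: "x \<in> W"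
    have xX: "x \<in> X" using x W_subset_X by auto
    have "T x \<in> X" using T(1) xX unfolding linear_map_def by blast
    thus "U x \<in> X" unfolding U_def using xX by (rule seqs.subspace_diff[OF subspace_X])
    have "T (c *\<^sub>q x) = c *\<^sub>q T x" using T(1) xX unfolding linear_map_def by blast
    thus "U (c *\<^sub>q x) = c *\<^sub>q U x" by (simp add: U_def seqs.scale_right_diff_distrib)
    assume x': "x' \<in> W"
    have "T (x + x') = T x + T x'" using T(1) xX x' W_subset_X unfolding linear_map_def by blast
    thus "U (x + x') = U x + U x'" by (simp add: U_def)
  qed
  have small: "nY (U x) \<le> \<delta>" if "x \<in> test_set" for x unfolding U_def by (rule T(4)[OF that])
  have beta1: "norm (beta 1 U) \<le> \<delta>"
  proof -
    have "norm (z' i (U (z i))) \<le> \<delta>" if i: "i \<in> dyadic 1" for i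
    proof -
      have i23: "i = 2 \<or> i = 3" using i by (auto simp: dyadic_def)
      hence zt: "z i \<in> test_set" by (auto simp: test_set_def)
      have "z i \<in> W" using i23 by (intro z_in_W) auto
      hence "U (z i) \<in> Y" using U X_subset_Y unfolding linear_map_def by blast
      hence le: "norm (U (z i) k) \<le> \<delta>" for k using norm_le_nY[of "U (z i)" k] small[OF zt] by simp
      have "(norm (U (z i) (2 * i)) + norm (U (z i) (2 * i + 1))) / 2 \<le> \<delta>"
        using le[of "2 * i"] le[of "2 * i + 1"] by simp
      with norm_z'[of i "U (z i)"] show ?thesis by (rule order_trans)
    qed
    hence "norm (\<Sum>i\<in>dyadic 1. z' i (U (z i))) \<le> of_nat (card (dyadic 1)) * \<delta>" by (rule sum_norm_bound)
    thus ?thesis by (simp add: beta_def norm_mult norm_divide card_dyadic)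
  qed
  have bound: "norm (beta (Suc n) U) \<le> \<delta> + (\<Sum>k<n. \<delta> * majorant (k + 3))" for n
  proof (induction n)
    case 0
    show ?case using beta1 by simp
  next
    case (Suc n)
    have "norm (beta (Suc (Suc n)) U - beta (Suc n) U) \<le> \<delta> * majorant (n + 3)"
      using beta_step_le[OF U, of \<delta> "Suc (Suc n)"] small by (simp add: numeral_3_eq_3)
    thus ?case using Suc.IH norm_triangle_sub[of "beta (Suc (Suc n)) U" "beta (Suc n) U"] by simp
  qed
  have bound': "norm (beta (Suc n) U) \<le> 1 / 2" for n
  proof -
    have "(\<Sum>k<n. majorant (k + 3)) = (\<Sum>k\<in>{3..<n + 3}. majorant k)"
      by (rule sum.reindex_bij_witness[of _ "\<lambda>k. k - 3" "\<lambda>k. k + 3"]) auto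
    also have "\<dots> \<le> S" unfolding S_def by (intro sum_le_suminf summable_majorant maj0) auto
    finally have "\<delta> + \<delta> * (\<Sum>k<n. majorant (k + 3)) \<le> \<delta> + \<delta> * S" using \<delta> by (intro add_left_mono mult_left_mono) auto
    also have "\<dots> = 1 / 2" using S0 by (simp add: \<delta>_def field_simps)
    finally show ?thesis using bound[of n] by (simp add: sum_distrib_left)
  qed
  have "(\<lambda>n. beta (Suc n) T) \<longlonglongrightarrow> 0" using beta_finite_rank[OF T(1-3)] by (rule LIMSEQ_Suc)
  hence "(\<lambda>n. norm (beta (Suc n) T - 1)) \<longlonglongrightarrow> norm (0 - 1 :: 'k)"
    by (intro tendsto_norm tendsto_diff tendsto_const)
  moreover have "norm (beta (Suc n) T - 1) \<le> 1 / 2" for n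
  proof -
    have "U = (\<lambda>x. T x - x)" by (rule ext) (rule U_def)
    thus ?thesis using bound'[of n] by (simp only: beta_diff_id)
  qed
  ultimately have "norm (0 - 1 :: 'k) \<le> 1 / 2" by (intro LIMSEQ_le_const2) auto
  thus False by simp
qed

end

section \<open>Change of density\<close>

context layered
begin

abbreviation "h j \<equiv> 2 / p j - 1"

text \<open>The blocks remain Euclidean and the density only weighs them against each other. A block
  with \<open>v A = 0\<close> gets weight 0, by the convention \<open>0 powr x = 0\<close>.\<close>

definition weighted_norm :: "nat \<Rightarrow> (nat set \<Rightarrow> real) \<Rightarrow> (nat \<Rightarrow> 'k::{real_normed_field,euclidean_space}) \<Rightarrow> real"
  where "weighted_norm j v f = sqrt (\<Sum>A\<in>\<Delta> j. v A powr (- h j) * (L2_set (\<lambda>k. norm (f k)) A)\<^sup>2)"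

text \<open>\<open>weighted_norm\<close> does not see blocks of density 0, so elements of
  \<open>E\<close> are to vanish there. The constant \<open>\<kappa>\<close> enters only through
  \<open>\<kappa> powr h j\<close>; as \<open>h j\<close> is small in late layers, even a polynomial
  \<open>\<kappa>\<close> is harmless there.\<close>

definition good_density :: "(nat \<Rightarrow> 'k::{real_normed_field,euclidean_space}) set \<Rightarrow> real \<Rightarrow> nat \<Rightarrow> (nat set \<Rightarrow> real) \<Rightarrow> bool"
  where "good_density E M j v \<longleftrightarrow> (\<forall>A\<in>\<Delta> j. v A \<ge> 0) \<and> (\<Sum>A\<in>\<Delta> j. v A) \<le> 1 \<and>
    (\<forall>f\<in>E. \<forall>A\<in>\<Delta> j. v A = 0 \<longrightarrow> L2_set (\<lambda>k. norm (f k)) A = 0) \<and>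
    (\<exists>\<kappa>>0. \<kappa> powr h j \<le> M \<and>
      (\<forall>f\<in>E. \<forall>A\<in>\<Delta> j. L2_set (\<lambda>k. norm (f k)) A \<le> \<kappa> * v A powr (1 / p j) * weighted_norm j v f))"

lemma weighted_norm_nonneg [simp]: "weighted_norm j v f \<ge> 0"
  unfolding weighted_norm_def by (intro real_sqrt_ge_zero sum_nonneg) auto

lemma L_le_weighted_norm:
  assumes j: "j \<ge> 1" and v: "\<And>A. A \<in> \<Delta> j \<Longrightarrow> v A \<ge> 0" "(\<Sum>A\<in>\<Delta> j. v A) \<le> 1"
    and f: "\<And>A. A \<in> \<Delta> j \<Longrightarrow> v A = 0 \<Longrightarrow> L2_set (\<lambda>k. norm (f k)) A = 0"
  shows "L j f \<le> weighted_norm j v f"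
  unfolding layer_norm_def weighted_norm_def using p_bounds[OF j] finite_parts[OF j] v f
  by (intro lp_norm_le_weighted) auto

text \<open>The first and third inequality compare the two norms on \<open>E\<close>; the second
  admits every \<open>g\<close> and yields the bound of the form on \<open>Y\<close>. The third is
  the second at \<open>g = f\<close> after cancelling one factor.\<close>

lemma good_densityD:
  fixes f g :: "nat \<Rightarrow> 'k::{real_normed_field,euclidean_space}"
  assumes j: "j \<ge> 1" and gd: "good_density E M j v" and f: "f \<in> E"
  shows "L j f \<le> weighted_norm j v f"
    and "(\<Sum>A\<in>\<Delta> j. v A powr (- h j) * L2_set (\<lambda>k. norm (f k)) A * L2_set (\<lambda>k. norm (g k)) A)
      \<le> M * weighted_norm j v f * L j g"
    and "weighted_norm j v f \<le> M * L j f"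
proof -
  have v: "\<And>A. A \<in> \<Delta> j \<Longrightarrow> v A \<ge> 0" "(\<Sum>A\<in>\<Delta> j. v A) \<le> 1"
    and v0: "\<And>A. A \<in> \<Delta> j \<Longrightarrow> v A = 0 \<Longrightarrow> L2_set (\<lambda>k. norm (f k)) A = 0"
    using gd f unfolding good_density_def by blast+
  obtain \<kappa> where \<kappa>: "\<kappa> > 0" "\<kappa> powr h j \<le> M"
    "\<And>A. A \<in> \<Delta> j \<Longrightarrow> L2_set (\<lambda>k. norm (f k)) A \<le> \<kappa> * v A powr (1 / p j) * weighted_norm j v f"
    using gd f unfolding good_density_def by blast
  show "L j f \<le> weighted_norm j v f" by (rule L_le_weighted_norm[OF j v v0])
  have le: "(\<Sum>A\<in>\<Delta> j. v A powr (- h j) * L2_set (\<lambda>k. norm (f k)) A * L2_set (\<lambda>k. norm (g k)) A)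
      \<le> M * weighted_norm j v f * L j g" for g :: "nat \<Rightarrow> 'k"
  proof -
    have "(\<Sum>A\<in>\<Delta> j. v A powr (- h j) * L2_set (\<lambda>k. norm (f k)) A * L2_set (\<lambda>k. norm (g k)) A)
      \<le> \<kappa> powr h j * weighted_norm j v f * lp_norm (p j) (\<Delta> j) (L2_set (\<lambda>k. norm (g k)))"
      using p_bounds[OF j] finite_parts[OF j] v \<kappa>(1,3)
      by (intro weighted_sum_le_lp_norm) (auto simp: weighted_norm_def)
    also have "\<dots> \<le> M * weighted_norm j v f * L j g"
      unfolding layer_norm_def[symmetric] using \<kappa>(2) by (intro mult_right_mono) auto
    finally show ?thesis .
  qed
  show "(\<Sum>A\<in>\<Delta> j. v A powr (- h j) * L2_set (\<lambda>k. norm (f k)) A * L2_set (\<lambda>k. norm (g k)) A)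
      \<le> M * weighted_norm j v f * L j g" by (rule le)
  have "weighted_norm j v f * weighted_norm j v f = (\<Sum>A\<in>\<Delta> j. v A powr (- h j) * (L2_set (\<lambda>k. norm (f k)) A)\<^sup>2)"
    unfolding weighted_norm_def by (simp add: sum_nonneg)
  also have "\<dots> \<le> M * weighted_norm j v f * L j f" using le[of f] by (simp add: power2_eq_square mult.assoc)
  finally have sq: "weighted_norm j v f * weighted_norm j v f \<le> weighted_norm j v f * (M * L j f)"
    by (simp add: mult_ac)
  show "weighted_norm j v f \<le> M * L j f"
  proof (cases "weighted_norm j v f = 0")
    case True
    have "0 \<le> M" using \<kappa>(2) powr_ge_zero order_trans by blast
    thus ?thesis using True by simp
  next
    case False
    hence "weighted_norm j v f > 0" by (simp add: less_le)
    thus ?thesis using sq by simp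
  qed
qed

section \<open>Gluing the layers into one Hermitian form\<close>

definition layer_form ::
    "nat \<Rightarrow> (nat set \<Rightarrow> real) \<Rightarrow> (nat \<Rightarrow> 'k) \<Rightarrow> (nat \<Rightarrow> 'k) \<Rightarrow> 'k::{real_normed_field,euclidean_space}"
  where "layer_form j v g f = (\<Sum>A\<in>\<Delta> j. of_real (v A powr (- h j)) * (\<Sum>k\<in>A. g k * cnj_scalar (f k)))"

lemma layer_form_add_left: "layer_form j v (g + g') f = layer_form j v g f + layer_form j v g' f"
  by (simp add: layer_form_def distrib_right distrib_left sum.distrib)

lemma layer_form_scale_left: "layer_form j v (c *\<^sub>q g) f = c * layer_form j v g f"
  unfolding layer_form_def seq_scale_def sum_distrib_left by (simp only: mult_ac)

lemma layer_form_hermitian: "layer_form j v g f = cnj_scalar (layer_form j v f g)"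
  by (simp add: layer_form_def cnj_scalar_sum cnj_scalar_mult mult_ac)

lemma layer_form_diag: "layer_form j v f f = of_real ((weighted_norm j v f)\<^sup>2)"
proof -
  have "layer_form j v f f = of_real (\<Sum>A\<in>\<Delta> j. v A powr (- h j) * (\<Sum>k\<in>A. (norm (f k))\<^sup>2))"
    by (simp add: layer_form_def mult_cnj_scalar)
  also have "(\<Sum>A\<in>\<Delta> j. v A powr (- h j) * (\<Sum>k\<in>A. (norm (f k))\<^sup>2)) = (weighted_norm j v f)\<^sup>2"
    unfolding weighted_norm_def L2_set_def by (simp add: sum_nonneg)
  finally show ?thesis .
qed

lemma norm_layer_form:
  "norm (layer_form j v g f)
    \<le> (\<Sum>A\<in>\<Delta> j. v A powr (- h j) * L2_set (\<lambda>k. norm (f k)) A * L2_set (\<lambda>k. norm (g k)) A)"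
  unfolding layer_form_def
proof (rule sum_norm_le)
  fix A
  have "norm (\<Sum>k\<in>A. g k * cnj_scalar (f k)) \<le> (\<Sum>k\<in>A. \<bar>norm (g k)\<bar> * \<bar>norm (f k)\<bar>)"
    by (intro sum_norm_le) (simp add: norm_mult)
  also have "\<dots> \<le> L2_set (\<lambda>k. norm (g k)) A * L2_set (\<lambda>k. norm (f k)) A" by (rule L2_set_mult_ineq)
  finally have "norm (\<Sum>k\<in>A. g k * cnj_scalar (f k)) \<le> L2_set (\<lambda>k. norm (g k)) A * L2_set (\<lambda>k. norm (f k)) A" .
  hence "v A powr (- h j) * norm (\<Sum>k\<in>A. g k * cnj_scalar (f k))
      \<le> v A powr (- h j) * (L2_set (\<lambda>k. norm (g k)) A * L2_set (\<lambda>k. norm (f k)) A)"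
    by (intro mult_left_mono) auto
  thus "norm (of_real (v A powr (- h j)) * (\<Sum>k\<in>A. g k * cnj_scalar (f k)))
      \<le> v A powr (- h j) * L2_set (\<lambda>k. norm (f k)) A * L2_set (\<lambda>k. norm (g k)) A"
    unfolding norm_mult norm_of_real by (simp add: mult_ac)
qed

text \<open>For \<open>f\<close> in \<open>E\<close> the weighted norms are square summable, being
  at most \<open>M\<close> times the layer norms. Against the square summable layer norms of any
  \<open>g\<close> in \<open>Y\<close>, Cauchy-Schwarz makes the sum of the layer forms converge
  absolutely, with bound \<open>M * q f * nY g\<close>.\<close>

lemma hilbertian_subspace:
  fixes E :: "(nat \<Rightarrow> 'k::{real_normed_field,euclidean_space}) set"
  assumes E: "seqs.subspace E" "E \<subseteq> X" "seqs.dim E > 0" and M: "M \<ge> 0"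
    and gd: "\<And>j. j \<ge> 1 \<Longrightarrow> good_density E M j (v j)"
  shows "banach_mazur E nY (ell2 (seqs.dim E)) (ell2_norm (seqs.dim E)) \<le> ennreal M"
    and "complemented M E Y nY" and "complemented M E X nY"
proof -
  define w where "w f j = weighted_norm j (v j) f" for f :: "nat \<Rightarrow> 'k" and j
  define H where "H g f = (\<Sum>\<^sub>\<infinity>j\<in>{1..}. layer_form j (v j) g f)" for g f :: "nat \<Rightarrow> 'k"
  define q where "q f = sqrt (\<Sum>\<^sub>\<infinity>j\<in>{1..}. (w f j)\<^sup>2)" for f
  have EY: "f \<in> Y" if "f \<in> E" for f using that E(2) X_subset_Y by blast
  have w0: "w f j \<ge> 0" for f j by (simp add: w_def)
  have wsum: "(\<lambda>j. (w f j)\<^sup>2) summable_on {1..}" if f: "f \<in> E" for f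
  proof (rule summable_on_comparison_test)
    show "(\<lambda>j. M\<^sup>2 * (L j f)\<^sup>2) summable_on {1..}"
      using EY[OF f] by (intro summable_on_cmult_right) (auto simp: mem_Y)
    show "(w f j)\<^sup>2 \<le> M\<^sup>2 * (L j f)\<^sup>2" if "j \<in> {1..}" for j
      unfolding power_mult_distrib[symmetric] w_def
      using good_densityD(3)[OF _ gd f] that by (intro power_mono) auto
  qed auto
  have q0: "q f \<ge> 0" for f unfolding q_def by (intro real_sqrt_ge_zero infsum_nonneg) auto
  have q2: "(q f)\<^sup>2 = (\<Sum>\<^sub>\<infinity>j\<in>{1..}. (w f j)\<^sup>2)" for f
    unfolding q_def by (intro real_sqrt_pow2 infsum_nonneg) auto
  have form_le: "norm (layer_form j (v j) g f) \<le> M * (w f j * L j g)" if "j \<ge> 1" "f \<in> E" for j g f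
    using norm_layer_form[of j "v j" g f] good_densityD(2)[OF that(1) gd[OF that(1)] that(2), of g]
    by (simp add: w_def mult.assoc)
  have fin: "(\<Sum>j\<in>F. w f j * L j g) \<le> q f * nY g"
    if f: "f \<in> E" and g: "g \<in> Y" and F: "finite F" "F \<subseteq> {1..}" for f g F
  proof -
    have "(\<Sum>j\<in>F. w f j * L j g) = (\<Sum>j\<in>F. \<bar>w f j\<bar> * \<bar>L j g\<bar>)" using w0 by simp
    also have "\<dots> \<le> L2_set (w f) F * L2_set (\<lambda>j. L j g) F" by (rule L2_set_mult_ineq)
    also have "\<dots> \<le> q f * nY g"
    proof (intro mult_mono L2_set_le_nY g F q0 L2_set_nonneg)
      show "L2_set (w f) F \<le> q f" unfolding L2_set_def q_def
        by (intro real_sqrt_le_mono finite_sum_le_infsum wsum f F) auto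
    qed
    finally show ?thesis .
  qed
  have prod_sum: "(\<lambda>j. w f j * L j g) summable_on {1..}" if "f \<in> E" "g \<in> Y" for f g
    using fin[OF that] w0 by (intro nonneg_bdd_above_summable_on bdd_aboveI2[where M = "q f * nY g"]) auto
  have prod_le: "(\<Sum>\<^sub>\<infinity>j\<in>{1..}. w f j * L j g) \<le> q f * nY g" if "f \<in> E" "g \<in> Y" for f g
    using fin[OF that] by (intro infsum_le_finite_sums prod_sum that) auto
  have abs_form: "(\<lambda>j. norm (layer_form j (v j) g f)) summable_on {1..}" if "f \<in> E" "g \<in> Y" for f g
  proof (rule summable_on_comparison_test)
    show "(\<lambda>j. M * (w f j * L j g)) summable_on {1..}" by (intro summable_on_cmult_right prod_sum that)
    show "norm (layer_form j (v j) g f) \<le> M * (w f j * L j g)" if "j \<in> {1..}" for j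
      using that \<open>f \<in> E\<close> by (intro form_le) auto
  qed auto
  have form_sum: "(\<lambda>j. layer_form j (v j) g f) summable_on {1..}" if "f \<in> E" "g \<in> Y" for f g
    using abs_form[OF that] by (rule abs_summable_summable)
  have herm: "H g f = cnj_scalar (H f g)" if "g \<in> Y" "f \<in> Y" "(\<lambda>j. layer_form j (v j) f g) summable_on {1..}" for g f
  proof -
    have "cnj_scalar (H f g) = (\<Sum>\<^sub>\<infinity>j\<in>{1..}. cnj_scalar (layer_form j (v j) f g))"
      unfolding H_def using infsumI[OF has_sum_bounded_linear[OF bounded_linear_cnj_scalar has_sum_infsum[OF that(3)]]]
      by (simp add: o_def)
    also have "\<dots> = H g f" unfolding H_def by (intro infsum_cong) (rule layer_form_hermitian[symmetric])
    finally show ?thesis by simp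
  qed
  have bd: "norm (H g f) \<le> M * q f * nY g" if g: "g \<in> Y" and f: "f \<in> E" for g f
  proof -
    have "norm (H g f) \<le> (\<Sum>\<^sub>\<infinity>j\<in>{1..}. norm (layer_form j (v j) g f))"
      unfolding H_def by (rule norm_infsum_bound[OF abs_form[OF f g]])
    also have "\<dots> \<le> (\<Sum>\<^sub>\<infinity>j\<in>{1..}. M * (w f j * L j g))"
      by (intro infsum_mono abs_form[OF f g] summable_on_cmult_right prod_sum f g form_le) auto
    also have "\<dots> = M * (\<Sum>\<^sub>\<infinity>j\<in>{1..}. w f j * L j g)" by (rule infsum_cmult_right')
    also have "\<dots> \<le> M * (q f * nY g)" by (intro mult_left_mono prod_le f g M)
    finally show ?thesis by (simp add: mult.assoc)
  qed
  have le: "nY f \<le> q f" if f: "f \<in> E" for f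
    unfolding nY_eq q_def
  proof (intro real_sqrt_le_mono infsum_mono wsum f)
    show "(\<lambda>j. (L j f)\<^sup>2) summable_on {1..}" using EY[OF f] by (simp add: mem_Y)
    show "(L j f)\<^sup>2 \<le> (w f j)\<^sup>2" if "j \<in> {1..}" for j
      unfolding w_def using good_densityD(1)[OF _ gd f] that by (intro power_mono) auto
  qed
  have sub: "E \<subseteq> Y" "E \<subseteq> X" using E(2) X_subset_Y by blast+
  interpret hermitian_form Y E nY q H M
  proof
    show "seqs.subspace (Y :: (nat \<Rightarrow> 'k) set)" by (rule subspace_Y)
    show "seqs.subspace E" "seqs.dim E > 0" "E \<subseteq> Y" using E EY by auto
  next
    fix g g' f :: "nat \<Rightarrow> 'k" assume g: "g \<in> Y" "g' \<in> Y" "f \<in> E"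
    show "H (g + g') f = H g f + H g' f"
      unfolding H_def layer_form_add_left by (intro infsum_add form_sum g)
  next
    fix c and g f :: "nat \<Rightarrow> 'k" assume "g \<in> Y" "f \<in> E"
    show "H (c *\<^sub>q g) f = c * H g f"
      unfolding H_def layer_form_scale_left by (rule infsum_cmult_right')
  next
    fix g f f' :: "nat \<Rightarrow> 'k" assume g: "g \<in> Y" "f \<in> E" "f' \<in> E"
    have "layer_form j (v j) g (f + f') = layer_form j (v j) g f + layer_form j (v j) g f'" for j
      by (simp add: layer_form_hermitian[of j "v j" g] layer_form_add_left cnj_scalar_add)
    thus "H g (f + f') = H g f + H g f'"
      unfolding H_def by (simp only:) (intro infsum_add form_sum g)
  next
    fix c and g f :: "nat \<Rightarrow> 'k" assume g: "g \<in> Y" "f \<in> E"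
    have "layer_form j (v j) g (c *\<^sub>q f) = cnj_scalar c * layer_form j (v j) g f" for j
      by (simp add: layer_form_hermitian[of j "v j" g] layer_form_scale_left cnj_scalar_mult)
    thus "H g (c *\<^sub>q f) = cnj_scalar c * H g f"
      unfolding H_def by (simp only:) (rule infsum_cmult_right')
  next
    fix g f :: "nat \<Rightarrow> 'k" assume gf: "g \<in> E" "f \<in> E"
    thus "H g f = cnj_scalar (H f g)" by (intro herm form_sum EY)
  next
    fix f :: "nat \<Rightarrow> 'k" assume f: "f \<in> E"
    have "H f f = (\<Sum>\<^sub>\<infinity>j\<in>{1..}. of_real ((w f j)\<^sup>2))"
      unfolding H_def w_def layer_form_diag ..
    also have "\<dots> = of_real (\<Sum>\<^sub>\<infinity>j\<in>{1..}. (w f j)\<^sup>2)"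
      using infsumI[OF has_sum_bounded_linear[OF bounded_linear_of_real has_sum_infsum[OF wsum[OF f]]]]
      by (simp only: o_def)
    finally show "H f f = of_real ((q f)\<^sup>2)" by (simp only: q2)
    show "0 \<le> q f" by (rule q0)
    show "nY f \<le> q f" by (rule le[OF f])
    show "f = 0" if "q f = 0"
    proof -
      have "nY f = 0" using le[OF f] that nY_nonneg[of f] by linarith
      thus ?thesis using nY_eq_0[OF EY[OF f]] by simp
    qed
  next
    show "0 \<le> M" by (rule M)
    fix g f :: "nat \<Rightarrow> 'k" assume "g \<in> Y" "f \<in> E"
    thus "norm (H g f) \<le> M * q f * nY g" by (rule bd)
  qed (rule nY_nonneg)
  show "banach_mazur E nY (ell2 (seqs.dim E)) (ell2_norm (seqs.dim E)) \<le> ennreal M"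
    by (rule banach_mazur_le)
  show "complemented M E Y nY" "complemented M E X nY"
    by (intro complemented sub X_subset_Y subset_refl)+
qed

text \<open>On \<open>E\<close> the layer norm is only a seminorm, so \<open>d\<close> may be
  smaller than the dimension of \<open>E\<close>. Pivots inside the layer identify the restriction
  of \<open>E\<close> with scalar tuples, and \<open>near_auerbach\<close> is applied to the image
  of the unit ball.\<close>

lemma layer_auerbach:
  fixes E :: "(nat \<Rightarrow> 'k::{real_normed_field,euclidean_space}) set"
  assumes j: "j \<ge> 1" and E: "seqs.subspace E" "seqs.dim E > 0"
  shows "\<exists>d \<phi>. d \<le> seqs.dim E \<and> (\<forall>k<d. \<phi> k \<in> E \<and> L j (\<phi> k) \<le> 1) \<and>
    (\<forall>f\<in>E. \<exists>c. (\<forall>k<d. norm (c k) \<le> 2 * L j f) \<and> (\<forall>i\<in>dyadic j. f i = (\<Sum>k<d. c k * \<phi> k i)))"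
proof -
  obtain B where B: "B \<subseteq> E" "seqs.independent B" "E \<subseteq> seqs.span B" "card B = seqs.dim E"
    by (rule seqs.basis_exists)
  have finB: "finite B" using B(4) E(2) by (metis card.infinite less_nat_zero_code)
  have spB: "seqs.span B = E" using B(1,3) E(1) by (intro seqs.span_subspace)
  define r :: "(nat \<Rightarrow> 'k) \<Rightarrow> nat \<Rightarrow> 'k" where "r = seq_restrict (dyadic j)"
  have rspan: "seqs.span (r ` B) = r ` E" unfolding r_def span_seq_restrict spB ..
  have finrB: "finite (r ` B)" using finB by simp
  obtain J g where J: "finite J" "card J \<le> card (r ` B)" "\<forall>i\<in>J. g i \<in> seqs.span (r ` B)"
    "\<forall>i\<in>J. \<forall>k\<in>J. g i k = (if k = i then 1 else 0)"
    "\<forall>u\<in>seqs.span (r ` B). u = (\<Sum>i\<in>J. u i *\<^sub>q g i)"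
    using span_coordinates[OF finrB] by (elim exE conjE)
  have "\<forall>i\<in>J. \<exists>f\<in>E. g i = r f" using J(3) unfolding rspan by blast
  then obtain \<psi> where \<psi>: "\<And>i. i \<in> J \<Longrightarrow> \<psi> i \<in> E" "\<And>i. i \<in> J \<Longrightarrow> g i = r (\<psi> i)" by metis
  have Jd: "i \<in> dyadic j" if "i \<in> J" for i
  proof (rule ccontr)
    assume "i \<notin> dyadic j"
    hence "g i i = 0" using \<psi>(2)[OF that] by (simp add: r_def seq_restrict_def)
    thus False using J(4) that by simp
  qed
  \<comment> \<open>The pivot entries determine an element of \<open>E\<close> on the whole layer,
    which carries the expansion from the pivots to all of \<open>dyadic j\<close>.\<close>
  have vanish: "u i = 0" if u: "u \<in> E" "\<And>i. i \<in> J \<Longrightarrow> u i = 0" and i: "i \<in> dyadic j" for u i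
  proof -
    have "r u \<in> seqs.span (r ` B)" unfolding rspan using u(1) by (rule imageI)
    hence "r u = (\<Sum>k\<in>J. r u k *\<^sub>q g k)" using J(5) by blast
    also have "\<dots> = (\<Sum>k\<in>J. 0)"
      using u(2) Jd by (intro sum.cong) (auto simp: r_def seq_restrict_def seq_scale_def fun_eq_iff)
    finally have "r u i = 0" by simp
    thus ?thesis using i by (simp add: r_def seq_restrict_def)
  qed
  define d where "d = card J"
  obtain e where e: "bij_betw e {0..<d} J" using ex_bij_betw_nat_finite[OF J(1)] by (auto simp: d_def)
  have eJ: "e i \<in> J" if "i < d" for i using e that by (auto simp: bij_betw_def)
  have einj: "e i = e k \<longleftrightarrow> i = k" if "i < d" "k < d" for i k
    using e that by (auto simp: bij_betw_def inj_on_def)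
  have dn: "d \<le> seqs.dim E" using J(2) card_image_le[OF finB, of r] B(4) by (simp add: d_def)
  define S where "S = (\<lambda>f i. f (e i)) ` {f \<in> E. L j f \<le> 1}"
  \<comment> \<open>Shrinks the lifted dual basis into the unit ball of the layer; the added 1 keeps
    the denominator positive.\<close>
  define t where "t = 1 / (1 + (\<Sum>k<d. L j (\<psi> (e k))))"
  have tpos: "1 + (\<Sum>k<d. L j (\<psi> (e k))) > 0" by (intro add_pos_nonneg sum_nonneg) auto
  hence t0: "t > 0" by (simp add: t_def)
  have unit: "\<exists>x\<in>S. \<forall>i<d. x i = (if i = k then of_real t else 0)" if k: "k < d" for k
  proof -
    define f where "f = of_real t *\<^sub>q \<psi> (e k)"
    have fE: "f \<in> E" unfolding f_def by (intro seqs.subspace_scale[OF E(1)] \<psi> eJ k)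
    have "L j f = t * L j (\<psi> (e k))" unfolding f_def L_scale[OF j] norm_of_real using t0 by simp
    also have "\<dots> \<le> t * (1 + (\<Sum>k<d. L j (\<psi> (e k))))"
      using t0 k member_le_sum[of k "{..<d}" "\<lambda>k. L j (\<psi> (e k))"] by (intro mult_left_mono) auto
    also have "\<dots> = 1" using tpos by (simp add: t_def)
    finally have "L j f \<le> 1" .
    moreover have "f (e i) = (if i = k then of_real t else 0)" if i: "i < d" for i
    proof -
      have "\<psi> (e k) (e i) = g (e k) (e i)"
        using \<psi>(2)[OF eJ[OF k]] Jd[OF eJ[OF i]] by (simp add: r_def seq_restrict_def)
      also have "\<dots> = (if i = k then 1 else 0)" using J(4) eJ i k einj by simp
      finally show ?thesis by (simp add: f_def seq_scale_def)
    qed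
    ultimately show ?thesis using fE by (intro bexI[of _ "\<lambda>i. f (e i)"]) (auto simp: S_def)
  qed
  have bdd: "norm (x i) \<le> 1" if x: "x \<in> S" "i < d" for x i
  proof -
    obtain f where f: "f \<in> E" "L j f \<le> 1" "x = (\<lambda>i. f (e i))" using x(1) by (auto simp: S_def)
    have "norm (f (e i)) \<le> L j f" by (rule norm_le_L[OF j Jd[OF eJ[OF x(2)]]])
    thus ?thesis using f by simp
  qed
  have tn: "of_real t \<noteq> (0 :: 'k)" using t0 by simp
  have "\<exists>F. (\<forall>k<d. F k \<in> S) \<and>
      (\<forall>x\<in>S. \<exists>c. (\<forall>k<d. norm (c k) \<le> 2) \<and> (\<forall>i<d. x i = (\<Sum>k<d. c k * F k i)))"
  proof (rule near_auerbach[where r = "of_real t" and M = 1])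
    show "norm (x i) \<le> 1" if "x \<in> S" "i < d" for x i by (rule bdd[OF that])
    show "\<exists>x\<in>S. \<forall>i<d. x i = (if i = k then of_real t else 0)" if "k < d" for k by (rule unit[OF that])
  qed (rule tn)
  then obtain F where F: "\<And>k. k < d \<Longrightarrow> F k \<in> S"
    "\<And>x. x \<in> S \<Longrightarrow> \<exists>c. (\<forall>k<d. norm (c k) \<le> 2) \<and> (\<forall>i<d. x i = (\<Sum>k<d. c k * F k i))"
    by blast
  have "\<forall>k\<in>{..<d}. \<exists>f. f \<in> E \<and> L j f \<le> 1 \<and> F k = (\<lambda>i. f (e i))" using F(1) by (auto simp: S_def)
  then obtain \<phi> where \<phi>: "\<forall>k\<in>{..<d}. \<phi> k \<in> E \<and> L j (\<phi> k) \<le> 1 \<and> F k = (\<lambda>i. \<phi> k (e i))"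
    by (rule bchoice[THEN exE])
  have expand: "\<exists>c. (\<forall>k<d. norm (c k) \<le> 2 * L j f) \<and> (\<forall>i\<in>dyadic j. f i = (\<Sum>k<d. c k * \<phi> k i))"
    if f: "f \<in> E" for f
  proof (cases "L j f = 0")
    case True
    hence "f i = 0" if "i \<in> dyadic j" for i using norm_le_L[OF j that, of f] by simp
    thus ?thesis by (intro exI[of _ "\<lambda>_. 0"]) (auto simp: True)
  next
    case False
    hence Lf: "L j f > 0" by (simp add: less_le)
    define f' where "f' = of_real (inverse (L j f)) *\<^sub>q f"
    have f'E: "f' \<in> E" unfolding f'_def by (intro seqs.subspace_scale[OF E(1)] f)
    have "L j f' = inverse (L j f) * L j f" unfolding f'_def L_scale[OF j] norm_of_real using Lf by simp
    hence "L j f' \<le> 1" using Lf by simp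
    hence "(\<lambda>i. f' (e i)) \<in> S" using f'E by (auto simp: S_def)
    then obtain c where c: "\<forall>k<d. norm (c k) \<le> 2" "\<forall>i<d. f' (e i) = (\<Sum>k<d. c k * F k i)"
      using F(2) by blast
    define u where "u = f' - (\<Sum>k<d. c k *\<^sub>q \<phi> k)"
    have uE: "u \<in> E" unfolding u_def using \<phi>
      by (intro seqs.subspace_diff[OF E(1) f'E] seqs.subspace_sum[OF E(1)] seqs.subspace_scale[OF E(1)]) auto
    have "u i = 0" if i: "i \<in> J" for i
    proof -
      obtain l where l: "l < d" "i = e l" using e i by (auto simp: bij_betw_def)
      have "f' i = (\<Sum>k<d. c k * \<phi> k i)" using c(2) l \<phi> by (auto intro!: sum.cong)
      thus ?thesis by (simp add: u_def sum_fun_apply seq_scale_def)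
    qed
    hence "u i = 0" if "i \<in> dyadic j" for i using vanish[OF uE] that by blast
    hence f'eq: "f' i = (\<Sum>k<d. c k * \<phi> k i)" if "i \<in> dyadic j" for i
      using that by (simp add: u_def sum_fun_apply seq_scale_def)
    have "f i = (\<Sum>k<d. (of_real (L j f) * c k) * \<phi> k i)" if "i \<in> dyadic j" for i
    proof -
      have "f i = of_real (L j f) * f' i" using Lf by (simp add: f'_def seq_scale_def)
      thus ?thesis unfolding f'eq[OF that] by (simp add: sum_distrib_left mult_ac)
    qed
    moreover have "norm (of_real (L j f) * c k) \<le> 2 * L j f" if "k < d" for k
      unfolding norm_mult norm_of_real using c(1) that Lf by (simp add: mult_left_mono mult.commute)
    ultimately show ?thesis by (intro exI[of _ "\<lambda>k. of_real (L j f) * c k"]) blast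
  qed
  show ?thesis using dn \<phi> expand by (intro exI[of _ d] exI[of _ \<phi>]) auto
qed

text \<open>The density is the average of the p-th powers of the block norms of the basis vectors.
  Its mass is at most 1 because each of these vectors has layer norm at most 1, and each block norm
  is at most \<open>(n * v A) powr (1 / p j)\<close>. Coefficients bounded by
  \<open>2 * L j f\<close> then give the pointwise control of \<open>E\<close>.\<close>

lemma good_density_auerbach:
  fixes E :: "(nat \<Rightarrow> 'k::{real_normed_field,euclidean_space}) set"
  assumes j: "j \<ge> 1" and E: "seqs.subspace E" and n: "seqs.dim E = n" "n > 0"
    and M: "(2 * (real n)\<^sup>2) powr h j \<le> M"
  shows "\<exists>v. good_density E M j v"
proof -
  note pj = p_bounds[OF j]
  obtain d \<phi> where d: "d \<le> n" and \<phi>: "\<And>k. k < d \<Longrightarrow> \<phi> k \<in> E \<and> L j (\<phi> k) \<le> 1"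
    and ex: "\<forall>f\<in>E. \<exists>c. (\<forall>k<d. norm (c k) \<le> 2 * L j f) \<and> (\<forall>i\<in>dyadic j. f i = (\<Sum>k<d. c k * \<phi> k i))"
    using layer_auerbach[OF j E, unfolded n(1), OF n(2)] by blast
  define l where "l A k = L2_set (\<lambda>i. norm (\<phi> k i)) A" for A k
  define v where "v A = (\<Sum>k<d. l A k powr p j) / real n" for A
  have l0: "l A k \<ge> 0" for A k by (simp add: l_def)
  have v0: "v A \<ge> 0" for A unfolding v_def by (intro divide_nonneg_nonneg sum_nonneg) auto
  have "(\<Sum>A\<in>\<Delta> j. v A) = (\<Sum>k<d. \<Sum>A\<in>\<Delta> j. l A k powr p j) / real n"
    unfolding v_def sum_divide_distrib[symmetric] by (subst sum.swap) (rule refl)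
  also have "\<dots> \<le> (\<Sum>k<d. 1) / real n"
  proof (intro divide_right_mono sum_mono)
    fix k assume "k \<in> {..<d}"
    hence "L j (\<phi> k) powr p j \<le> 1 powr p j" using \<phi> pj by (intro powr_mono2) auto
    thus "(\<Sum>A\<in>\<Delta> j. l A k powr p j) \<le> 1"
      using pj by (simp add: layer_norm_def lp_norm_powr l_def)
  qed auto
  also have "\<dots> \<le> 1" using d n(2) by simp
  finally have vsum: "(\<Sum>A\<in>\<Delta> j. v A) \<le> 1" .
  have lv: "l A k \<le> real n powr (1 / p j) * v A powr (1 / p j)" if "k < d" for A k
  proof -
    have "l A k = (l A k powr p j) powr (1 / p j)" using pj l0 by (simp add: powr_powr)
    also have "\<dots> \<le> (\<Sum>k<d. l A k powr p j) powr (1 / p j)"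
      using that pj by (intro powr_mono2 member_le_sum) auto
    also have "(\<Sum>k<d. l A k powr p j) = real n * v A" using n(2) by (simp add: v_def)
    also have "(real n * v A) powr (1 / p j) = real n powr (1 / p j) * v A powr (1 / p j)" by (rule powr_mult)
    finally show ?thesis .
  qed
  have Lf: "L2_set (\<lambda>k. norm (f k)) A \<le> 2 * (real n)\<^sup>2 * v A powr (1 / p j) * L j f"
    if f: "f \<in> E" and A: "A \<in> \<Delta> j" for f A
  proof -
    obtain c where c: "\<And>k. k < d \<Longrightarrow> norm (c k) \<le> 2 * L j f" "\<And>i. i \<in> dyadic j \<Longrightarrow> f i = (\<Sum>k<d. c k * \<phi> k i)"
      using ex f by blast
    have sub: "L2_set (\<lambda>i. \<Sum>k\<in>T. norm (c k) * norm (\<phi> k i)) A \<le> (\<Sum>k\<in>T. norm (c k) * l A k)" if "finite T" for T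
      using that
    proof (induction T rule: finite_induct)
      case (insert k T)
      have "L2_set (\<lambda>i. \<Sum>k\<in>insert k T. norm (c k) * norm (\<phi> k i)) A
          = L2_set (\<lambda>i. norm (c k) * norm (\<phi> k i) + (\<Sum>k\<in>T. norm (c k) * norm (\<phi> k i))) A"
        using insert by simp
      also have "\<dots> \<le> L2_set (\<lambda>i. norm (c k) * norm (\<phi> k i)) A + L2_set (\<lambda>i. \<Sum>k\<in>T. norm (c k) * norm (\<phi> k i)) A"
        by (rule L2_set_triangle_ineq)
      also have "L2_set (\<lambda>i. norm (c k) * norm (\<phi> k i)) A = norm (c k) * l A k"
        unfolding l_def by (rule L2_set_right_distrib[symmetric]) simp
      finally show ?case using insert by simp
    qed (simp add: L2_set_def)
    have "L2_set (\<lambda>i. norm (f i)) A \<le> L2_set (\<lambda>i. \<Sum>k<d. norm (c k) * norm (\<phi> k i)) A"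
    proof (rule L2_set_mono)
      fix i assume "i \<in> A"
      hence "f i = (\<Sum>k<d. c k * \<phi> k i)" using c(2) part_subset[OF j A] by blast
      thus "norm (f i) \<le> (\<Sum>k<d. norm (c k) * norm (\<phi> k i))"
        using norm_sum[of "\<lambda>k. c k * \<phi> k i" "{..<d}"] by (simp add: norm_mult)
    qed simp
    also have "\<dots> \<le> (\<Sum>k<d. norm (c k) * l A k)" by (rule sub) simp
    also have "\<dots> \<le> (\<Sum>k<d. 2 * L j f * (real n powr (1 / p j) * v A powr (1 / p j)))"
      using c(1) lv l0 by (intro sum_mono mult_mono) auto
    also have "\<dots> = real d * real n powr (1 / p j) * (2 * v A powr (1 / p j) * L j f)" by simp
    \<comment> \<open>One factor \<open>n\<close> counts the summands, the other bounds
      \<open>n powr (1 / p j)\<close>; with the 2 of the coefficients this is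
      \<open>\<kappa> = 2 * n^2\<close>.\<close>
    also have "\<dots> \<le> real n * real n powr 1 * (2 * v A powr (1 / p j) * L j f)"
      using d n(2) pj by (intro mult_right_mono mult_mono powr_mono) auto
    also have "\<dots> = 2 * (real n)\<^sup>2 * v A powr (1 / p j) * L j f" using n(2) by (simp add: power2_eq_square)
    finally show ?thesis .
  qed
  have van: "L2_set (\<lambda>k. norm (f k)) A = 0" if "f \<in> E" "A \<in> \<Delta> j" "v A = 0" for f A
    using Lf[OF that(1,2)] that(3) by (intro antisym L2_set_nonneg) simp
  have "L2_set (\<lambda>k. norm (f k)) A \<le> 2 * (real n)\<^sup>2 * v A powr (1 / p j) * weighted_norm j v f"
    if f: "f \<in> E" and A: "A \<in> \<Delta> j" for f A
  proof -
    have "L j f \<le> weighted_norm j v f" using f van by (intro L_le_weighted_norm[OF j v0 vsum]) auto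
    hence "2 * (real n)\<^sup>2 * v A powr (1 / p j) * L j f \<le> 2 * (real n)\<^sup>2 * v A powr (1 / p j) * weighted_norm j v f"
      by (intro mult_left_mono) auto
    thus ?thesis using Lf[OF f A] by linarith
  qed
  moreover have "2 * (real n)\<^sup>2 > 0" using n(2) by simp
  ultimately have "good_density E M j v"
    unfolding good_density_def using v0 vsum van M by blast
  thus ?thesis by blast
qed

text \<open>With density \<open>1 / N\<close> the weighted norm is \<open>N powr (h j / 2)\<close>
  times the l2 norm over the blocks, and this factor cancels
  \<open>sqrt N * v A powr (1 / p j)\<close>. The required bound then says that one block is
  dominated by the l2 sum of all blocks.\<close>

lemma good_density_uniform:
  fixes E :: "(nat \<Rightarrow> 'k::{real_normed_field,euclidean_space}) set"
  assumes j: "j \<ge> 1" and M: "real (card (\<Delta> j)) powr (h j / 2) \<le> M"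
  shows "\<exists>v. good_density E M j v"
proof -
  note pj = p_bounds[OF j]
  define N where "N = real (card (\<Delta> j))"
  have "\<Delta> j \<noteq> {}" using part_cover[OF j, of "2 ^ j"] by (auto simp: dyadic_def)
  hence N: "N > 0" using finite_parts[OF j] by (simp add: N_def card_gt_0_iff)
  define v where "v A = 1 / N" for A :: "nat set"
  have "L2_set (\<lambda>k. norm (f k)) A \<le> sqrt N * v A powr (1 / p j) * weighted_norm j v f"
    if A: "A \<in> \<Delta> j" for f :: "nat \<Rightarrow> 'k" and A
  proof -
    have "N powr h j * (L2_set (\<lambda>k. norm (f k)) A)\<^sup>2 = v A powr (- h j) * (L2_set (\<lambda>k. norm (f k)) A)\<^sup>2"
    proof -
      have "(1 / N) powr (- x) = N powr x" for x using N by (simp add: powr_divide powr_minus_divide)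
      thus ?thesis unfolding v_def by (simp only:)
    qed
    also have "\<dots> \<le> (\<Sum>A\<in>\<Delta> j. v A powr (- h j) * (L2_set (\<lambda>k. norm (f k)) A)\<^sup>2)"
      using A finite_parts[OF j] by (intro member_le_sum[of A "\<Delta> j"]) auto
    finally have "sqrt (N powr h j * (L2_set (\<lambda>k. norm (f k)) A)\<^sup>2) \<le> weighted_norm j v f"
      unfolding weighted_norm_def by (rule real_sqrt_le_mono)
    hence le: "N powr (h j / 2) * L2_set (\<lambda>k. norm (f k)) A \<le> weighted_norm j v f"
    proof -
      have "sqrt (N powr x) = N powr (x / 2)" for x by (simp add: powr_half_sqrt[symmetric] powr_powr)
      moreover assume "sqrt (N powr h j * (L2_set (\<lambda>k. norm (f k)) A)\<^sup>2) \<le> weighted_norm j v f"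
      ultimately show ?thesis by (simp only: real_sqrt_mult) simp
    qed
    have "sqrt N * v A powr (1 / p j) = N powr (1 / 2 - 1 / p j)"
      using N by (simp add: v_def powr_divide powr_diff powr_half_sqrt)
    also have "\<dots> = N powr (- (h j / 2))" by (simp add: algebra_simps diff_divide_distrib)
    also have "\<dots> = 1 / N powr (h j / 2)" by (simp add: powr_minus_divide)
    finally have eq: "sqrt N * v A powr (1 / p j) = 1 / N powr (h j / 2)" .
    have "L2_set (\<lambda>k. norm (f k)) A \<le> weighted_norm j v f / N powr (h j / 2)"
      using le N by (subst pos_le_divide_eq) (auto simp: mult.commute)
    thus ?thesis unfolding eq by simp
  qed
  moreover have "sqrt N powr h j \<le> M"
    using M N by (simp add: N_def[symmetric] powr_powr flip: powr_half_sqrt)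
  moreover have "(\<Sum>A\<in>\<Delta> j. v A) \<le> 1" using N by (simp add: v_def N_def)
  moreover have "sqrt N > 0" "v A \<ge> 0" "v A \<noteq> 0" for A using N by (auto simp: v_def)
  ultimately have "good_density E M j v"
    unfolding good_density_def by blast
  thus ?thesis by blast
qed

end

section \<open>Choice of the density in each layer\<close>

context szankowski
begin

lemma card_parts_le:
  assumes j: "j \<ge> 1"
  shows "real (card (\<Delta> j)) \<le> 2 powr (real j / 8) / C"
proof -
  \<comment> \<open>Hypothesis \<open>c\<close> bounds \<open>card A\<close> from below only in the
    presence of a block of \<open>Nabla j\<close>.\<close>
  obtain B where B: "B \<in> Nabla j" using Nabla[OF j] partition_onD1[OF Nabla[OF j]] by (force simp: dyadic_def)
  have U: "\<Union> (\<Delta> j) = dyadic j" using part[OF j] partition_onD1 by blast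
  have "real (card (\<Delta> j)) * (C * 2 powr (7 * real j / 8)) = (\<Sum>A\<in>\<Delta> j. C * 2 powr (7 * real j / 8))" by simp
  also have "\<dots> \<le> (\<Sum>A\<in>\<Delta> j. real (card A))" using c[OF j _ B] by (intro sum_mono) blast
  also have "\<dots> = real (card (\<Union> (\<Delta> j)))"
    unfolding of_nat_sum[symmetric] using part[OF j] finite_part[OF j]
    by (subst card_Union_disjoint) (auto simp: partition_on_def disjoint_def pairwise_def disjnt_def)
  also have "\<dots> = 2 powr real j" unfolding U card_dyadic by (simp add: powr_realpow)
  also have "\<dots> = 2 powr (real j / 8) * 2 powr (7 * real j / 8)" by (simp flip: powr_add)
  finally show ?thesis using C by (simp add: field_simps)
qed

text \<open>The calibration of the gap again, now applied to the upper bound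
  \<open>2 powr (j / 8) / C\<close> for the number of blocks; truncating the gap only helps
  here.\<close>

lemma uniform_constant:
  assumes j: "j \<ge> 1"
  shows "real (card (\<Delta> j)) powr (h j / 2) \<le> max 1 (C powr (- 1 / 2)) * real j powr (1 + \<epsilon>)"
proof -
  define g where "g = h j / 2"
  have g: "g = min (exponent_gap \<epsilon> j) (1 / 2)" using inverse_p_exp[of \<epsilon> j] by (simp add: g_def)
  have g0: "0 \<le> g" "g \<le> 1 / 2" "g \<le> exponent_gap \<epsilon> j" using exponent_gap_nonneg[OF eps j] by (auto simp: g)
  have "real (card (\<Delta> j)) powr g \<le> (2 powr (real j / 8) / C) powr g"
    using card_parts_le[OF j] g0 by (intro powr_mono2) auto
  also have "\<dots> = C powr (- g) * (2 powr (real j / 8)) powr g"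
    using C by (simp add: powr_divide powr_minus_divide)
  also have "\<dots> \<le> max 1 (C powr (- 1 / 2)) * real j powr (1 + \<epsilon>)"
  proof (intro mult_mono)
    show "C powr (- g) \<le> max 1 (C powr (- 1 / 2))"
    proof (cases "C \<ge> 1")
      case True
      have "C powr (- g) \<le> C powr 0" using True g0 by (intro powr_mono) auto
      thus ?thesis using C by simp
    next
      case False
      have "C powr (- g) \<le> C powr (- 1 / 2)" using False C g0 by (intro powr_mono') auto
      thus ?thesis by simp
    qed
    have "(2 powr (real j / 8)) powr g \<le> (2 powr (real j / 8)) powr exponent_gap \<epsilon> j"
      using g0 by (intro powr_mono ge_one_powr_ge_zero) auto
    thus "(2 powr (real j / 8)) powr g \<le> real j powr (1 + \<epsilon>)" unfolding two_powr_gap[OF j] .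
  qed auto
  finally show ?thesis by (simp add: g_def)
qed

text \<open>
  The uniform density serves the layers up to \<open>T = (48 / ln 2) * ln n\<close>, the Auerbach density
  the later ones, where the polynomial constant \<open>2 * n ^ 2\<close> is tamed by the small exponent.
\<close>

lemma auerbach_constant:
  assumes n: "n \<ge> 2" and j: "j \<ge> 1" and T: "T = 48 / ln 2 * ln (real n)" "real j \<ge> T"
  shows "(2 * (real n)\<^sup>2) powr h j \<le> T powr (1 + \<epsilon>)"
proof -
  have ln2: "ln 2 > (0::real)" by simp
  have lnn: "ln (real n) \<ge> ln 2" using n by simp
  hence "48 / ln 2 * ln (real n) \<ge> 48 / ln 2 * ln 2" by (intro mult_left_mono) auto
  hence T48: "T \<ge> 48" using T(1) ln2 by simp
  \<comment> \<open>From \<open>exp 1\<close> on, \<open>ln x / x\<close> is decreasing, so the gap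
    at \<open>j \<ge> T\<close> can be compared with its value at \<open>T\<close>.\<close>
  have eT: "exp 1 \<le> T" using T48 exp_le by linarith
  have h: "0 \<le> h j" "h j \<le> 2 * exponent_gap \<epsilon> j"
    using inverse_p_exp[of \<epsilon> j] p_bounds[OF j] by auto
  \<comment> \<open>\<open>n \<ge> 2\<close> absorbs the constant 2 into a third power of
    \<open>n\<close>.\<close>
  have "2 * (real n)\<^sup>2 \<le> real n * (real n)\<^sup>2" using n by (intro mult_right_mono) auto
  hence "(2 * (real n)\<^sup>2) powr h j \<le> (real n ^ 3) powr h j"
    using h by (intro powr_mono2) (auto simp: power2_eq_square power3_eq_cube)
  also have "\<dots> = real n powr (3 * h j)" using n by (simp add: powr_powr flip: powr_numeral)
  also have "\<dots> \<le> real n powr (6 * exponent_gap \<epsilon> j)" using n h by (intro powr_mono) auto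
  also have "\<dots> = exp (6 * exponent_gap \<epsilon> j * ln (real n))" using n by (simp add: powr_def)
  also have "\<dots> \<le> exp ((1 + \<epsilon>) * ln T)"
  proof -
    \<comment> \<open>Origin of 48: a factor 3 from the cube, 2 from
      \<open>h j \<le> 2 * exponent_gap \<epsilon> j\<close>, and 8 from the base of the logarithm.
      With it the coefficient is \<open>(1 + \<epsilon>) * T\<close>, and \<open>T\<close> cancels
      against \<open>ln T / T\<close>.\<close>
    have "ln (real j) / real j \<le> ln T / T" using eT T(2) by (intro ln_x_over_x_mono) auto
    hence "6 * ln (real n) * (8 * (1 + \<epsilon>) / ln 2) * (ln (real j) / real j)
        \<le> 6 * ln (real n) * (8 * (1 + \<epsilon>) / ln 2) * (ln T / T)"
      using eps lnn ln2 by (intro mult_left_mono mult_nonneg_nonneg divide_nonneg_nonneg) linarith+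
    moreover have "6 * ln (real n) * (8 * (1 + \<epsilon>) / ln 2) = (1 + \<epsilon>) * T" by (simp add: T(1))
    moreover have "(1 + \<epsilon>) * T * (ln T / T) = (1 + \<epsilon>) * ln T" using T48 by simp
    moreover have "6 * exponent_gap \<epsilon> j * ln (real n)
        = 6 * ln (real n) * (8 * (1 + \<epsilon>) / ln 2) * (ln (real j) / real j)"
      unfolding exponent_gap_eq[OF j] by simp
    ultimately show ?thesis by (simp only: exp_le_cancel_iff)
  qed
  also have "\<dots> = T powr (1 + \<epsilon>)" using T48 by (simp add: powr_def)
  finally show ?thesis .
qed

text \<open>The bound for the uniform density grows with \<open>j\<close> and the exponent of the
  Auerbach constant has a decreasing bound beyond the threshold. At \<open>T\<close> both costs are
  of order \<open>T powr (1 + \<epsilon>)\<close>, so this order is reached from either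
  side.\<close>

lemma good_density_exists:
  fixes E :: "(nat \<Rightarrow> 'l::{real_normed_field,euclidean_space}) set"
  assumes n: "n \<ge> 2" and j: "j \<ge> 1" and E: "seqs.subspace E" "seqs.dim E = n"
  shows "\<exists>v. good_density E (max 1 (C powr (- 1 / 2)) * (48 / ln 2) powr (1 + \<epsilon>) * ln (real n) powr (1 + \<epsilon>)) j v"
proof -
  define T where "T = 48 / ln 2 * ln (real n)"
  have M: "max 1 (C powr (- 1 / 2)) * (48 / ln 2) powr (1 + \<epsilon>) * ln (real n) powr (1 + \<epsilon>)
      = max 1 (C powr (- 1 / 2)) * T powr (1 + \<epsilon>)"
    unfolding T_def powr_mult by (simp only: mult.assoc)
  show ?thesis
  proof (cases "real j \<le> T")
    case True
    have "real j powr (1 + \<epsilon>) \<le> T powr (1 + \<epsilon>)" using True eps by (intro powr_mono2) auto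
    hence "max 1 (C powr (- 1 / 2)) * real j powr (1 + \<epsilon>) \<le> max 1 (C powr (- 1 / 2)) * T powr (1 + \<epsilon>)"
      by (intro mult_left_mono) auto
    thus ?thesis unfolding M by (intro good_density_uniform j order_trans[OF uniform_constant[OF j]])
  next
    case False
    have "(2 * (real n)\<^sup>2) powr h j \<le> 1 * T powr (1 + \<epsilon>)"
      using auerbach_constant[OF n j T_def] False by simp
    also have "\<dots> \<le> max 1 (C powr (- 1 / 2)) * T powr (1 + \<epsilon>)" by (intro mult_right_mono) auto
    finally show ?thesis unfolding M using n by (intro good_density_auerbach[OF j E]) auto
  qed
qed

lemma subspaces_hilbertian:
  "\<exists>K>0. \<forall>n\<ge>2. \<forall>E :: (nat \<Rightarrow> 'l::{real_normed_field,euclidean_space}) set.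
     seqs.subspace E \<and> E \<subseteq> X \<and> seqs.dim E = n \<longrightarrow>
       banach_mazur E nY (ell2 n) (ell2_norm n) \<le> ennreal (K * ln (real n) powr (1 + \<epsilon>)) \<and>
       complemented (K * ln (real n) powr (1 + \<epsilon>)) E Y nY \<and>
       complemented (K * ln (real n) powr (1 + \<epsilon>)) E X nY"
proof -
  define K where "K = max 1 (C powr (- 1 / 2)) * (48 / ln 2) powr (1 + \<epsilon>)"
  have K: "K > 0" unfolding K_def by (intro mult_pos_pos) auto
  have "banach_mazur E nY (ell2 n) (ell2_norm n) \<le> ennreal (K * ln (real n) powr (1 + \<epsilon>)) \<and>
       complemented (K * ln (real n) powr (1 + \<epsilon>)) E Y nY \<and>
       complemented (K * ln (real n) powr (1 + \<epsilon>)) E X nY"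
    if n: "n \<ge> 2" and E: "seqs.subspace E" "E \<subseteq> X" "seqs.dim E = n"
    for n and E :: "(nat \<Rightarrow> 'l) set"
  proof -
    have "\<forall>j\<in>{1..}. \<exists>v. good_density E (K * ln (real n) powr (1 + \<epsilon>)) j v"
      using good_density_exists[OF n _ E(1,3)] unfolding K_def by auto
    then obtain v where v: "\<forall>j\<in>{1..}. good_density E (K * ln (real n) powr (1 + \<epsilon>)) j (v j)"
      by (rule bchoice[THEN exE])
    have pos: "seqs.dim E > 0" "K * ln (real n) powr (1 + \<epsilon>) \<ge> 0" using n E(3) K by auto
    have gd: "good_density E (K * ln (real n) powr (1 + \<epsilon>)) j (v j)" if "j \<ge> 1" for j using v that by auto
    show ?thesis using hilbertian_subspace[OF E(1,2) pos gd] unfolding E(3) by blast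
  qed
  thus ?thesis using K by blast
qed

end

theorem mainTheorem1:
  fixes \<epsilon> C :: real
    and \<Delta> Nabla :: "nat \<Rightarrow> nat set set"
    and m :: "nat \<Rightarrow> nat"
    and y :: "nat \<Rightarrow> nat \<Rightarrow> 'k::{real_normed_field,euclidean_space}"
  assumes "\<epsilon> > 0"
    and "C > 0"
    and "\<And>n. n \<ge> 1 \<Longrightarrow> partition_on (dyadic n) (\<Delta> n)"
    and "\<And>n. n \<ge> 1 \<Longrightarrow> partition_on (dyadic n) (Nabla n)"
    and "\<And>j. j \<ge> 1 \<Longrightarrow> y j \<in> W"
    and "\<And>n. n \<ge> 1 \<Longrightarrow> m n \<ge> 1"
    and a: "\<And>U n. \<lbrakk>linear_map W W U; n \<ge> 2\<rbrakk> \<Longrightarrow>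
          beta n U - beta (n - 1) U = (1 / 2 ^ (n + 1)) * (\<Sum>j\<in>dyadic (n + 1). U (y j) j)"
    and b: "\<And>n B. \<lbrakk>n \<ge> 1; B \<in> Nabla n\<rbrakk> \<Longrightarrow> card B = m n"
           "\<And>n. n \<ge> 1 \<Longrightarrow> real (m n) \<ge> C * 2 powr (real n / 8)"
    and c: "\<And>n A B. \<lbrakk>n \<ge> 1; A \<in> \<Delta> n; B \<in> Nabla n\<rbrakk> \<Longrightarrow>
          card (A \<inter> B) \<le> 1 \<and> real (card A) \<ge> C * 2 powr (7 * real n / 8)"
    and d: "\<And>n B s. \<lbrakk>n \<ge> 2; B \<in> Nabla n; \<forall>i\<in>B. s i \<in> {1, -1}\<rbrakk> \<Longrightarrow>
          \<exists>A \<eta>. (\<forall>j\<in>{1..10::nat}.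
                   (\<exists>D \<in> \<Delta> (n - 1) \<union> \<Delta> n \<union> \<Delta> (n + 1). A j \<subseteq> D) \<and>
                   card (A j) = card B \<and> (\<forall>i\<in>A j. \<eta> j i \<in> {1, -1})) \<and>
                (\<Sum>i\<in>B. s i *\<^sub>q y i) = (\<Sum>j=1..10. \<Sum>i\<in>A j. \<eta> j i *\<^sub>q unit_seq i)"
  shows "\<not> approximation_property (X_space \<epsilon> \<Delta> :: (nat \<Rightarrow> 'k) set) (Y_norm \<epsilon> \<Delta>) \<and>
    (\<exists>K>0. \<forall>n\<ge>2. \<forall>E :: (nat \<Rightarrow> 'k) set.
       seqs.subspace E \<and> E \<subseteq> X_space \<epsilon> \<Delta> \<and> seqs.dim E = n \<longrightarrow>
         banach_mazur E (Y_norm \<epsilon> \<Delta>) (ell2 n) (ell2_norm n) \<le> ennreal (K * ln (real n) powr (1 + \<epsilon>)) \<and>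
         complemented (K * ln (real n) powr (1 + \<epsilon>)) E (Y_space \<epsilon> \<Delta>) (Y_norm \<epsilon> \<Delta>) \<and>
         complemented (K * ln (real n) powr (1 + \<epsilon>)) E (X_space \<epsilon> \<Delta>) (Y_norm \<epsilon> \<Delta>))"
proof -
  interpret szankowski \<epsilon> \<Delta> C Nabla m y
    by unfold_locales (fact assms)+
  show ?thesis using no_approximation_property subspaces_hilbertian by (rule conjI)
qed

end
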